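(* For every $n\ge1$ and every $x\in X$, $$\omega(x;z)=\frac{1-q^{-1+2z_n}}{q^{2z_n}-q^{-1}}\,\omega(x;\tau(z)),\qquad \tau(z)=(z_1,\ldots,z_{n-1},-z_n).$$
   Context: Let $k$ be a finite extension of $\mathbb{Q}_p$, $p$ odd, $k'$ its unramified quadratic extension, $a\mapsto a^*$ the conjugation of $k'/k$ and $a^*$ also conjugate transpose. Let $\pi$ be a prime of $k$, $q$ the residue field cardinality, $|\cdot|$ the absolute value on $k$ with $|\pi|=q^{-1}$. Let $j_{2n+1}$ be the anti-diagonal matrix of $1$'s, $G=\{g\in GL_{2n+1}(k'):g^*j_{2n+1}g=j_{2n+1}\}$, $K=G\cap M_{2n+1}(\mathcal{O}_{k'})$ with normalized Haar measure $dk$, $X=\{x\in G:x^*=x,\ \det(t-xj_{2n+1})=(t^2-1)^n(t-1)\}$, $g\cdot x=gxg^*$. $d_i(y)$ is the determinant of the lower right $i\times i$ block of $y$. $\omega(x;s)=\int_K\prod_{i=1}^n|d_i(k\cdot x)|^{s_i}dk$ (over $k$ with all $d_i(k\cdot x)\ne0$), convergent for $\mathrm{Re}(s_i)\ge0$ and continued as a rational function of $q^{s_1},\dots,q^{s_n}$; $z\in\mathbb{C}^n$ is related to $s$ by $s_i=-z_i+z_{i+1}-1+\frac{\pi\sqrt{-1}}{\log q}$ ($1\le i\le n-1$), $s_n=-z_n-1+\frac{\pi\sqrt{-1}}{2\log q}$, and $\omega(x;z)=\omega(x;s)$. *)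

theory Defs
  imports
    "HOL-Analysis.Analysis"
    "HOL-Computational_Algebra.Primes"
    "Jordan_Normal_Form.Char_Poly"
begin

text \<open>
  The field \<open>k'\<close> is the whole type \<open>'a\<close>; its subfields \<open>k\<close> and \<open>\<rat>\<^sub>p\<close> are subsets of it.
\<close>

subsection \<open>Fields\<close>

definition is_subfield :: "'a::field set \<Rightarrow> bool" where
  "is_subfield F \<longleftrightarrow> 1 \<in> F \<and> (\<forall>a\<in>F. \<forall>b\<in>F. a - b \<in> F \<and> a * b \<in> F) \<and> (\<forall>a\<in>F. inverse a \<in> F)"

definition finite_extension :: "'a::field set \<Rightarrow> 'a set \<Rightarrow> bool" where
  "finite_extension F E \<longleftrightarrow> F \<subseteq> E \<and>
     (\<exists>B. finite B \<and> B \<subseteq> E \<and> (\<forall>a\<in>E. \<exists>c. (\<forall>b\<in>B. c b \<in> F) \<and> a = (\<Sum>b\<in>B. c b * b)))"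

definition quadratic_extension :: "'a::field set \<Rightarrow> 'a set \<Rightarrow> bool" where
  "quadratic_extension F E \<longleftrightarrow> F \<subseteq> E \<and>
     (\<exists>\<theta>\<in>E. \<theta> \<notin> F \<and> (\<forall>a\<in>E. \<exists>b\<in>F. \<exists>c\<in>F. a = b + c * \<theta>))"

definition nonarch_abs :: "('a::field \<Rightarrow> real) \<Rightarrow> bool" where
  "nonarch_abs v \<longleftrightarrow> (\<forall>a. 0 \<le> v a) \<and> (\<forall>a. v a = 0 \<longleftrightarrow> a = 0) \<and>
     (\<forall>a b. v (a * b) = v a * v b) \<and> (\<forall>a b. v (a + b) \<le> max (v a) (v b))"

definition padic_abs :: "nat \<Rightarrow> rat \<Rightarrow> real" where
  "padic_abs p r = (if r = 0 then 0
     else real p powi (int (multiplicity (int p) (snd (quotient_of r)))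
                        - int (multiplicity (int p) (fst (quotient_of r)))))"

text \<open>
  \<open>Qp\<close> is the completion of \<open>\<rat>\<close> for the \<open>p\<close>-adic absolute value. The absolute value \<open>v\<close> is only
  required to be equivalent to the \<open>p\<close>-adic one on \<open>\<rat>\<close>, since below it is normalized with respect
  to the extension field \<open>k\<close> (there \<open>v\<close> is the power of the \<open>p\<close>-adic one with exponent the degree
  of \<open>k\<close> over \<open>\<rat>\<^sub>p\<close>).
\<close>

definition is_Qp :: "nat \<Rightarrow> ('a::field_char_0 \<Rightarrow> real) \<Rightarrow> 'a set \<Rightarrow> bool" where
  "is_Qp p v Qp \<longleftrightarrow> is_subfield Qp \<and>
     (\<exists>c>0. \<forall>r. v (of_rat r) = padic_abs p r powr c) \<and>
     Metric_space.mcomplete Qp (\<lambda>a b. v (a - b)) \<and>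
     Metric_space.mtopology Qp (\<lambda>a b. v (a - b)) closure_of \<rat> = Qp"

definition integers_of :: "('a::field \<Rightarrow> real) \<Rightarrow> 'a set \<Rightarrow> 'a set" where
  "integers_of v F = {a\<in>F. v a \<le> 1}"

definition max_ideal_of :: "('a::field \<Rightarrow> real) \<Rightarrow> 'a set \<Rightarrow> 'a set" where
  "max_ideal_of v F = {a\<in>F. v a < 1}"

definition residue_card :: "('a::field \<Rightarrow> real) \<Rightarrow> 'a set \<Rightarrow> nat" where
  "residue_card v F = card (integers_of v F //
     {(a, b). a \<in> integers_of v F \<and> b \<in> integers_of v F \<and> a - b \<in> max_ideal_of v F})"

definition prime_element :: "('a::field \<Rightarrow> real) \<Rightarrow> 'a set \<Rightarrow> 'a \<Rightarrow> bool" where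
  "prime_element v F \<pi> \<longleftrightarrow>
     \<pi> \<in> F \<and> \<pi> \<noteq> 0 \<and> max_ideal_of v F = {\<pi> * a |a. a \<in> integers_of v F}"

text \<open>
  The absolute value \<open>v\<close> lives on \<open>k'\<close>; it is the unique extension of the normalized absolute value
  of \<open>k\<close>. That \<open>k'/k\<close> is unramified is the condition that the prime of \<open>k\<close> stays prime in \<open>k'\<close>
  (residue fields being finite, their extension is separable).
\<close>

locale unramified_quadratic =
  fixes p :: nat and Qp k :: "'a::field_char_0 set"
    and star :: "'a \<Rightarrow> 'a" and v :: "'a \<Rightarrow> real" and \<pi> :: 'a
  assumes p: "prime p" "odd p"
    and v: "nonarch_abs v"
    and Qp: "is_Qp p v Qp"
    and k: "is_subfield k" "finite_extension Qp k"
    and k': "quadratic_extension k UNIV"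
    and star: "bij star" "\<And>a b. star (a + b) = star a + star b"
      "\<And>a b. star (a * b) = star a * star b" "\<And>a. a \<in> k \<Longrightarrow> star a = a" "\<exists>a. star a \<noteq> a"
    and prime_k: "prime_element v k \<pi>"
    and prime_k': "prime_element v UNIV \<pi>"
    and normalized: "v \<pi> = 1 / real (residue_card v k)"

subsection \<open>The group and the space\<close>

definition adj :: "('a \<Rightarrow> 'a) \<Rightarrow> 'a mat \<Rightarrow> 'a mat" where
  "adj star A = map_mat star (transpose_mat A)"

definition antidiag :: "nat \<Rightarrow> 'a::zero_neq_one mat" where
  "antidiag m = mat m m (\<lambda>(i, j). if i + j + 1 = m then 1 else 0)"

definition G_grp :: "('a::field \<Rightarrow> 'a) \<Rightarrow> nat \<Rightarrow> 'a mat set" where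
  "G_grp star n = {g \<in> carrier_mat (2*n+1) (2*n+1).
     invertible_mat g \<and> adj star g * antidiag (2*n+1) * g = antidiag (2*n+1)}"

definition K_grp :: "('a::field \<Rightarrow> 'a) \<Rightarrow> ('a \<Rightarrow> real) \<Rightarrow> nat \<Rightarrow> 'a mat set" where
  "K_grp star v n = {g \<in> G_grp star n.
     \<forall>i<2*n+1. \<forall>j<2*n+1. g $$ (i, j) \<in> integers_of v UNIV}"

definition X_space :: "('a::field \<Rightarrow> 'a) \<Rightarrow> nat \<Rightarrow> 'a mat set" where
  "X_space star n = {x \<in> G_grp star n. adj star x = x \<and>
     char_poly (x * antidiag (2*n+1)) = ([:0, 1:]^2 - 1)^n * ([:0, 1:] - 1)}"

definition act :: "('a::field \<Rightarrow> 'a) \<Rightarrow> 'a mat \<Rightarrow> 'a mat \<Rightarrow> 'a mat" where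
  "act star g x = g * x * adj star g"

definition lower_right_minor :: "nat \<Rightarrow> 'a::comm_ring_1 mat \<Rightarrow> 'a" where
  "lower_right_minor i y =
     Determinant.det (mat i i (\<lambda>(a, b). y $$ (dim_row y - i + a, dim_col y - i + b)))"

subsection \<open>Haar measure\<close>

definition mat_dist :: "('a::field \<Rightarrow> real) \<Rightarrow> nat \<Rightarrow> 'a mat \<Rightarrow> 'a mat \<Rightarrow> real" where
  "mat_dist v m A B = Max {v (A $$ (i, j) - B $$ (i, j)) |i j. i < m \<and> j < m}"

definition K_topology :: "('a::field \<Rightarrow> 'a) \<Rightarrow> ('a \<Rightarrow> real) \<Rightarrow> nat \<Rightarrow> 'a mat topology" where
  "K_topology star v n = Metric_space.mtopology (K_grp star v n) (mat_dist v (2*n+1))"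

text \<open>
  Normalized Haar measure, as a Borel measure on a compact metrizable group, where finite Borel
  measures are automatically regular.
\<close>

definition normalized_Haar ::
  "('a::field \<Rightarrow> 'a) \<Rightarrow> ('a \<Rightarrow> real) \<Rightarrow> nat \<Rightarrow> 'a mat measure \<Rightarrow> bool" where
  "normalized_Haar star v n M \<longleftrightarrow>
     space M = K_grp star v n \<and>
     sets M = sigma_sets (K_grp star v n) {U. openin (K_topology star v n) U} \<and>
     emeasure M (K_grp star v n) = 1 \<and>
     (\<forall>g\<in>K_grp star v n. \<forall>A\<in>sets M. emeasure M ((\<lambda>h. g * h) ` A) = emeasure M A)"

subsection \<open>The spherical function and its continuation\<close>

text \<open>
  The tuples \<open>s\<close>, \<open>z\<close> of complex numbers are functions of which only the values at \<open>1, \<dots>, n\<close> matter.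
\<close>

definition omega :: "('a::field \<Rightarrow> 'a) \<Rightarrow> ('a \<Rightarrow> real) \<Rightarrow> nat \<Rightarrow> 'a mat measure
    \<Rightarrow> 'a mat \<Rightarrow> (nat \<Rightarrow> complex) \<Rightarrow> complex" where
  "omega star v n M x s =
     (LINT h:{h\<in>K_grp star v n. \<forall>i\<in>{1..n}. lower_right_minor i (act star h x) \<noteq> 0}|M.
        (\<Prod>i=1..n. complex_of_real (v (lower_right_minor i (act star h x))) powr s i))"

definition polynomial_fun :: "nat \<Rightarrow> ((nat \<Rightarrow> complex) \<Rightarrow> complex) \<Rightarrow> bool" where
  "polynomial_fun n P \<longleftrightarrow>
     (\<exists>S c. finite S \<and> P = (\<lambda>X. \<Sum>m\<in>S. c m * (\<Prod>i=1..n. X i ^ m i)))"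

definition q_powers :: "nat \<Rightarrow> (nat \<Rightarrow> complex) \<Rightarrow> nat \<Rightarrow> complex" where
  "q_powers q s = (\<lambda>i. of_nat q powr s i)"

text \<open>
  The rational function \<open>P/Q\<close> of \<open>q\<^bsup>s\<^sub>1\<^esup>, \<dots>, q\<^bsup>s\<^sub>n\<^esup>\<close> agrees with \<open>f\<close> on the closed domain
  \<open>Re s\<^sub>i \<ge> 0\<close>. As the powers range over a nonempty open set there, \<open>P/Q\<close> is determined by \<open>f\<close> as an
  element of the field of rational functions, but the fraction need not be reduced.
\<close>

definition rational_continuation ::
  "nat \<Rightarrow> nat \<Rightarrow> ((nat \<Rightarrow> complex) \<Rightarrow> complex) \<Rightarrow> ((nat \<Rightarrow> complex) \<Rightarrow> complex)
    \<Rightarrow> ((nat \<Rightarrow> complex) \<Rightarrow> complex) \<Rightarrow> bool" where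
  "rational_continuation n q f P Q \<longleftrightarrow>
     polynomial_fun n P \<and> polynomial_fun n Q \<and> (\<exists>X. Q X \<noteq> 0) \<and>
     (\<forall>s. (\<forall>i\<in>{1..n}. 0 \<le> Re (s i)) \<and> Q (q_powers q s) \<noteq> 0 \<longrightarrow>
        f s = P (q_powers q s) / Q (q_powers q s))"

definition s_of_z :: "nat \<Rightarrow> nat \<Rightarrow> (nat \<Rightarrow> complex) \<Rightarrow> nat \<Rightarrow> complex" where
  "s_of_z n q z = (\<lambda>i. if i < n then - z i + z (i + 1) - 1 + of_real pi * \<i> / of_real (ln (real q))
     else - z n - 1 + of_real pi * \<i> / (2 * of_real (ln (real q))))"

definition tau :: "nat \<Rightarrow> (nat \<Rightarrow> complex) \<Rightarrow> nat \<Rightarrow> complex" where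
  "tau n z = z(n := - z n)"

end

(*
  Write t = q^(-s_n) and U = q^(-s_(n-1) - s_n); tau replaces t by -q^2/t and fixes U and the other
  q^(s_i). The subgroup of K acting on the middle 3 x 3 block preserves d_1, ..., d_(n-1).
  For y in X with d_(n-1)(y) <> 0, a Schur complement turns y j into an involution of trace 1 on a
  three-dimensional space, that is, into a reflection in a vector w, and
  d_n(h y) = c d_(n-1)(y) N(r w) / <w, w> up to a unit c, where r is the last row of the middle block
  of h and w is primitive. Averaging over unipotent elements of this subgroup computes the
  distribution of |r w| when |<w, w>| = q^(-l), and its generating function satisfies a functional
  equation in Y = t^2/q^2 under Y -> 1/Y. Hence omega is a Laurent series in U, all of whose
  coefficients are rational in t with the same functional equation; multiplying by a denominator
  Q makes this a finite identity between polynomials in U and t.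
*)
theory Submission
  imports Defs "HOL-Computational_Algebra.Polynomial_FPS"
begin

section \<open>Non-archimedean absolute values\<close>

text \<open>The two sides of the equation never converge together: Re s_n >= 0 means |t| <= 1, and
  \<open>tau\<close> then moves t to modulus at least q^2. The symmetry is therefore read off from
  the coefficients of the powers of U, finite sums of terms rational in t, whose identities spread
  from the unit disc to all t. The other coordinates enter these coefficients only through integrals
  over K that involve neither t nor U, and nothing has to be known about those integrals.

  The fraction P/Q need not be reduced, and Q may vanish identically on a slice where the other
  coordinates are fixed. Hence the identities stay cross-multiplied until the end.

  That the conjugation preserves |.| is not assumed; it is derived from the completeness of k and
  underlies all estimates.

  With Y = t^2/q^2 = - q^(2 z_n), the substitution multiplies every coefficient by - (q Y + 1)/(q +
  Y), the inverse of the factor in the theorem. The number q^3 + 1 in the denominators counts the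
  isotropic lines of a Hermitian 3-space over the residue field.\<close>

definition seq_complete :: "('a::field \<Rightarrow> real) \<Rightarrow> 'a set \<Rightarrow> bool" where
  "seq_complete v W \<longleftrightarrow> (\<forall>\<sigma>. range \<sigma> \<subseteq> W \<longrightarrow>
     (\<forall>e>0. \<exists>N. \<forall>m\<ge>N. \<forall>n\<ge>N. v (\<sigma> m - \<sigma> n) < e) \<longrightarrow>
     (\<exists>l\<in>W. (\<lambda>n. v (\<sigma> n - l)) \<longlonglongrightarrow> 0))"

lemma is_subfieldD:
  assumes "is_subfield F"
  shows "1 \<in> F" "0 \<in> F" "\<And>a b. a \<in> F \<Longrightarrow> b \<in> F \<Longrightarrow> a - b \<in> F"
    "\<And>a b. a \<in> F \<Longrightarrow> b \<in> F \<Longrightarrow> a * b \<in> F" "\<And>a. a \<in> F \<Longrightarrow> inverse a \<in> F"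
    "\<And>a. a \<in> F \<Longrightarrow> - a \<in> F" "\<And>a b. a \<in> F \<Longrightarrow> b \<in> F \<Longrightarrow> a + b \<in> F"
    "\<And>a b. a \<in> F \<Longrightarrow> b \<in> F \<Longrightarrow> a / b \<in> F" "\<And>a m. a \<in> F \<Longrightarrow> a ^ m \<in> F"
proof -
  show 1: "1 \<in> F" and d: "\<And>a b. a \<in> F \<Longrightarrow> b \<in> F \<Longrightarrow> a - b \<in> F"
    and m: "\<And>a b. a \<in> F \<Longrightarrow> b \<in> F \<Longrightarrow> a * b \<in> F" and i: "\<And>a. a \<in> F \<Longrightarrow> inverse a \<in> F"
    using assms by (auto simp: is_subfield_def)
  show 0: "0 \<in> F" using d[OF 1 1] by simp
  show n: "\<And>a. a \<in> F \<Longrightarrow> - a \<in> F" using d[OF 0] by simp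
  show "\<And>a b. a \<in> F \<Longrightarrow> b \<in> F \<Longrightarrow> a + b \<in> F" using d n by (metis diff_minus_eq_add)
  show "\<And>a b. a \<in> F \<Longrightarrow> b \<in> F \<Longrightarrow> a / b \<in> F" using m i by (simp add: divide_inverse)
  show "a ^ m \<in> F" if "a \<in> F" for a m using that by (induction m) (auto simp: 1 m)
qed

context
  fixes v :: "'a::field \<Rightarrow> real"
  assumes v: "nonarch_abs v"
begin

lemma nonarch_abs_simps:
  shows "0 \<le> v a" "v a = 0 \<longleftrightarrow> a = 0" "v (a * b) = v a * v b" "v 0 = 0" "v 1 = 1"
    "v (- a) = v a" "v (inverse a) = inverse (v a)" "v (a / b) = v a / v b" "v (a ^ m) = v a ^ m"
    "v (a powi i) = v a powi i" "0 < v a \<longleftrightarrow> a \<noteq> 0"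
proof -
  show nn: "0 \<le> v a" and z: "v a = 0 \<longleftrightarrow> a = 0" and m: "v (a * b) = v a * v b" for a b
    using v by (auto simp: nonarch_abs_def)
  show z0: "v 0 = 0" using z by simp
  have "v 1 * v 1 = v 1" "v 1 \<noteq> 0" using m[of 1 1] z[of 1] by auto
  then show o: "v 1 = 1" by simp
  have "v (-1) * v (-1) = 1" using m[of "-1" "-1"] o by simp
  with nn[of "-1"] have "v (-1) = 1" by (smt (verit) mult_less_cancel_right1 mult_cancel_left1)
  then show "v (- a) = v a" using m[of "-1" a] by simp
  show i: "v (inverse a) = inverse (v a)" for a
  proof (cases "a = 0")
    case False
    then have "v (inverse a) * v a = 1" by (metis m o left_inverse)
    then show ?thesis by (metis inverse_unique mult.commute)
  qed (simp add: z0)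
  show "v (a / b) = v a / v b" by (simp add: divide_inverse m i)
  show p: "v (a ^ m) = v a ^ m" for a m by (induction m) (auto simp: o m)
  show "v (a powi i) = v a powi i" by (simp add: power_int_def p i)
  show "0 < v a \<longleftrightarrow> a \<noteq> 0" using nn[of a] z[of a] by linarith
qed

lemma v_add_le: "v a \<le> r \<Longrightarrow> v b \<le> r \<Longrightarrow> v (a + b) \<le> r"
  using v by (smt (verit) nonarch_abs_def)

lemma v_add_less: "v a < r \<Longrightarrow> v b < r \<Longrightarrow> v (a + b) < r"
  using v by (smt (verit) nonarch_abs_def)

lemma v_diff_le: "v a \<le> r \<Longrightarrow> v b \<le> r \<Longrightarrow> v (a - b) \<le> r"
  using v_add_le[of a r "- b"] by (simp add: nonarch_abs_simps)

lemma v_diff_less: "v a < r \<Longrightarrow> v b < r \<Longrightarrow> v (a - b) < r"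
  using v_add_less[of a r "- b"] by (simp add: nonarch_abs_simps)

lemma v_minus_commute: "v (a - b) = v (b - a)"
  using nonarch_abs_simps(6)[of "a - b"] by simp

lemma v_add_eq: "v a < v b \<Longrightarrow> v (a + b) = v b"
proof -
  assume l: "v a < v b"
  then have "v (a + b) \<le> v b" by (intro v_add_le) auto
  moreover have "v (a + b) \<ge> v b"
  proof (rule ccontr)
    assume "\<not> v (a + b) \<ge> v b"
    then have "v ((a + b) - a) < v b" using l by (intro v_diff_less) auto
    then show False by simp
  qed
  ultimately show ?thesis by simp
qed

lemma v_close_eq: "v (a - b) < v b \<Longrightarrow> v a = v b"
  using v_add_eq[of "a - b" b] by simp

lemma v_sum_le: "finite S \<Longrightarrow> (\<And>i. i \<in> S \<Longrightarrow> v (f i) \<le> r) \<Longrightarrow> 0 \<le> r \<Longrightarrow> v (sum f S) \<le> r"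
  by (induction S rule: finite_induct) (auto simp: nonarch_abs_simps intro!: v_add_le)

section \<open>Completeness of finite-dimensional spaces over a complete subfield\<close>

lemma seq_complete_closed:
  assumes W: "seq_complete v W" and s: "range \<sigma> \<subseteq> W" and l: "(\<lambda>n. v (\<sigma> n - l)) \<longlonglongrightarrow> 0"
  shows "l \<in> W"
proof -
  have "\<exists>N. \<forall>m\<ge>N. \<forall>n\<ge>N. v (\<sigma> m - \<sigma> n) < e" if "e > 0" for e
  proof -
    from l that obtain N where N: "\<forall>n\<ge>N. v (\<sigma> n - l) < e"
      using nonarch_abs_simps(1) unfolding LIMSEQ_iff by (metis diff_zero real_norm_def abs_of_nonneg)
    have "v (\<sigma> m - \<sigma> n) < e" if "m \<ge> N" "n \<ge> N" for m n
      using v_diff_less[of "\<sigma> m - l" e "\<sigma> n - l"] N that by simp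
    then show ?thesis by blast
  qed
  with W s obtain l' where l': "l' \<in> W" "(\<lambda>n. v (\<sigma> n - l')) \<longlonglongrightarrow> 0"
    unfolding seq_complete_def by blast
  have "v (l' - l) \<le> v (\<sigma> n - l) + v (\<sigma> n - l')" for n
    using v_diff_le[of "\<sigma> n - l" "v (\<sigma> n - l) + v (\<sigma> n - l')" "\<sigma> n - l'"]
    by (simp add: nonarch_abs_simps)
  moreover have "(\<lambda>n. v (\<sigma> n - l) + v (\<sigma> n - l')) \<longlonglongrightarrow> 0"
    using tendsto_add[OF l l'(2)] by simp
  ultimately have "v (l' - l) \<le> 0" by (intro LIMSEQ_le_const) auto
  then have "l' = l" using nonarch_abs_simps(1,2)[of "l' - l"] by (metis eq_iff_diff_eq_0 antisym)
  with l' show ?thesis by simp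
qed

text \<open>Being closed, \<open>W\<close> has a positive distance d from \<open>b\<close>, so |x +
  c b| >= d |c| for x in \<open>W\<close>. Hence the coefficients c of a Cauchy sequence are
  themselves Cauchy, and so are the components in \<open>W\<close>.\<close>

lemma seq_complete_insert:
  assumes F: "is_subfield F" and cF: "seq_complete v F" and cW: "seq_complete v W"
    and Wadd: "\<And>x y. x \<in> W \<Longrightarrow> y \<in> W \<Longrightarrow> x - y \<in> W"
    and Wmul: "\<And>c x. c \<in> F \<Longrightarrow> x \<in> W \<Longrightarrow> c * x \<in> W" and b: "b \<notin> W"
  shows "seq_complete v {x + c * b |x c. x \<in> W \<and> c \<in> F}"
proof -
  note F = is_subfieldD[OF F]
  have "\<exists>d>0. \<forall>x\<in>W. d \<le> v (b - x)"
  proof (rule ccontr)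
    assume "\<not> ?thesis"
    then have "\<exists>x\<in>W. v (b - x) < inverse (real (Suc n))" for n
      by (meson inverse_positive_iff_positive not_le of_nat_0_less_iff zero_less_Suc)
    then obtain \<sigma> where s: "\<And>n. \<sigma> n \<in> W" "\<And>n. v (b - \<sigma> n) < inverse (real (Suc n))" by metis
    have "(\<lambda>n. v (\<sigma> n - b)) \<longlonglongrightarrow> 0"
      by (rule tendsto_sandwich[OF _ _ tendsto_const LIMSEQ_inverse_real_of_nat])
         (auto simp: nonarch_abs_simps v_minus_commute[of "\<sigma> _" b] simp del: of_nat_Suc
           intro!: always_eventually less_imp_le s)
    then show False using seq_complete_closed[OF cW, of \<sigma> b] s(1) b by auto
  qed
  then obtain d where d: "d > 0" "\<And>x. x \<in> W \<Longrightarrow> d \<le> v (b - x)" by blast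
  have low: "v c * d \<le> v (x + c * b)" if "x \<in> W" "c \<in> F" for x c
  proof (cases "c = 0")
    case False
    have "x + c * b = c * (b - (- inverse c) * x)" using False by (simp add: field_simps)
    then have "v (x + c * b) = v c * v (b - (- inverse c) * x)" by (simp add: nonarch_abs_simps)
    then show ?thesis using d(2)[of "(- inverse c) * x"] Wmul[of "- inverse c" x] F that
      by (metis mult_left_mono nonarch_abs_simps(1))
  qed (simp add: nonarch_abs_simps)
  show ?thesis
    unfolding seq_complete_def
  proof (intro allI impI)
    fix \<sigma> :: "nat \<Rightarrow> 'a" assume "range \<sigma> \<subseteq> {x + c * b |x c. x \<in> W \<and> c \<in> F}"
      and C: "\<forall>e>0. \<exists>N. \<forall>m\<ge>N. \<forall>n\<ge>N. v (\<sigma> m - \<sigma> n) < e"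
    then have "\<exists>x c. \<sigma> n = x + c * b \<and> x \<in> W \<and> c \<in> F" for n
      using rangeI[of \<sigma> n] by blast
    then obtain x c where xc: "\<And>n. \<sigma> n = x n + c n * b" "\<And>n. x n \<in> W" "\<And>n. c n \<in> F" by metis
    have diff: "\<sigma> m - \<sigma> n = (x m - x n) + (c m - c n) * b" for m n
      by (simp add: xc(1) algebra_simps)
    have lowd: "v (c m - c n) * d \<le> v (\<sigma> m - \<sigma> n)" for m n
      unfolding diff by (intro low Wadd F xc)
    have Cc: "\<exists>N. \<forall>m\<ge>N. \<forall>n\<ge>N. v (c m - c n) < e" if "e > 0" for e
    proof -
      obtain N where N: "\<forall>m\<ge>N. \<forall>n\<ge>N. v (\<sigma> m - \<sigma> n) < e * d"
        using C[rule_format, of "e * d"] \<open>e > 0\<close> d(1) by (auto simp: mult_pos_pos)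
      then have "\<forall>m\<ge>N. \<forall>n\<ge>N. v (c m - c n) * d < e * d" using lowd by (meson le_less_trans)
      then show ?thesis using d(1) by auto
    qed
    then obtain c' where c': "c' \<in> F" "(\<lambda>n. v (c n - c')) \<longlonglongrightarrow> 0"
      using cF xc(3) unfolding seq_complete_def by (metis image_subsetI)
    have "\<exists>N. \<forall>m\<ge>N. \<forall>n\<ge>N. v (x m - x n) < e" if "e > 0" for e
    proof -
      have b0: "v b + 1 > 0" by (smt (verit) nonarch_abs_simps(1))
      obtain N1 where N1: "\<forall>m\<ge>N1. \<forall>n\<ge>N1. v (\<sigma> m - \<sigma> n) < e" using C \<open>e > 0\<close> by blast
      obtain N2 where N2: "\<forall>m\<ge>N2. \<forall>n\<ge>N2. v (c m - c n) < e / (v b + 1)" using Cc[of "e / (v b + 1)"] \<open>e > 0\<close> b0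
        by auto
      have "v (x m - x n) < e" if "m \<ge> max N1 N2" "n \<ge> max N1 N2" for m n
      proof -
        have "v (c m - c n) * (v b + 1) < e" using N2 that b0 by (simp add: pos_less_divide_eq)
        then have "v ((c m - c n) * b) < e"
          by (smt (verit) mult_left_mono nonarch_abs_simps(1,3))
        moreover have "x m - x n = (\<sigma> m - \<sigma> n) - (c m - c n) * b" by (simp add: diff)
        ultimately show ?thesis using N1 that by (metis v_diff_less max.bounded_iff)
      qed
      then show ?thesis by blast
    qed
    then obtain x' where x': "x' \<in> W" "(\<lambda>n. v (x n - x')) \<longlonglongrightarrow> 0"
      using cW xc(2) unfolding seq_complete_def by (metis image_subsetI)
    have "v (\<sigma> n - (x' + c' * b)) \<le> v (x n - x') + v (c n - c') * v b" for n
    proof -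
      have "\<sigma> n - (x' + c' * b) = (x n - x') + (c n - c') * b" by (simp add: xc(1) algebra_simps)
      then show ?thesis
        using v_add_le[of "x n - x'" "v (x n - x') + v (c n - c') * v b" "(c n - c') * b"]
        by (metis add_increasing add_increasing2 nonarch_abs_simps(1,3) order_refl zero_le_mult_iff)
    qed
    moreover have lim: "(\<lambda>n. v (x n - x') + v (c n - c') * v b) \<longlonglongrightarrow> 0"
      using tendsto_add[OF x'(2) tendsto_mult_right[OF c'(2), of "v b"]] by simp
    ultimately have "(\<lambda>n. v (\<sigma> n - (x' + c' * b))) \<longlonglongrightarrow> 0"
      using nonarch_abs_simps(1)
      by (rule_tac tendsto_sandwich[OF always_eventually always_eventually tendsto_const lim]) blast+
    moreover have "x' + c' * b \<in> {x + c * b |x c. x \<in> W \<and> c \<in> F}" using x'(1) c'(1) by blast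
    ultimately show "\<exists>l\<in>{x + c * b |x c. x \<in> W \<and> c \<in> F}. (\<lambda>n. v (\<sigma> n - l)) \<longlonglongrightarrow> 0"
      by (rule bexI)
  qed
qed

text \<open>The generators are added one at a time; one that already lies in the span changes
  nothing. Any finite spanning set serves, independent or not.\<close>

lemma seq_complete_span:
  assumes F: "is_subfield F" and cF: "seq_complete v F" and B: "finite B"
  shows "seq_complete v {\<Sum>b\<in>B. c b * b |c. \<forall>b\<in>B. c b \<in> F}" (is "seq_complete v (?W B)")
  using B
proof (induction B rule: finite_induct)
  case empty
  have "?W {} = {0}" by auto
  have "\<sigma> = (\<lambda>n. 0)" if "range \<sigma> \<subseteq> {0}" for \<sigma> :: "nat \<Rightarrow> 'a" using that by fastforce
  then have "(\<lambda>n. v (\<sigma> n - 0)) \<longlonglongrightarrow> 0" if "range \<sigma> \<subseteq> {0}" for \<sigma> using \<open>\<And>\<sigma>. range \<sigma> \<subseteq> {0} \<Longrightarrow> \<sigma> = (\<lambda>n. 0)\<close>[OF that] by (simp add: nonarch_abs_simps)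
  then show ?case unfolding \<open>?W {} = {0}\<close> seq_complete_def by blast
next
  case (insert b B)
  note F' = is_subfieldD[OF F]
  have eq: "?W (insert b B) = {x + c * b |x c. x \<in> ?W B \<and> c \<in> F}"
  proof (intro equalityI subsetI)
    fix y assume "y \<in> ?W (insert b B)"
    then obtain f where "y = (\<Sum>b\<in>B. f b * b) + f b * b" "\<forall>b\<in>insert b B. f b \<in> F"
      using insert by (auto simp: add.commute)
    then show "y \<in> {x + c * b |x c. x \<in> ?W B \<and> c \<in> F}" by blast
  next
    fix y assume "y \<in> {x + c * b |x c. x \<in> ?W B \<and> c \<in> F}"
    then obtain c f where y: "y = (\<Sum>b\<in>B. f b * b) + c * b" "\<forall>b\<in>B. f b \<in> F" "c \<in> F" by blast
    have "(\<Sum>b'\<in>insert b B. (f(b := c)) b' * b') = y"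
      using insert y(1) by (auto simp: add.commute intro!: sum.cong)
    then show "y \<in> ?W (insert b B)" using y by (intro CollectI exI[of _ "f(b := c)"]) auto
  qed
  have add: "x - y \<in> ?W B" if "x \<in> ?W B" "y \<in> ?W B" for x y
  proof -
    from that obtain f g where "x = (\<Sum>b\<in>B. f b * b)" "\<forall>b\<in>B. f b \<in> F"
      "y = (\<Sum>b\<in>B. g b * b)" "\<forall>b\<in>B. g b \<in> F" by blast
    then show ?thesis by (intro CollectI exI[of _ "\<lambda>b. f b - g b"])
        (auto simp: sum_subtractf left_diff_distrib intro!: F')
  qed
  have mul: "c * x \<in> ?W B" if "c \<in> F" "x \<in> ?W B" for c x
  proof -
    from that obtain f where "x = (\<Sum>b\<in>B. f b * b)" "\<forall>b\<in>B. f b \<in> F" by blast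
    then show ?thesis using that(1) by (intro CollectI exI[of _ "\<lambda>b. c * f b"])
        (auto simp: sum_distrib_left mult.assoc intro!: F')
  qed
  show ?case
  proof (cases "b \<in> ?W B")
    case True
    have "{x + c * b |x c. x \<in> ?W B \<and> c \<in> F} = ?W B"
    proof (intro equalityI subsetI)
      fix y assume "y \<in> {x + c * b |x c. x \<in> ?W B \<and> c \<in> F}"
      then obtain x c where xc: "y = x + c * b" "x \<in> ?W B" "c \<in> F" by blast
      have "x - (- c) * b \<in> ?W B" by (intro add mul True F' xc)
      then show "y \<in> ?W B" using xc(1) by simp
    next
      fix y assume "y \<in> ?W B"
      moreover have "y = y + 0 * b" by simp
      ultimately show "y \<in> {x + c * b |x c. x \<in> ?W B \<and> c \<in> F}" using F'(2) by blast
    qed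
    then show ?thesis using eq insert.IH by simp
  next
    case False
    show ?thesis unfolding eq by (rule seq_complete_insert[OF F cF insert.IH add mul False])
  qed
qed

end

lemma mcomplete_imp_seq_complete:
  assumes v: "nonarch_abs v" and c: "Metric_space.mcomplete F (\<lambda>a b. v (a - b))"
  shows "seq_complete v F"
proof -
  interpret Metric_space F "\<lambda>a b. v (a - b)"
  proof
    show "v (a - b) = v (b - a)" for a b by (rule v_minus_commute[OF v])
    show "v (x - z) \<le> v (x - y) + v (y - z)" for x y z
      using v_add_le[OF v, of "x - y" "v (x - y) + v (y - z)" "y - z"]
      by (simp add: nonarch_abs_simps[OF v])
  qed (auto simp: nonarch_abs_simps[OF v])
  show ?thesis
    unfolding seq_complete_def
  proof (intro allI impI)
    fix \<sigma> :: "nat \<Rightarrow> 'a" assume "range \<sigma> \<subseteq> F" "\<forall>e>0. \<exists>N. \<forall>m\<ge>N. \<forall>n\<ge>N. v (\<sigma> m - \<sigma> n) < e"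
    then have "MCauchy \<sigma>" unfolding MCauchy_def by simp
    with c obtain l where l: "limitin mtopology \<sigma> l sequentially" by (auto simp: mcomplete_def)
    then have l: "l \<in> F" "\<forall>e>0. \<exists>N. \<forall>n\<ge>N. \<sigma> n \<in> F \<and> v (\<sigma> n - l) < e"
      unfolding limit_metric_sequentially by simp_all
    then have "(\<lambda>n. v (\<sigma> n - l)) \<longlonglongrightarrow> 0"
      unfolding LIMSEQ_iff using l(2) by (simp add: nonarch_abs_simps[OF v]) meson
    then show "\<exists>l\<in>F. (\<lambda>n. v (\<sigma> n - l)) \<longlonglongrightarrow> 0" using l(1) by blast
  qed
qed

section \<open>The valued field and its conjugation\<close>

context unramified_quadratic
begin

abbreviation (input) q :: nat where "q \<equiv> residue_card v k"

lemmas v_simps = nonarch_abs_simps[OF v]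
lemmas k_closed = is_subfieldD[OF k(1)]

lemma pi_props: "0 < v \<pi>" "v \<pi> < 1" "\<pi> \<noteq> 0" "\<pi> \<in> k" "2 \<le> q"
proof -
  note 1 = normalized
  show 2: "\<pi> \<noteq> 0" "\<pi> \<in> k" using prime_k by (auto simp: prime_element_def)
  then show 3: "0 < v \<pi>" by (simp add: v_simps)
  have "\<pi> * 1 \<in> max_ideal_of v k"
    using prime_k k_closed by (auto simp: prime_element_def integers_of_def v_simps)
  then show 4: "v \<pi> < 1" by (simp add: max_ideal_of_def)
  have "q \<noteq> 0" "q \<noteq> 1" using 1 3 4 by auto
  then show "2 \<le> q" by linarith
qed

text \<open>This is how unramifiedness enters: by \<open>prime_k'\<close> the prime of k generates
  the maximal ideal of k', so no value lies strictly between |\<pi>| and 1.\<close>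

lemma v_lt_one_imp: "v a < 1 \<Longrightarrow> v a \<le> v \<pi>"
proof -
  assume "v a < 1"
  then have "a \<in> max_ideal_of v UNIV" by (simp add: max_ideal_of_def)
  then obtain b where "a = \<pi> * b" "v b \<le> 1"
    using prime_k' by (auto simp: prime_element_def integers_of_def)
  then show ?thesis using pi_props(1) by (simp add: v_simps mult_left_le)
qed

lemma v_discrete: assumes "a \<noteq> 0" obtains m :: int where "v a = v \<pi> powi m"
proof -
  \<comment> \<open>The base |\<pi>| is below 1, so the floor gives |\<pi>|^(m+1) < |a| <=
    |\<pi>|^m; by \<open>v_lt_one_imp\<close> only the upper end is a possible value.\<close>
  define m where "m = \<lfloor>log (v \<pi>) (v a)\<rfloor>"
  have va: "0 < v a" using assms by (simp add: v_simps)
  have pw: "v \<pi> powi i = v \<pi> powr (of_int i)" for i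
    using pi_props by (simp add: powr_real_of_int')
  have l: "v a = v \<pi> powr (log (v \<pi>) (v a))" using pi_props va by simp
  have "v \<pi> powr (of_int m + 1) < v a"
    unfolding m_def by (subst (2) l, rule powr_less_mono') (use pi_props in linarith)+
  then have 1: "v \<pi> powi (m + 1) < v a" using pw[of "m + 1"] by simp
  have "v a \<le> v \<pi> powr (of_int m)"
    unfolding m_def by (subst l, rule powr_mono') (use pi_props in linarith)+
  then have 2: "v a \<le> v \<pi> powi m" using pw[of m] by simp
  have e: "v (a / \<pi> powi m) = v a / v \<pi> powi m" by (simp add: v_simps)
  have "\<not> v (a / \<pi> powi m) < 1"
  proof
    assume "v (a / \<pi> powi m) < 1"
    then have "v a / v \<pi> powi m \<le> v \<pi>" using v_lt_one_imp e by metis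
    then have "v a \<le> v \<pi> powi (m + 1)" using pi_props by (simp add: divide_le_eq power_int_add zero_less_power_int mult.commute)
    with 1 show False by simp
  qed
  with 2 e have "v a = v \<pi> powi m" using pi_props(1) zero_less_power_int[of "v \<pi>" m]
    by (simp add: divide_less_eq)
  then show ?thesis by (rule that)
qed

lemma v_less_powi: "v a < v \<pi> powi m \<Longrightarrow> v a \<le> v \<pi> powi (m + 1)"
proof -
  assume "v a < v \<pi> powi m"
  then have "v (a / \<pi> powi m) < 1" using pi_props(1) by (simp add: v_simps divide_less_eq)
  then have "v (a / \<pi> powi m) \<le> v \<pi>" by (rule v_lt_one_imp)
  then show ?thesis using pi_props(1,3)
    by (simp add: v_simps divide_le_eq power_int_add mult.commute)
qed

lemma v_less_pow: "v a < v \<pi> ^ m \<longleftrightarrow> v a \<le> v \<pi> ^ Suc m"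
proof
  assume "v a < v \<pi> ^ m"
  then have "v a < v \<pi> powi int m" by simp
  from v_less_powi[OF this] show "v a \<le> v \<pi> ^ Suc m" by (metis of_nat_Suc add.commute power_int_of_nat)
next
  assume "v a \<le> v \<pi> ^ Suc m"
  also have "v \<pi> ^ Suc m < v \<pi> ^ m" using pi_props(1,2) by simp
  finally show "v a < v \<pi> ^ m" .
qed

text \<open>An odd p does not divide 2, so its p-adic absolute value is 1, and on the rationals
  \<open>v\<close> is a power of the p-adic one. From here on halving is integral, and elements
  split into trace and skew parts without loss.\<close>

lemma v_two: "v 2 = 1"
proof -
  obtain c :: real where c: "\<forall>r. v (of_rat r) = padic_abs p r powr c" using Qp by (auto simp: is_Qp_def)
  have "\<not> int p dvd 2"
  proof
    assume "int p dvd 2"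
    then have "p dvd 2" by presburger
    then show False using p prime_nat_iff[of p] two_is_prime_nat by (metis even_numeral odd_one prime_nat_iff prime_gt_1_nat less_irrefl dvd_refl)
  qed
  then have "multiplicity (int p) 2 = 0" by (rule not_dvd_imp_multiplicity_0)
  moreover have "quotient_of 2 = (2, 1)" using quotient_of_int[of 2] by simp
  ultimately have "padic_abs p 2 = 1" by (simp add: padic_abs_def)
  with c[rule_format, of 2] show ?thesis by simp
qed

lemma star_simps: "star 0 = 0" "star 1 = 1" "star (- a) = - star a" "star (a - b) = star a - star b"
  "star (a + b) = star a + star b" "star (a * b) = star a * star b" "star (inverse a) = inverse (star a)"
  "star (a / b) = star a / star b" "star (a ^ m) = star a ^ m" "star 2 = 2" "star a = 0 \<longleftrightarrow> a = 0"
  "star \<pi> = \<pi>"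
proof -
  show 0: "star 0 = 0" and 1: "star 1 = 1" using star(4) k_closed by auto
  show "star 2 = 2" using star(4)[OF k_closed(7)[OF k_closed(1) k_closed(1)]] by simp
  show m: "star (- a) = - star a" for a using star(2)[of a "- a"] 0 by (simp add: eq_neg_iff_add_eq_0 add.commute)
  show "star (a - b) = star a - star b" using star(2)[of a "- b"] m[of b] by simp
  show z: "star a = 0 \<longleftrightarrow> a = 0" for a using star(1) 0 by (metis bij_is_inj injD)
  show i: "star (inverse a) = inverse (star a)" for a
  proof (cases "a = 0")
    case False
    then have "star a * star (inverse a) = 1" using star(3)[of a "inverse a"] 1 by simp
    then show ?thesis by (metis inverse_unique)
  qed (simp add: 0)
  show "star (a / b) = star a / star b" by (simp add: divide_inverse star(3) i)
  show "star (a ^ m) = star a ^ m" by (induction m) (auto simp: 1 star(3))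
  show "star (a + b) = star a + star b" "star (a * b) = star a * star b" using star by auto
  show "star \<pi> = \<pi>" using star(4) pi_props by auto
qed

lemma star_sum: "star (sum f S) = (\<Sum>i\<in>S. star (f i))"
  by (induction S rule: infinite_finite_induct) (auto simp: star_simps)

text \<open>A generator \<theta> of k' over k satisfies \<theta>^2 = b + c \<theta>, and
  \<open>star\<close> sends it to the other root c - \<theta>. Involutivity and the fixed field thus
  follow from \<open>star\<close> being a nontrivial automorphism over k.\<close>

lemma star_star [simp]: "star (star a) = a" and star_fixed: "star a = a \<longleftrightarrow> a \<in> k"
proof -
  obtain \<theta> where th: "\<theta> \<notin> k" "\<And>a. \<exists>b\<in>k. \<exists>c\<in>k. a = b + c * \<theta>"
    using k' unfolding quadratic_extension_def by blast
  have ne: "star \<theta> \<noteq> \<theta>"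
  proof
    assume "star \<theta> = \<theta>"
    then have "star a = a" for a using th(2)[of a] star by (metis (no_types, lifting))
    then show False using star(5) by blast
  qed
  obtain b c where bc: "b \<in> k" "c \<in> k" "\<theta> * \<theta> = b + c * \<theta>" using th(2) by metis
  then have "star \<theta> * star \<theta> = b + c * star \<theta>" using star by metis
  with bc(3) have "(\<theta> - star \<theta>) * (\<theta> + star \<theta> - c) = 0" by (simp add: algebra_simps)
  with ne have s: "\<theta> + star \<theta> = c" by auto
  then have "star \<theta> + star (star \<theta>) = c" using star(2,4) bc(2) by metis
  with s have ss: "star (star \<theta>) = \<theta>" by (metis add.commute add_left_cancel)
  show "star (star a) = a"
    using th(2)[of a] ss star by (metis (no_types, lifting))
  show "star a = a \<longleftrightarrow> a \<in> k"
  proof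
    assume a: "star a = a"
    obtain b c where bc: "b \<in> k" "c \<in> k" "a = b + c * \<theta>" using th(2) by metis
    then have "c * star \<theta> = c * \<theta>" using a star by (metis add_left_cancel)
    with ne have "c = 0" by simp
    with bc show "a \<in> k" by simp
  qed (rule star(4))
qed

text \<open>A finite extension of the complete field \<open>Qp\<close> is complete, hence closed in
  k'. In this form completeness is used to show that \<open>star\<close> is an isometry.\<close>

lemma k_seq_closed: "range \<sigma> \<subseteq> k \<Longrightarrow> (\<lambda>n. v (\<sigma> n - l)) \<longlonglongrightarrow> 0 \<Longrightarrow> l \<in> k"
proof -
  have sub: "is_subfield Qp" and c: "seq_complete v Qp"
    using Qp mcomplete_imp_seq_complete[OF v] by (auto simp: is_Qp_def)
  obtain B where B: "finite B" "B \<subseteq> k" "Qp \<subseteq> k" "\<And>a. a \<in> k \<Longrightarrow> \<exists>c. (\<forall>b\<in>B. c b \<in> Qp) \<and> a = (\<Sum>b\<in>B. c b * b)"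
    using k(2) unfolding finite_extension_def by blast
  have sumk: "sum f S \<in> k" if "finite S" "\<And>b. b \<in> S \<Longrightarrow> f b \<in> k" for f :: "'a \<Rightarrow> 'a" and S
    using that by (induction S rule: finite_induct) (auto intro: k_closed)
  have "k = {\<Sum>b\<in>B. c b * b |c. \<forall>b\<in>B. c b \<in> Qp}"
  proof (intro equalityI subsetI)
    fix a assume "a \<in> {\<Sum>b\<in>B. c b * b |c. \<forall>b\<in>B. c b \<in> Qp}"
    then show "a \<in> k" using B by (auto intro!: sumk k_closed)
  qed (use B(4) in blast)
  then have "seq_complete v k" using seq_complete_span[OF v sub c B(1)] by simp
  then show "range \<sigma> \<subseteq> k \<Longrightarrow> (\<lambda>n. v (\<sigma> n - l)) \<longlonglongrightarrow> 0 \<Longrightarrow> l \<in> k"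
    by (rule seq_complete_closed[OF v])
qed

text \<open>If \<open>v a < v (star a)\<close>, then \<open>\<alpha> = a / star a\<close> is the limit of the iteration
  \<open>x \<mapsto> (1 + x\<^sup>2) / (\<alpha> + \<alpha>\<inverse>)\<close> in \<open>k\<close>, although it is not fixed by \<open>star\<close>.\<close>

lemma v_star_ge: "v (star a) \<le> v a"
proof (rule ccontr)
  assume "\<not> ?thesis"
  then have lt: "v a < v (star a)" by simp
  then have a0: "a \<noteq> 0" using v_simps(1,4) star_simps(1) by (metis less_irrefl)
  define \<alpha> where "\<alpha> = a / star a"
  have sa: "star a \<noteq> 0" using a0 star_simps by simp
  have al: "star \<alpha> = inverse \<alpha>" "\<alpha> \<noteq> 0" using a0 sa by (auto simp: \<alpha>_def star_simps)
  have val: "v \<alpha> < 1" "0 < v \<alpha>" using lt a0 sa by (auto simp: \<alpha>_def v_simps divide_less_eq)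
  define T where "T = \<alpha> + inverse \<alpha>"
  have Tk: "T \<in> k" by (simp add: T_def al star_simps add.commute flip: star_fixed)
  have inv: "v (inverse \<alpha>) = inverse (v \<alpha>)" by (simp add: v_simps)
  have "1 < inverse (v \<alpha>)" using val by (simp add: one_less_inverse)
  then have vT: "v T = inverse (v \<alpha>)"
    unfolding T_def using v_add_eq[OF v, of \<alpha> "inverse \<alpha>"] inv val by simp
  then have T0: "T \<noteq> 0" using val by (metis inverse_positive_iff_positive less_irrefl v_simps(4))
  define \<sigma> where "\<sigma> = rec_nat 0 (\<lambda>_ x. (1 + x * x) / T)"
  have s0: "\<sigma> 0 = 0" and sS: "\<sigma> (Suc n) = (1 + \<sigma> n * \<sigma> n) / T" for n by (auto simp: \<sigma>_def)
  have sk: "\<sigma> n \<in> k" for n by (induction n) (auto simp: s0 sS intro!: k_closed Tk)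
  have fixp: "\<alpha> = (1 + \<alpha> * \<alpha>) / T" using T0 al by (simp add: T_def field_simps)
  have step: "\<sigma> (Suc n) - \<alpha> = (\<sigma> n - \<alpha>) * (\<sigma> n + \<alpha>) / T" for n
    unfolding sS using T0 by (subst (1) fixp) (simp add: field_simps)
  have *: "v (\<sigma> n) \<le> v \<alpha> \<and> v (\<sigma> n - \<alpha>) \<le> v \<alpha> ^ n" for n
  proof (induction n)
    case 0
    then show ?case using val by (simp add: s0 v_simps)
  next
    case (Suc n)
    have "v (\<sigma> n - \<alpha>) \<le> v \<alpha>" using v_diff_le[OF v] Suc by auto
    moreover have "v (\<sigma> n + \<alpha>) \<le> 1" using v_add_le[OF v] Suc val by auto
    moreover have e: "v (\<sigma> (Suc n) - \<alpha>) = v (\<sigma> n - \<alpha>) * v (\<sigma> n + \<alpha>) * v \<alpha>"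
      by (simp add: step v_simps vT divide_inverse)
    ultimately have le: "v (\<sigma> (Suc n) - \<alpha>) \<le> v (\<sigma> n - \<alpha>) * v \<alpha>"
      using val v_simps(1) by (simp add: mult_left_le mult_right_mono)
    also have "\<dots> \<le> v \<alpha> ^ n * v \<alpha>" using Suc val by (intro mult_right_mono) auto
    finally have 1: "v (\<sigma> (Suc n) - \<alpha>) \<le> v \<alpha> ^ Suc n" by (simp add: mult.commute)
    also have "\<dots> \<le> v \<alpha>" using val power_decreasing[of 1 "Suc n" "v \<alpha>"] by simp
    finally have "v ((\<sigma> (Suc n) - \<alpha>) + \<alpha>) \<le> v \<alpha>" by (intro v_add_le[OF v]) auto
    with 1 show ?case by simp
  qed
  have pow: "(\<lambda>n. v \<alpha> ^ n) \<longlonglongrightarrow> 0" using val by (intro LIMSEQ_power_zero) auto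
  have "(\<lambda>n. v (\<sigma> n - \<alpha>)) \<longlonglongrightarrow> 0"
    by (rule tendsto_sandwich[OF always_eventually always_eventually tendsto_const pow])
       (use * v_simps(1) in blast)+
  then have "\<alpha> \<in> k" using sk by (intro k_seq_closed[of \<sigma>]) auto
  then have "\<alpha> = inverse \<alpha>" using al star_fixed by metis
  then have "v \<alpha> = inverse (v \<alpha>)" using inv by simp
  then show False using val \<open>1 < inverse (v \<alpha>)\<close> by simp
qed

lemma v_star [simp]: "v (star a) = v a"
  using v_star_ge[of a] v_star_ge[of "star a"] by simp

lemma v_norm: "v (a * star a) = v a ^ 2"
  by (simp add: v_simps power2_eq_square)

lemma norm_in_k: "a * star a \<in> k" "star a * a \<in> k"
  by (simp_all add: star_simps mult.commute flip: star_fixed)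

text \<open>The skew element \<theta> - \<open>star\<close> \<theta> can be scaled to a unit by a
  power of \<pi>, because \<pi> is fixed by \<open>star\<close> and generates the value group of
  k'.\<close>

lemma skew_unit: obtains \<delta> where "v \<delta> = 1" "star \<delta> = - \<delta>"
proof -
  obtain \<theta> where "star \<theta> \<noteq> \<theta>" using star by blast
  then have "\<theta> - star \<theta> \<noteq> 0" by simp
  then obtain m where m: "v (\<theta> - star \<theta>) = v \<pi> powi m" using v_discrete by blast
  define d where "d = (\<theta> - star \<theta>) * (inverse \<pi>) powi m"
  have "star ((inverse \<pi>) powi m) = (inverse \<pi>) powi m"
    by (cases m) (auto simp: power_int_def star_simps)
  then have "star d = - d" by (simp add: d_def star_simps algebra_simps)
  moreover have "v d = 1" using pi_props by (simp add: d_def v_simps m power_int_inverse)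
  ultimately show ?thesis by (rule that[rotated])
qed

end

section \<open>Residue systems\<close>

context unramified_quadratic
begin

text \<open>Counting on finite sets of representatives modulo the open unit ball replaces
  computation in the residue fields of k (with A = \<open>Ok\<close>) and of k' (with A =
  \<open>Ok'\<close>).\<close>

definition residue_system :: "'a set \<Rightarrow> 'a set \<Rightarrow> bool" where
  "residue_system R A \<longleftrightarrow> finite R \<and> R \<subseteq> A \<and> (\<forall>a\<in>A. \<exists>!r. r \<in> R \<and> v (a - r) < 1)"

lemma v_cong_trans: "v (a - b) < r \<Longrightarrow> v (b - c) < r \<Longrightarrow> v (a - c) < r"
  using v_add_less[OF v, of "a - b" r "b - c"] by simp

lemma residue_system_ex: "residue_system R A \<Longrightarrow> a \<in> A \<Longrightarrow> \<exists>r. r \<in> R \<and> v (a - r) < 1"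
  by (auto simp: residue_system_def)

lemma residue_system_unique:
  assumes "residue_system R A" "r \<in> R" "s \<in> R" "v (r - s) < 1"
  shows "r = s"
proof -
  have "\<exists>!t. t \<in> R \<and> v (r - t) < 1" using assms by (auto simp: residue_system_def)
  moreover have "v (r - r) < 1" by (simp add: v_simps)
  ultimately show ?thesis using assms by blast
qed

text \<open>Up to congruence \<open>f\<close> maps representatives injectively to representatives,
  hence permutes the finite set \<open>R\<close>. A property that depends only on the class is met
  equally often before and after.\<close>

lemma residue_system_count:
  assumes R: "residue_system R A" and f: "\<And>a. a \<in> A \<Longrightarrow> f a \<in> A"
    and inj: "\<And>a b. a \<in> A \<Longrightarrow> b \<in> A \<Longrightarrow> v (f a - f b) < 1 \<Longrightarrow> v (a - b) < 1"
    and P: "\<And>a b. a \<in> A \<Longrightarrow> b \<in> A \<Longrightarrow> v (a - b) < 1 \<Longrightarrow> P a \<Longrightarrow> P b"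
  shows "card {r \<in> R. P (f r)} = card {r \<in> R. P r}"
proof -
  have fin: "finite R" and RA: "\<And>r. r \<in> R \<Longrightarrow> r \<in> A" using R by (auto simp: residue_system_def)
  have "\<forall>a\<in>A. \<exists>r. r \<in> R \<and> v (a - r) < 1" using R by (auto simp: residue_system_def)
  then have "\<forall>r\<in>R. \<exists>s. s \<in> R \<and> v (f r - s) < 1" using f RA by blast
  from bchoice[OF this] obtain g
    where g: "\<And>r. r \<in> R \<Longrightarrow> g r \<in> R" "\<And>r. r \<in> R \<Longrightarrow> v (f r - g r) < 1" by blast
  note uniq = residue_system_unique[OF R]
  have "inj_on g R"
  proof (rule inj_onI)
    fix r s assume rs: "r \<in> R" "s \<in> R" "g r = g s"
    then have "v (f r - f s) < 1"
      using g(2)[of r] g(2)[of s] v_cong_trans v_minus_commute[OF v] by metis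
    then show "r = s" using inj RA rs uniq by blast
  qed
  then have im: "g ` R = R" using g(1) fin by (intro endo_inj_surj) auto
  have eq: "P (f r) \<longleftrightarrow> P (g r)" if "r \<in> R" for r
    using P[of "f r" "g r"] P[of "g r" "f r"] g that f RA v_minus_commute[OF v] by metis
  have "card {r \<in> R. P (f r)} = card (g ` {r \<in> R. P (f r)})"
    using \<open>inj_on g R\<close> by (intro card_image[symmetric]) (auto intro: inj_on_subset)
  also have "g ` {r \<in> R. P (f r)} = {r \<in> R. P r}"
    using im eq g(1) by (auto simp: image_iff) (metis imageE)
  finally show ?thesis .
qed

lemma residue_system_count_zero:
  assumes R: "residue_system R A" and "0 \<in> A"
  shows "card {r \<in> R. v r < 1} = 1"
proof -
  obtain r0 where "r0 \<in> R" "v (0 - r0) < 1" using residue_system_ex[OF assms] by blast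
  then have r0: "r0 \<in> R" "v r0 < 1" by (simp_all add: v_simps)
  have "r = r0" if "r \<in> R" "v r < 1" for r
    using residue_system_unique[OF R that(1) r0(1)] v_diff_less[OF v that(2) r0(2)] by blast
  then have "{r \<in> R. v r < 1} = {r0}" using r0 by blast
  then show ?thesis by simp
qed

lemma residue_system_count_root:
  assumes "residue_system R A" "\<And>a. a \<in> A \<Longrightarrow> f a \<in> A" "0 \<in> A"
    "\<And>a b. a \<in> A \<Longrightarrow> b \<in> A \<Longrightarrow> v (f a - f b) < 1 \<Longrightarrow> v (a - b) < 1"
  shows "card {r \<in> R. v (f r) < 1} = 1"
proof -
  have "card {r \<in> R. v (f r) < 1} = card {r \<in> R. v r < 1}"
    using assms(1,2,4)
  proof (rule residue_system_count)
    fix a b assume "v (a - b) < 1" "v a < 1"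
    then show "v b < 1" using v_diff_less[OF v, of a 1 "a - b"] by simp
  qed
  then show ?thesis using residue_system_count_zero[OF assms(1,3)] by simp
qed

abbreviation Ok :: "'a set" where "Ok \<equiv> integers_of v k"
abbreviation Ok' :: "'a set" where "Ok' \<equiv> integers_of v UNIV"

lemma Ok_iff: "a \<in> Ok \<longleftrightarrow> a \<in> k \<and> v a \<le> 1" "a \<in> Ok' \<longleftrightarrow> v a \<le> 1"
  by (auto simp: integers_of_def)

lemma residue_system_k_exists: "\<exists>R. residue_system R Ok \<and> card R = q"
proof -
  define E where "E = {(a, b). a \<in> Ok \<and> b \<in> Ok \<and> a - b \<in> max_ideal_of v k}"
  have Ei: "(a, b) \<in> E \<longleftrightarrow> a \<in> Ok \<and> b \<in> Ok \<and> v (a - b) < 1" for a b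
    by (auto simp: E_def max_ideal_of_def integers_of_def intro: k_closed)
  have eq: "equiv Ok E"
  proof (rule equivI)
    show "E \<subseteq> Ok \<times> Ok" by (auto simp: E_def)
    show "refl_on Ok E" by (auto simp: refl_on_def Ei v_simps)
    show "sym E" by (auto simp: sym_def Ei v_minus_commute[OF v])
    show "trans E" by (auto simp: trans_def Ei intro: v_cong_trans)
  qed
  have cq: "card (Ok // E) = q" by (simp add: residue_card_def E_def)
  \<comment> \<open>An infinite quotient would have cardinality 0, whereas q >= 2.\<close>
  then have fin: "finite (Ok // E)" using pi_props(5) by (metis card.infinite not_numeral_le_zero)
  define r where "r X = (SOME a. a \<in> X)" for X :: "'a set"
  have r: "r X \<in> X" if "X \<in> Ok // E" for X
    using in_quotient_imp_non_empty[OF eq that] unfolding r_def by (metis ex_in_conv someI)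
  have inj: "inj_on r (Ok // E)"
  proof (rule inj_onI)
    fix X Y assume "X \<in> Ok // E" "Y \<in> Ok // E" "r X = r Y"
    then show "X = Y" using r quotient_disj[OF eq] by (metis disjoint_iff)
  qed
  have "residue_system (r ` (Ok // E)) Ok"
    unfolding residue_system_def
  proof (intro conjI ballI)
    show "finite (r ` (Ok // E))" using fin by simp
    show "r ` (Ok // E) \<subseteq> Ok" using r in_quotient_imp_subset[OF eq] by blast
    fix a assume a: "a \<in> Ok"
    have X: "E `` {a} \<in> Ok // E" using a by (rule quotientI)
    have 1: "v (a - r (E `` {a})) < 1" using r[OF X] Ei by auto
    show "\<exists>!s. s \<in> r ` (Ok // E) \<and> v (a - s) < 1"
    proof (rule ex1I[of _ "r (E `` {a})"])
      fix s assume s: "s \<in> r ` (Ok // E) \<and> v (a - s) < 1"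
      then obtain Y where Y: "Y \<in> Ok // E" "s = r Y" by blast
      have "s \<in> Ok" "s \<in> Y" using Y r in_quotient_imp_subset[OF eq] by blast+
      then have "s \<in> E `` {a}" using s a Ei by auto
      then have "Y = E `` {a}" using quotient_disj[OF eq X Y(1)] \<open>s \<in> Y\<close> by blast
      then show "s = r (E `` {a})" using Y by simp
    qed (use X 1 in blast)
  qed
  moreover have "card (r ` (Ok // E)) = q" using card_image[OF inj] cq by simp
  ultimately show ?thesis by blast
qed

definition Rk :: "'a set" where "Rk = (SOME R. residue_system R Ok \<and> card R = q)"

lemma Rk: "residue_system Rk Ok" "card Rk = q"
  using someI_ex[OF residue_system_k_exists] by (auto simp: Rk_def)

definition \<delta> :: 'a where "\<delta> = (SOME d. v d = 1 \<and> star d = - d)"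

lemma delta: "v \<delta> = 1" "star \<delta> = - \<delta>" "\<delta> \<noteq> 0"
proof -
  have "\<exists>d. v d = 1 \<and> star d = - d" using skew_unit by blast
  from someI_ex[OF this] show "v \<delta> = 1" "star \<delta> = - \<delta>" by (auto simp: \<delta>_def)
  then show "\<delta> \<noteq> 0" using v_simps(4) by force
qed

definition Rk' :: "'a set" where "Rk' = (\<lambda>(x, y). x + \<delta> * y) ` (Rk \<times> Rk)"

text \<open>As 2 is a unit and \<open>star\<close> an isometry, |a| is the larger of |a +
  \<open>star\<close> a| and |a - \<open>star\<close> a|. A congruence in k' thereby becomes one
  condition on the trace part and one on the skew part, which the counts below solve
  separately.\<close>

lemma split_real_skew: "v a < r \<longleftrightarrow> v (a + star a) < r \<and> v (a - star a) < r"
  "v a \<le> r \<longleftrightarrow> v (a + star a) \<le> r \<and> v (a - star a) \<le> r"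
proof -
  have e: "(a + star a) + (a - star a) = 2 * a" by simp
  have f: "v (2 * a) = v a" by (simp add: v_simps v_two)
  show "v a < r \<longleftrightarrow> v (a + star a) < r \<and> v (a - star a) < r"
    using v_add_less[OF v, of "a + star a" r "a - star a"] v_add_less[OF v, of a r "star a"]
      v_diff_less[OF v, of a r "star a"] unfolding e f by auto
  show "v a \<le> r \<longleftrightarrow> v (a + star a) \<le> r \<and> v (a - star a) \<le> r"
    using v_add_le[OF v, of "a + star a" r "a - star a"] v_add_le[OF v, of a r "star a"]
      v_diff_le[OF v, of a r "star a"] unfolding e f by auto
qed

lemma v_split:
  assumes "x \<in> k" "y \<in> k"
  shows "v (x + \<delta> * y) < r \<longleftrightarrow> v x < r \<and> v y < r" "v (x + \<delta> * y) \<le> r \<longleftrightarrow> v x \<le> r \<and> v y \<le> r"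
proof -
  have s: "star x = x" "star y = y" using assms by (simp_all add: star_fixed)
  have 1: "(x + \<delta> * y) + star (x + \<delta> * y) = 2 * x" "(x + \<delta> * y) - star (x + \<delta> * y) = 2 * \<delta> * y"
    by (auto simp: star_simps s delta)
  show "v (x + \<delta> * y) < r \<longleftrightarrow> v x < r \<and> v y < r" "v (x + \<delta> * y) \<le> r \<longleftrightarrow> v x \<le> r \<and> v y \<le> r"
    by (subst split_real_skew, simp only: 1, simp add: v_simps v_two delta)+
qed

lemma split_exists: obtains x y where "x \<in> k" "y \<in> k" "a = x + \<delta> * y"
proof
  show "(a + star a) / 2 \<in> k" "(a - star a) / (2 * \<delta>) \<in> k"
    using delta by (auto simp: star_simps add.commute field_simps simp flip: star_fixed)
  show "a = (a + star a) / 2 + \<delta> * ((a - star a) / (2 * \<delta>))" using delta by (simp add: field_simps)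
qed

text \<open>For x, y in k, |x + \<delta> y| is the larger of |x| and |y|, so pairs of
  representatives for k represent k'. In particular the residue degree is 2.\<close>

lemma Rk': "residue_system Rk' Ok'" "card Rk' = q\<^sup>2"
proof -
  have RO: "r \<in> k \<and> v r \<le> 1" if "r \<in> Rk" for r
    using Rk that by (auto simp: residue_system_def integers_of_def)
  have uni: "\<exists>!r. r \<in> Rk \<and> v (a - r) < 1" if "a \<in> k" "v a \<le> 1" for a
    using Rk that by (auto simp: residue_system_def integers_of_def)
  have inj: "inj_on (\<lambda>(x, y). x + \<delta> * y) (Rk \<times> Rk)"
  proof (rule inj_onI, clarify)
    fix x y x' y' assume "x \<in> Rk" "y \<in> Rk" "x' \<in> Rk" "y' \<in> Rk" and e: "x + \<delta> * y = x' + \<delta> * y'"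
    then have k: "x \<in> k" "y \<in> k" "x' \<in> k" "y' \<in> k" using RO by auto
    have "(x - x') + \<delta> * (y - y') = 0" using e by (simp add: algebra_simps)
    then have "v ((x - x') + \<delta> * (y - y')) \<le> 0" by (simp add: v_simps)
    then have "v (x - x') \<le> 0" "v (y - y') \<le> 0" using v_split(2) k k_closed by blast+
    then show "x = x' \<and> y = y'" using v_simps(1,2) by (metis antisym eq_iff_diff_eq_0)
  qed
  show "card Rk' = q\<^sup>2" unfolding Rk'_def using card_image[OF inj]
    by (simp add: card_cartesian_product Rk power2_eq_square)
  show "residue_system Rk' Ok'"
    unfolding residue_system_def
  proof (intro conjI ballI)
    show "finite Rk'" using Rk by (auto simp: Rk'_def residue_system_def)
    show "Rk' \<subseteq> Ok'" using RO by (auto simp: Rk'_def integers_of_def v_split)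
    fix a assume "a \<in> Ok'"
    obtain x y where xy: "x \<in> k" "y \<in> k" "a = x + \<delta> * y" by (rule split_exists)
    with \<open>a \<in> Ok'\<close> have "v x \<le> 1" "v y \<le> 1" using v_split[OF xy(1,2)] by (auto simp: integers_of_def)
    with xy uni obtain x' y' where x': "x' \<in> Rk" "v (x - x') < 1" "\<And>s. s \<in> Rk \<Longrightarrow> v (x - s) < 1 \<Longrightarrow> s = x'"
      and y': "y' \<in> Rk" "v (y - y') < 1" "\<And>s. s \<in> Rk \<Longrightarrow> v (y - s) < 1 \<Longrightarrow> s = y'" by metis
    have d: "a - (s + \<delta> * t) = (x - s) + \<delta> * (y - t)" for s t using xy by (simp add: algebra_simps)
    show "\<exists>!r. r \<in> Rk' \<and> v (a - r) < 1"
    proof (rule ex1I[of _ "x' + \<delta> * y'"])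
      show "x' + \<delta> * y' \<in> Rk' \<and> v (a - (x' + \<delta> * y')) < 1"
        unfolding d using x'(1,2) y'(1,2) xy RO k_closed by (auto simp: Rk'_def v_split)
      fix r assume r: "r \<in> Rk' \<and> v (a - r) < 1"
      then obtain s t where st: "r = s + \<delta> * t" "s \<in> Rk" "t \<in> Rk" by (auto simp: Rk'_def)
      with r have "v (x - s) < 1 \<and> v (y - t) < 1" unfolding st(1) d
        using v_split(1)[of "x - s" "y - t"] xy RO k_closed by metis
      then show "r = x' + \<delta> * y'" using x' y' st by blast
    qed
  qed
qed

lemma Rk_mem: "r \<in> Rk \<Longrightarrow> r \<in> k" "r \<in> Rk \<Longrightarrow> v r \<le> 1" "finite Rk"
  using Rk by (auto simp: residue_system_def integers_of_def)

lemma Rk'_mem: "r \<in> Rk' \<Longrightarrow> v r \<le> 1" "finite Rk'"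
  using Rk' by (auto simp: residue_system_def integers_of_def)

section \<open>Fibres of the norm map on residue classes\<close>

lemma v_mult_cong:
  assumes "v (a - a') < 1" "v (b - b') < 1" "v a \<le> 1" "v b' \<le> 1"
  shows "v (a * b - a' * b') < 1"
proof -
  have e: "a * b - a' * b' = a * (b - b') + (a - a') * b'" by (simp add: algebra_simps)
  have "v (a * (b - b')) < 1" "v ((a - a') * b') < 1" using assms v_simps(1)
      mult_left_le_one_le[of "v (b - b')" "v a"] mult_right_le_one_le[of "v (a - a')" "v b'"]
    by (auto simp: v_simps(3) intro: le_less_trans)
  then show ?thesis unfolding e by (rule v_add_less[OF v])
qed

lemma norm_cong: "v (a - b) < 1 \<Longrightarrow> v a \<le> 1 \<Longrightarrow> v b \<le> 1 \<Longrightarrow> v (a * star a - b * star b) < 1"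
  by (rule v_mult_cong) (simp_all flip: star_simps)

lemma norm_cong_right:
  assumes "v (a - b) < 1" "v a \<le> 1" "v b \<le> 1" "v (a * star a - c) < 1"
  shows "v (b * star b - c) < 1"
  using v_cong_trans[of "b * star b" "a * star a" 1 c] norm_cong[of b a] assms v_minus_commute[OF v] by metis

text \<open>For a fixed solution \<open>x\<^sub>0\<close>, the Cayley transform \<open>x \<mapsto> (x - x\<^sub>0) / ((x + x\<^sub>0) \<delta>)\<close> embeds the
  other solutions into \<open>k \<union> {\<infinity>}\<close>.\<close>

lemma norm_count_le:
  assumes c: "c \<in> k" "v c = 1"
  shows "card {r \<in> Rk'. v (r * star r - c) < 1} \<le> q + 1"
proof (cases "{r \<in> Rk'. v (r * star r - c) < 1} = {}")
  case False
  let ?T = "{r \<in> Rk'. v (r * star r - c) < 1}"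
  obtain x0 where x0: "x0 \<in> Rk'" "v (x0 * star x0 - c) < 1" using False by blast
  have unit: "v x = 1" if "x \<in> ?T" for x
  proof -
    have "v (x * star x) = 1" using v_close_eq[OF v, of "x * star x" c] that c by simp
    then show ?thesis using v_simps(1)[of x] by (simp add: v_norm power2_eq_1_iff)
  qed
  note uniq = residue_system_unique[OF Rk'(1)]
  define bad where "bad = {x \<in> ?T. v (x + x0) < 1}"
  define m where "m x = (x - x0) / ((x + x0) * \<delta>)" for x
  have "card bad \<le> 1"
  proof -
    have "x = y" if "x \<in> bad" "y \<in> bad" for x y
      using that uniq v_diff_less[OF v, of "x + x0" 1 "y + x0"] by (auto simp: bad_def)
    then show ?thesis using Rk'_mem(2) by (intro card_le_Suc0_iff_eq[THEN iffD2, unfolded One_nat_def[symmetric]]) (auto simp: bad_def)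
  qed
  have good: "v (x + x0) = 1" if "x \<in> ?T - bad" for x
    using that v_add_le[OF v, of x 1 x0] unit[of x] unit[of x0] x0 by (force simp: bad_def)
  have "\<exists>r\<in>Rk. v (m x - r) < 1" if x: "x \<in> ?T - bad" for x
  proof -
    have xx: "v (x + x0) = 1" "v x = 1" "v x0 = 1"
      using good[OF x] unit[of x] unit[of x0] x x0 by simp_all
    have nz: "x + x0 \<noteq> 0" "star x + star x0 \<noteq> 0" "x \<noteq> 0" "x0 \<noteq> 0"
      using xx v_simps(4) star_simps(11)[of "x + x0"] star(2)[of x x0] by fastforce+
    have vm: "v (m x) \<le> 1" using xx delta v_diff_le[OF v, of x 1 x0] by (simp add: m_def v_simps)
    have "star (m x) = (star x - star x0) / ((star x + star x0) * (- \<delta>))"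
      by (simp add: m_def star_simps delta)
    then have "star (m x) * ((x + x0) * (star x + star x0) * \<delta>) = - (star x - star x0) * (x + x0)"
      using nz(2) delta(3) by (simp, simp add: algebra_simps)
    moreover have "m x * ((x + x0) * (star x + star x0) * \<delta>) = (x - x0) * (star x + star x0)"
      using nz(1) delta(3) by (simp add: m_def)
    ultimately have "(m x - star (m x)) * ((x + x0) * (star x + star x0) * \<delta>) =
        (x - x0) * (star x + star x0) - (- (star x - star x0) * (x + x0))"
      by (simp only: left_diff_distrib)
    also have "\<dots> = 2 * (x * star x - x0 * star x0)" by (simp add: algebra_simps)
    finally have "v ((m x - star (m x)) * ((x + x0) * (star x + star x0) * \<delta>)) =
        v (2 * (x * star x - x0 * star x0))" by (rule arg_cong)
    moreover have "v (star x + star x0) = 1" using xx v_star[of "x + x0"] by (simp add: star_simps)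
    moreover have "v (x * star x - x0 * star x0) < 1"
      using v_cong_trans[of "x * star x" c 1 "x0 * star x0"] v_minus_commute[OF v, of c] x x0 by simp
    ultimately have sk: "v (m x - star (m x)) < 1" using xx delta(1) v_two by (simp only: v_simps(3))
    define y where "y = (m x + star (m x)) / 2"
    have "y \<in> k" by (simp add: y_def star_simps add.commute flip: star_fixed)
    moreover have "v y \<le> 1" using vm v_add_le[OF v, of "m x" 1 "star (m x)"] by (simp add: y_def v_simps v_two)
    ultimately obtain r where r: "r \<in> Rk" "v (y - r) < 1"
      using residue_system_ex[OF Rk(1), of y] by (auto simp: Ok_iff)
    have "m x - y = (m x - star (m x)) / 2" by (simp add: y_def field_simps)
    then have "v (m x - y) = v (m x - star (m x))" by (simp only: v_simps(8) v_two div_by_1)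
    then have "v (m x - y) < 1" using sk by simp
    with r show ?thesis using v_cong_trans by blast
  qed
  then obtain g where g: "\<And>x. x \<in> ?T - bad \<Longrightarrow> g x \<in> Rk \<and> v (m x - g x) < 1" by metis
  have "inj_on g (?T - bad)"
  proof (rule inj_onI)
    fix x y assume xy: "x \<in> ?T - bad" "y \<in> ?T - bad" "g x = g y"
    have u: "v (x + x0) = 1" "v (y + x0) = 1" "v x0 = 1"
      using good[OF xy(1)] good[OF xy(2)] unit[of x0] x0 by simp_all
    then have nz: "x + x0 \<noteq> 0" "y + x0 \<noteq> 0" using v_simps(4) by auto
    have "v (m x - m y) < 1" 
      using g[OF xy(1)] g[OF xy(2)] xy(3) v_cong_trans[of "m x" "g x" 1 "m y"]
        v_minus_commute[OF v, of "m y"] by simp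
    moreover have "(m x - m y) * ((x + x0) * (y + x0) * \<delta>) = 2 * x0 * (x - y)"
    proof -
      have "m x * ((x + x0) * (y + x0) * \<delta>) = (x - x0) * (y + x0)"
        "m y * ((x + x0) * (y + x0) * \<delta>) = (y - x0) * (x + x0)"
        using nz delta(3) by (simp_all add: m_def)
      then show ?thesis by (simp only: left_diff_distrib) (simp add: algebra_simps)
    qed
    then have "v (m x - m y) * (v (x + x0) * v (y + x0) * v \<delta>) = v 2 * v x0 * v (x - y)"
      by (metis v_simps(3))
    ultimately have "v (x - y) < 1" using u delta v_two by simp
    then show "x = y" using uniq xy by auto
  qed
  then have "card (?T - bad) \<le> card Rk" using g Rk_mem(3) by (intro card_inj_on_le) auto
  moreover have "card ?T = card (?T - bad) + card bad"
  proof -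
    have sub: "bad \<subseteq> ?T" and fin: "finite ?T" using Rk'_mem(2) by (auto simp: bad_def)
    then have "card (?T - bad) = card ?T - card bad" by (intro card_Diff_subset finite_subset[OF sub fin])
    then show ?thesis using card_mono[OF fin sub] by simp
  qed
  ultimately show ?thesis using \<open>card bad \<le> 1\<close> Rk(2) by linarith
next
  case True
  then show ?thesis by (simp only: card.empty zero_le)
qed

text \<open>The q^2 - 1 unit classes of k' are distributed over the q - 1 unit classes of k by the
  norm. Each fibre has at most q + 1 elements by \<open>norm_count_le\<close>, and (q - 1)(q + 1) =
  q^2 - 1, so equality holds everywhere.\<close>

lemma norm_count_unit:
  assumes c: "c \<in> k" "v c = 1"
  shows "card {r \<in> Rk'. v (r * star r - c) < 1} = q + 1"
proof -
  let ?T = "\<lambda>c. {r \<in> Rk'. v (r * star r - c) < 1}"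
  define U where "U = {r \<in> Rk. v r = 1}"
  have one: "card {r \<in> Rk. v r < 1} = 1" "card {r \<in> Rk'. v r < 1} = 1"
    using residue_system_count_zero[OF Rk(1)] residue_system_count_zero[OF Rk'(1)]
    by (auto simp: Ok_iff v_simps k_closed)
  have "U = Rk - {r \<in> Rk. v r < 1}" using Rk_mem by (force simp: U_def)
  then have cU: "card U = q - 1" using one(1) Rk(2) Rk_mem(3) by (simp add: card_Diff_subset)
  have finU: "finite U" using Rk_mem(3) by (simp add: U_def)
  let ?U' = "Rk' - {r \<in> Rk'. v r < 1}"
  have cU': "card ?U' = q\<^sup>2 - 1" using one(2) Rk' Rk'_mem(2) by (simp add: card_Diff_subset)
  have "?U' = (\<Union>u\<in>U. ?T u)"
  proof (intro equalityI subsetI)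
    fix x assume x: "x \<in> ?U'"
    then have vx: "v x = 1" using Rk'_mem(1)[of x] by force
    then have "x * star x \<in> Ok" by (simp add: Ok_iff norm_in_k v_simps)
    then obtain u where u: "u \<in> Rk" "v (x * star x - u) < 1"
      using residue_system_ex[OF Rk(1)] by blast
    have "v u = 1" using v_close_eq[OF v, of u "x * star x"] u vx v_minus_commute[OF v, of u]
      by (simp add: v_simps)
    then show "x \<in> (\<Union>u\<in>U. ?T u)" using u x by (auto simp: U_def)
  next
    fix x assume "x \<in> (\<Union>u\<in>U. ?T u)"
    then obtain u where u: "x \<in> Rk'" "v u = 1" "v (x * star x - u) < 1" by (auto simp: U_def)
    then have "v (x * star x) = 1" using v_close_eq[OF v, of "x * star x" u] by simp
    then have "\<not> v x < 1" using v_simps(1)[of x] by (auto simp: v_norm power2_eq_square mult_le_one)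
      (smt (verit) mult_left_le)
    then show "x \<in> ?U'" using u by simp
  qed
  moreover have "card (\<Union>u\<in>U. ?T u) = (\<Sum>u\<in>U. card (?T u))"
  proof (rule card_UN_disjoint[OF finU])
    show "\<forall>u\<in>U. finite (?T u)" using Rk'_mem(2) by simp
    have "u = u'" if "u \<in> U" "u' \<in> U" "x \<in> ?T u" "x \<in> ?T u'" for u u' x
    proof -
      have "v (u - u') < 1" using v_cong_trans[of u "x * star x" 1 u'] v_minus_commute[OF v, of u] that by simp
      then show ?thesis using residue_system_unique[OF Rk(1)] that(1,2) by (simp add: U_def)
    qed
    then show "\<forall>i\<in>U. \<forall>j\<in>U. i \<noteq> j \<longrightarrow> ?T i \<inter> ?T j = {}" by blast
  qed
  ultimately have s: "(\<Sum>u\<in>U. card (?T u)) = q\<^sup>2 - 1" using cU' by simp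
  have le: "card (?T u) \<le> q + 1" if "u \<in> U" for u
    using norm_count_le that Rk_mem by (auto simp: U_def)
  have all: "card (?T u) = q + 1" if u: "u \<in> U" for u
  proof (rule ccontr)
    assume "card (?T u) \<noteq> q + 1"
    then have "card (?T u) < q + 1" using le[OF u] by simp
    then have "(\<Sum>u\<in>U. card (?T u)) < (\<Sum>u\<in>U. q + 1)"
      using finU u le by (intro sum_strict_mono_ex1) auto
    also have "\<dots> = q\<^sup>2 - 1" using pi_props(5) by (simp add: cU power2_eq_square algebra_simps)
    finally show False using s by simp
  qed
  have "c \<in> Ok" using c by (simp add: Ok_iff)
  then obtain u where u: "u \<in> Rk" "v (c - u) < 1" using residue_system_ex[OF Rk(1)] by blast
  then have "v u = 1" using v_close_eq[OF v, of u c] c v_minus_commute[OF v] by simp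
  then have "card (?T u) = q + 1" using u all by (simp add: U_def)
  moreover have "v (r * star r - u) < 1 \<longleftrightarrow> v (r * star r - c) < 1" for r
    using u(2) v_cong_trans[of "r * star r" u 1 c] v_cong_trans[of "r * star r" c 1 u]
      v_minus_commute[OF v, of c u] by auto
  ultimately show ?thesis by simp
qed

lemma norm_count:
  assumes c: "c \<in> k" "v c \<le> 1"
  shows "card {r \<in> Rk'. v (r * star r - c) < 1} = (if v c = 1 then q + 1 else 1)"
proof (cases "v c = 1")
  case False
  then have c1: "v c < 1" using c by simp
  have "v (r * star r - c) < 1 \<longleftrightarrow> v r < 1" for r
  proof -
    have "v (r * star r - c) < 1 \<longleftrightarrow> v (r * star r) < 1"
      using v_add_less[OF v, of "r * star r - c" 1 c] v_diff_less[OF v, of "r * star r" 1 c] c1 by auto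
    also have "\<dots> \<longleftrightarrow> v r < 1" using v_simps(1)[of r] by (simp add: v_norm power_less_one_iff)
    finally show ?thesis .
  qed
  then show ?thesis using False residue_system_count_zero[OF Rk'(1)] by (simp add: Ok_iff v_simps)
qed (use norm_count_unit[OF c(1)] in simp)

end

section \<open>Counting unipotent translates\<close>

context unramified_quadratic
begin

text \<open>The Hermitian form that the antidiagonal matrix of size 2n + 1 induces on the middle
  three coordinates.\<close>

definition form :: "'a \<Rightarrow> 'a \<Rightarrow> 'a \<Rightarrow> 'a" where
  "form w1 w2 w3 = star w1 * w3 + w1 * star w3 + w2 * star w2"

lemma form_in_k: "form w1 w2 w3 \<in> k"
  unfolding form_def by (simp add: star_simps algebra_simps flip: star_fixed)

text \<open>\<open>tr_b\<close> and \<open>tr_g\<close> are the parameters \<beta>, \<gamma> of a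
  lower unitriangular element of the middle unitary group. Unitarity prescribes \<gamma> +
  \<open>star\<close> \<gamma>, so only the skew part of \<gamma> is free; \<open>j\<close> and
  \<open>i\<close> are the depths of \<beta> and of that skew part.\<close>

definition tr_b :: "nat \<Rightarrow> 'a \<Rightarrow> 'a" where "tr_b j b = \<pi> ^ j * b"
definition tr_g :: "nat \<Rightarrow> nat \<Rightarrow> 'a \<Rightarrow> 'a \<Rightarrow> 'a" where
  "tr_g j i b r = \<pi> ^ i * \<delta> * r - tr_b j b * star (tr_b j b) / 2"

lemma star_pi_pow: "star (\<pi> ^ m) = \<pi> ^ m"
  by (simp add: star_simps)

lemma pi_pow_nz [simp]: "\<pi> ^ m \<noteq> 0"
  using pi_props by simp

lemma tr_g_trace: "r \<in> k \<Longrightarrow> tr_g j i b r + star (tr_g j i b r) + tr_b j b * star (tr_b j b) = 0"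
  using pi_props(3) by (simp add: tr_g_def tr_b_def star_simps delta star(4) field_simps)

lemma form_trace: "v w1 \<le> 1 \<Longrightarrow> v (star w1 * w3 + w1 * star w3) \<le> v w3"
  by (rule v_add_le[OF v]) (auto simp: v_simps mult_left_le_one_le)

text \<open>The arguments on the left are the image of w under the unitriangular element with
  parameters \<beta>, \<gamma>, and the hypothesis is its unitarity. The third coordinate of the
  image is the quantity that is counted below.\<close>

lemma form_invariant:
  assumes "\<gamma> + star \<gamma> + \<beta> * star \<beta> = 0"
  shows "form w1 (w2 - star \<beta> * w1) (w3 + \<beta> * w2 + \<gamma> * w1) = form w1 w2 w3"
proof -
  have "form w1 (w2 - star \<beta> * w1) (w3 + \<beta> * w2 + \<gamma> * w1) - form w1 w2 w3 =
    w1 * star w1 * (\<gamma> + star \<gamma> + \<beta> * star \<beta>)"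
    by (simp add: form_def star_simps algebra_simps)
  then show ?thesis using assms by simp
qed

lemma v_tr_b: "v (tr_b j b) = v \<pi> ^ j * v b"
  by (simp add: tr_b_def v_simps)

lemma v_tr_g: assumes "v b \<le> 1" "v r \<le> 1" "v \<pi> ^ i \<le> s" "v \<pi> ^ (2 * j) \<le> s"
  shows "v (tr_g j i b r) \<le> s"
  unfolding tr_g_def
proof (rule v_diff_le[OF v])
  show "v (\<pi> ^ i * \<delta> * r) \<le> s"
    using order_trans[OF mult_left_le[of "v r" "v \<pi> ^ i"]] assms pi_props(1) by (simp add: v_simps(3,9) delta)
  have "v b * v b \<le> 1" using assms v_simps(1) by (simp add: mult_le_one)
  then have "v \<pi> ^ (2 * j) * (v b * v b) \<le> v \<pi> ^ (2 * j)"
    using pi_props(1) by (intro mult_left_le) auto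
  then show "v (tr_b j b * star (tr_b j b) / 2) \<le> s" using assms
    by (simp add: v_simps v_tr_b v_two power_mult power2_eq_square algebra_simps power_mult_distrib)
qed

text \<open>The exponent of |a|^2 is even, so a bound with the odd exponent 2m - 1 improves to 2m.
  For m = 0 truncated subtraction makes the bound 1, which is what the claim needs there.\<close>

lemma v_sq_le:
  assumes "v a ^ 2 \<le> v \<pi> ^ (2 * m - 1)" shows "v a \<le> v \<pi> ^ m"
proof (cases m)
  case 0
  then show ?thesis using assms v_simps(1)[of a] by (simp add: power_le_one_iff)
next
  case (Suc m')
  have "v a < v \<pi> ^ m'"
  proof (rule ccontr)
    assume "\<not> v a < v \<pi> ^ m'"
    then have "(v \<pi> ^ m') ^ 2 \<le> v a ^ 2" using pi_props(1) by (intro power_mono) auto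
    also have "\<dots> \<le> v \<pi> ^ (2 * m' + 1)" using assms Suc by simp
    also have "\<dots> < v \<pi> ^ (2 * m')" using pi_props by simp
    finally show False by (simp add: power_mult power_mult_distrib flip: power_mult) (simp add: mult.commute)
  qed
  then show ?thesis using v_less_pow Suc by blast
qed

lemma v_sq_odd: "v a ^ 2 = v \<pi> ^ l \<Longrightarrow> even l \<and> v a = v \<pi> ^ (l div 2)"
proof -
  assume a: "v a ^ 2 = v \<pi> ^ l"
  define m where "m = (l + 1) div 2"
  have "v \<pi> ^ l \<le> v \<pi> ^ (2 * m - 1)" using pi_props unfolding m_def by (intro power_decreasing) auto
  with a have le: "v a \<le> v \<pi> ^ m" by (intro v_sq_le) simp
  have "even l"
  proof (rule ccontr)
    assume "odd l"
    have "v a ^ 2 \<le> (v \<pi> ^ m) ^ 2" using le v_simps(1) by (intro power_mono) auto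
    also have "\<dots> = v \<pi> ^ (2 * m)" by (simp add: mult.commute flip: power_mult)
    also have "\<dots> = v \<pi> ^ (l + 1)" using \<open>odd l\<close> by (simp add: m_def)
    also have "\<dots> < v \<pi> ^ l" using pi_props by simp
    finally show False using a by simp
  qed
  moreover from this have "v a ^ 2 = (v \<pi> ^ (l div 2)) ^ 2" using a by (simp flip: power_mult)
  then have "v a = v \<pi> ^ (l div 2)" using v_simps(1)[of a] pi_props(1)
    by (metis power2_eq_imp_eq zero_le_power less_imp_le)
  ultimately show ?thesis by blast
qed

lemma skew_root_count:
  assumes "v w1 = 1" "s \<in> k" "v s \<le> 1"
  shows "card {r \<in> Rk. v (r * (w1 * star w1) + s) < 1} = 1"
proof (rule residue_system_count_root[OF Rk(1)])
  show "r * (w1 * star w1) + s \<in> Ok" if "r \<in> Ok" for r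
    using that assms norm_in_k k_closed by (auto simp: Ok_iff v_simps intro!: v_add_le[OF v])
  show "0 \<in> Ok" by (simp add: Ok_iff k_closed v_simps)
  show "v (a - b) < 1" if "v ((a * (w1 * star w1) + s) - (b * (w1 * star w1) + s)) < 1" for a b
  proof -
    have "(a * (w1 * star w1) + s) - (b * (w1 * star w1) + s) = (a - b) * (w1 * star w1)"
      by (simp add: algebra_simps)
    then show ?thesis using that assms by (simp add: v_simps)
  qed
qed

text \<open>Multiplication by the unit \<open>star w1\<close> leaves the size unchanged. The trace
  part then does not involve r and is small by hypothesis, while the skew part is linear in r with
  the unit coefficient \<open>w1 * star w1\<close>.\<close>

lemma skew_count:
  assumes w1: "v w1 = 1" and w3: "v w3 \<le> v \<pi> ^ i" and tr: "v (star w1 * w3 + w1 * star w3) < v \<pi> ^ i"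
  shows "card {r \<in> Rk. v (w3 + \<pi> ^ i * \<delta> * r * w1) < v \<pi> ^ i} = 1"
proof -
  define s where "s = (star w1 * w3 - w1 * star w3) / (2 * \<pi> ^ i * \<delta>)"
  have s: "s \<in> k" using delta by (simp add: s_def star_simps star_pi_pow divide_simps flip: star_fixed)
  have "v (star w1 * w3 - w1 * star w3) \<le> v \<pi> ^ i"
    using w1 w3 by (intro v_diff_le[OF v]) (simp_all add: v_simps)
  then have vs: "v s \<le> 1" using pi_props(1) by (simp add: s_def v_simps v_two delta)
  have "v (w3 + \<pi> ^ i * \<delta> * r * w1) < v \<pi> ^ i \<longleftrightarrow> v (r * (w1 * star w1) + s) < 1" if "r \<in> Rk" for r
  proof -
    have r: "star r = r" using Rk_mem(1)[OF that] by (simp add: star_fixed)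
    define e where "e = star w1 * (w3 + \<pi> ^ i * \<delta> * r * w1)"
    have "v (w3 + \<pi> ^ i * \<delta> * r * w1) = v e" using w1 by (simp add: e_def v_simps)
    moreover have "e + star e = star w1 * w3 + w1 * star w3"
      by (simp add: e_def star_simps r delta algebra_simps)
    moreover have "e - star e = (2 * \<pi> ^ i * \<delta>) * (r * (w1 * star w1) + s)"
      using delta(3) pi_props(3) by (simp add: e_def s_def star_simps r delta field_simps)
    then have "v (e - star e) = v \<pi> ^ i * v (r * (w1 * star w1) + s)"
      by (simp only: v_simps(3,9) v_two delta(1) mult_1 mult_1_right)
    ultimately show ?thesis using split_real_skew(1)[of e "v \<pi> ^ i"] tr pi_props(1) by simp
  qed
  then have "{r \<in> Rk. v (w3 + \<pi> ^ i * \<delta> * r * w1) < v \<pi> ^ i} = {r \<in> Rk. v (r * (w1 * star w1) + s) < 1}"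
    by blast
  then show ?thesis using skew_root_count[OF w1 s vs] by simp
qed

text \<open>After multiplication by \<open>star w1\<close> the skew part determines r for every b.
  In the trace part the square is completed: with \<open>P\<close> = \<pi>^m and \<open>x b\<close>
  = w2/\<open>P\<close> - \<open>star b * w1\<close> it says that the norm of \<open>x b\<close> is
  congruent to \<open>form w1 w2 w3\<close> divided by \<open>P\<close>^2. This norm equation has q
  + 1 solutions if the right side is a unit and one otherwise.\<close>

lemma heis_count:
  assumes w1: "v w1 = 1" and w2: "v w2 \<le> v \<pi> ^ m" and w3: "v w3 \<le> v \<pi> ^ (2 * m)"
  shows "card {(b, r) \<in> Rk' \<times> Rk. v (w3 + tr_b m b * w2 + tr_g m (2 * m) b r * w1) < v \<pi> ^ (2 * m)} =
    (if v (form w1 w2 w3) = v \<pi> ^ (2 * m) then q + 1 else 1)"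
proof -
  define P where "P = \<pi> ^ m"
  have P: "star P = P" "P \<noteq> 0" "\<pi> ^ (2 * m) = P * P" "v \<pi> ^ m = v P"
    using pi_props(3) by (simp_all add: P_def star_pi_pow v_simps mult_2 power_add)
  have vP: "0 < v P" "v \<pi> ^ (2 * m) = v P * v P" using P by (simp_all add: v_simps mult_2 power_add)
  define c where "c = form w1 w2 w3"
  define x where "x b = w2 / P - star b * w1" for b
  define y where "y b = star w1 * (w3 + P * b * w2)" for b
  define s where "s b = (y b - star (y b)) / (2 * P * P * \<delta>)" for b
  have s: "s b \<in> k" for b using delta P by (simp add: s_def star_simps field_simps flip: star_fixed)
  have vs: "v (s b) \<le> 1" if "b \<in> Rk'" for b
  proof -
    have "v (P * b * w2) \<le> v P * v P"
      unfolding v_simps(3) using w2 Rk'_mem(1)[OF that] vP(1) v_simps(1)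
      by (intro mult_mono) (auto simp: P(4) mult_left_le)
    then have "v (y b) \<le> v P * v P"
      using w1 w3 vP(2) by (simp add: y_def v_simps(3) v_add_le[OF v])
    then have "v (y b - star (y b)) \<le> v P * v P" by (intro v_diff_le[OF v]) auto
    then show ?thesis using vP by (simp add: s_def v_simps v_two delta)
  qed
  have ck: "c / (P * P) \<in> k" using form_in_k P by (auto simp: c_def star_simps simp flip: star_fixed)
  have "v c \<le> v P * v P"
    unfolding c_def form_def
  proof (rule v_add_le[OF v])
    show "v (star w1 * w3 + w1 * star w3) \<le> v P * v P" using form_trace[of w1 w3] w1 w3 vP by simp
    show "v (w2 * star w2) \<le> v P * v P" using w2 P v_simps(1) by (simp add: v_simps mult_mono)
  qed
  then have vc: "v (c / (P * P)) \<le> 1" using vP by (simp add: v_simps)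
  have iff: "v (w3 + tr_b m b * w2 + tr_g m (2 * m) b r * w1) < v \<pi> ^ (2 * m) \<longleftrightarrow>
     v (x b * star (x b) - c / (P * P)) < 1 \<and> v (r * (w1 * star w1) + s b) < 1"
    if "r \<in> Rk" for b r
  proof -
    have r: "star r = r" using Rk_mem(1)[OF that] by (simp add: star_fixed)
    define e where "e = star w1 * (w3 + tr_b m b * w2 + tr_g m (2 * m) b r * w1)"
    have e': "e = y b + (P * P * \<delta> * r - P * P * b * star b / 2) * (w1 * star w1)"
      by (simp add: e_def y_def tr_b_def tr_g_def P star_simps flip: P_def) (simp add: algebra_simps)
    have ve: "v (w3 + tr_b m b * w2 + tr_g m (2 * m) b r * w1) = v e" using w1 by (simp add: e_def v_simps)
    have "e + star e = y b + star (y b) - P * P * b * star b * (w1 * star w1)"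
      by (simp add: e' star_simps r delta P) (simp add: algebra_simps)
    also have "\<dots> = - (P * P) * (x b * star (x b) - c / (P * P))"
      using P(2) by (simp add: x_def y_def c_def form_def star_simps P field_simps)
    finally have "v (e + star e) = v P * v P * v (x b * star (x b) - c / (P * P))"
      by (simp only: v_simps(3,6))
    moreover have "e - star e = (2 * P * P * \<delta>) * (r * (w1 * star w1) + s b)"
      using delta(3) P by (simp add: e' s_def star_simps r delta field_simps)
    then have "v (e - star e) = v P * v P * v (r * (w1 * star w1) + s b)"
      by (simp only: v_simps(3,9) v_two delta(1) mult_1 mult_1_right)
    ultimately show ?thesis unfolding ve using split_real_skew(1)[of e "v P * v P"] vP by simp
  qed
  have one: "card {r \<in> Rk. v (r * (w1 * star w1) + s b) < 1} = 1" if "b \<in> Rk'" for b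
    by (rule skew_root_count[OF w1 s vs[OF that]])
  let ?S = "{b \<in> Rk'. v (x b * star (x b) - c / (P * P)) < 1}"
  have "card {(b, r) \<in> Rk' \<times> Rk. v (w3 + tr_b m b * w2 + tr_g m (2 * m) b r * w1) < v \<pi> ^ (2 * m)} =
     card (SIGMA b:?S. {r \<in> Rk. v (r * (w1 * star w1) + s b) < 1})"
    using iff by (intro arg_cong[where f = card]) auto
  also have "\<dots> = (\<Sum>b\<in>?S. card {r \<in> Rk. v (r * (w1 * star w1) + s b) < 1})"
    using Rk_mem(3) Rk'_mem(2) by (intro card_SigmaI) auto
  also have "\<dots> = (\<Sum>b\<in>?S. 1)"
    by (rule sum.cong[OF refl], rule one) blast
  also have "\<dots> = card ?S" by (rule card_eq_sum[symmetric])
  also have "\<dots> = card {b \<in> Rk'. v (b * star b - c / (P * P)) < 1}"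
  proof (rule residue_system_count[OF Rk'(1), of x "\<lambda>a. v (a * star a - c / (P * P)) < 1"])
    have "v (w2 / P) \<le> 1" using w2 vP(1) P(4) by (simp add: v_simps(8))
    then show "x b \<in> Ok'" if "b \<in> Ok'" for b
      using that w1 by (auto simp: x_def Ok_iff v_simps(3) intro!: v_diff_le[OF v])
    show "v (a - b) < 1" if "v (x a - x b) < 1" for a b
    proof -
      have "x a - x b = star (b - a) * w1" by (simp add: x_def star_simps algebra_simps)
      then show ?thesis using that w1 v_minus_commute[OF v] by (simp add: v_simps(3))
    qed
    show "v (b * star b - c / (P * P)) < 1"
      if "a \<in> Ok'" "b \<in> Ok'" "v (a - b) < 1" "v (a * star a - c / (P * P)) < 1" for a b
      using norm_cong_right that by (auto simp: Ok_iff)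
  qed
  also have "\<dots> = (if v (c / (P * P)) = 1 then q + 1 else 1)" by (rule norm_count[OF ck vc])
  also have "v (c / (P * P)) = 1 \<longleftrightarrow> v c = v \<pi> ^ (2 * m)" using vP by (auto simp: v_simps)
  finally show ?thesis by (simp add: c_def)
qed

text \<open>With j > m the \<gamma> term has size at most q^(-2j) and drops out. What remains is
  linear in b, and its slope has size exactly q^(-(j+m)).\<close>

lemma beta_count:
  assumes w1: "v w1 \<le> 1" and w2: "v w2 = v \<pi> ^ m" and w3: "v w3 \<le> v \<pi> ^ (j + m)" and jm: "m < j"
  shows "card {b \<in> Rk'. v (w3 + tr_b j b * w2 + tr_g j i b 0 * w1) < v \<pi> ^ (j + m)} = 1"
proof -
  define f where "f b = w3 / \<pi> ^ (j + m) + b * (w2 / \<pi> ^ m)" for b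
  have u: "v (w2 / \<pi> ^ m) = 1" using w2 pi_props(1) by (simp add: v_simps)
  have "v (w3 + tr_b j b * w2 + tr_g j i b 0 * w1) < v \<pi> ^ (j + m) \<longleftrightarrow> v (f b) < 1" if b: "b \<in> Rk'" for b
  proof -
    have e: "w3 + tr_b j b * w2 = \<pi> ^ (j + m) * f b"
      using pi_props(3) by (simp add: f_def tr_b_def power_add field_simps)
    have "tr_g j i b 0 = tr_g j (2 * j) b 0" by (simp add: tr_g_def)
    then have "v (tr_g j i b 0) \<le> v \<pi> ^ (2 * j)"
      using v_tr_g[of b 0 "2 * j" _ j] Rk'_mem(1)[OF b] by (simp add: v_simps(4))
    then have "v (tr_g j i b 0 * w1) \<le> v \<pi> ^ (2 * j)"
      using w1 v_simps(1) mult_right_le_one_le[of "v (tr_g j i b 0)" "v w1"]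
      by (simp add: v_simps(3))
    also have "\<dots> < v \<pi> ^ (j + m)" using pi_props jm by (intro power_strict_decreasing) auto
    finally have lt: "v (tr_g j i b 0 * w1) < v \<pi> ^ (j + m)" .
    have "v (w3 + tr_b j b * w2 + tr_g j i b 0 * w1) < v \<pi> ^ (j + m) \<longleftrightarrow> v (w3 + tr_b j b * w2) < v \<pi> ^ (j + m)"
      using v_add_less[OF v _ lt, of "w3 + tr_b j b * w2"]
        v_diff_less[OF v _ lt, of "w3 + tr_b j b * w2 + tr_g j i b 0 * w1"] by auto
    then show ?thesis using pi_props(1) by (simp add: e v_simps)
  qed
  then have "{b \<in> Rk'. v (w3 + tr_b j b * w2 + tr_g j i b 0 * w1) < v \<pi> ^ (j + m)} = {b \<in> Rk'. v (f b) < 1}"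
    by blast
  also have "card \<dots> = 1"
  proof (rule residue_system_count_root[OF Rk'(1)])
    have "v (w3 / \<pi> ^ (j + m)) \<le> 1" using w3 pi_props(1) by (simp add: v_simps)
    then show "f b \<in> Ok'" if "b \<in> Ok'" for b
      using that u v_simps(3)[of b "w2 / \<pi> ^ m"] by (auto simp: f_def Ok_iff simp del: times_divide_eq_right intro!: v_add_le[OF v])
    show "0 \<in> Ok'" by (simp add: Ok_iff v_simps)
    show "v (a - b) < 1" if "v (f a - f b) < 1" for a b
    proof -
      have "f a - f b = (a - b) * (w2 / \<pi> ^ m)" by (simp add: f_def left_diff_distrib diff_divide_distrib)
      then have "v (f a - f b) = v (a - b) * v (w2 / \<pi> ^ m)" by (simp only: v_simps(3))
      then show ?thesis using that u by simp
    qed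
  qed
  finally show ?thesis .
qed

definition primitive :: "'a \<Rightarrow> 'a \<Rightarrow> 'a \<Rightarrow> bool" where
  "primitive w1 w2 w3 \<longleftrightarrow> v w1 \<le> 1 \<and> v w2 \<le> 1 \<and> v w3 \<le> 1 \<and> (v w1 = 1 \<or> v w2 = 1 \<or> v w3 = 1)"

text \<open>For B >= 1 this is the conditional probability that |r w| <= q^(-B-1) given |r w| <=
  q^(-B). The denominators q, q^3 and q^2 are the sizes of the families of translates chosen in
  \<open>step_count\<close>.\<close>

definition rho :: "nat \<Rightarrow> nat \<Rightarrow> real" where
  "rho l B = (if B < l then (if odd B then 1 / q else 1 / q ^ 3)
     else if odd l then 0 else if B = l then (q + 1) / q ^ 3 else 1 / q\<^sup>2)"

lemma v_w2_bound:
  assumes "v w1 \<le> 1" "v w3 \<le> v \<pi> ^ (2 * m - 1)" "v (form w1 w2 w3) \<le> v \<pi> ^ (2 * m - 1)"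
  shows "v w2 \<le> v \<pi> ^ m"
proof -
  have "w2 * star w2 = form w1 w2 w3 - (star w1 * w3 + w1 * star w3)" by (simp add: form_def)
  then have "v (w2 * star w2) \<le> v \<pi> ^ (2 * m - 1)"
    using assms form_trace[of w1 w3] by (simp only:) (intro v_diff_le[OF v]; simp)
  then show ?thesis by (intro v_sq_le) (simp add: v_norm)
qed

text \<open>If w3 is smaller than the form, the norm \<open>w2 * star w2\<close> must carry the
  form, and norms have even valuation. This is why the distribution of |r w| breaks off at q^(-l)
  for odd l.\<close>

lemma v_w2_exact:
  assumes "v w1 \<le> 1" "v w3 < v \<pi> ^ l" "v (form w1 w2 w3) = v \<pi> ^ l"
  shows "even l \<and> v w2 = v \<pi> ^ (l div 2)"
proof -
  have t: "v (- (star w1 * w3 + w1 * star w3)) < v (form w1 w2 w3)"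
    using assms form_trace[of w1 w3] v_simps(6)[of "star w1 * w3 + w1 * star w3"] by linarith
  have "w2 * star w2 = - (star w1 * w3 + w1 * star w3) + form w1 w2 w3" by (simp add: form_def)
  then have "v (w2 * star w2) = v \<pi> ^ l" using v_add_eq[OF v t] assms by simp
  then show ?thesis by (intro v_sq_odd) (simp add: v_norm)
qed

lemma v_w1_unit:
  assumes "primitive w1 w2 w3" "v w3 < 1" "v (form w1 w2 w3) < 1"
  shows "v w1 = 1"
proof -
  have "v w1 \<le> 1" "v w3 \<le> v \<pi> ^ (2 * 1 - 1)" "v (form w1 w2 w3) \<le> v \<pi> ^ (2 * 1 - 1)"
    using assms v_less_pow[of _ 0] by (auto simp: primitive_def)
  from v_w2_bound[OF this] have "v w2 < 1" using pi_props by simp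
  then show ?thesis using assms by (auto simp: primitive_def)
qed

lemma pi_pow_less_one: "0 < l \<Longrightarrow> v \<pi> ^ l < 1" and pi_pow_le_one: "v \<pi> ^ m \<le> 1"
  using pi_props by (auto simp: power_less_one_iff power_le_one_iff)

text \<open>The family \<open>I\<close> and the depths depend on \<open>l\<close> and
  \<open>B\<close> only, not on w, so that one finite set of group elements can be averaged over all
  h of a class. The unipotents are so deep that no translate falls below the next level unless |w3|
  is already at most q^(-B); this gives the value 0 in the other case.\<close>

lemma step_count:
  assumes B: "B \<ge> 1"
  obtains I i j where "finite I" "I \<subseteq> Ok' \<times> Ok" "I \<noteq> {}" "\<And>w1 w2 w3. primitive w1 w2 w3 \<Longrightarrow>
    v (form w1 w2 w3) = v \<pi> ^ l \<Longrightarrow>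
    real (card {(b, r) \<in> I. v (w3 + tr_b j b * w2 + tr_g j i b r * w1) \<le> v \<pi> ^ Suc B}) =
    (if v w3 \<le> v \<pi> ^ B then rho l B * card I else 0)"
proof -
  have zO: "0 \<in> Ok" "0 \<in> Ok'" by (auto simp: Ok_iff v_simps k_closed)
  have RO: "Rk \<subseteq> Ok" "Rk' \<subseteq> Ok'" using Rk(1) Rk'(1) by (auto simp: residue_system_def)
  have q0: "q > 0" using pi_props(5) by simp
  then have Rne: "Rk \<noteq> {}" "Rk' \<noteq> {}" using Rk(2) Rk'(2) by auto
  have fin: "finite Rk" "finite Rk'" using Rk_mem Rk'_mem by auto
  have pB: "v \<pi> ^ B < 1" using B pi_pow_less_one by simp
  have mono: "v \<pi> ^ a \<le> v \<pi> ^ b" if "b \<le> a" for a b using that pi_props by (intro power_decreasing) auto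
  consider (odd) "odd B" "B < l" | (zero) "l \<le> B" "odd l" | (even) "even B" "B \<le> l" | (tail) "l < B" "even l"
    using B by (metis le_eq_less_or_eq linorder_le_less_linear)
  then show ?thesis
  proof cases
    \<comment> \<open>Only the skew parameter is averaged, with \<beta> = 0. For \<open>B\<close> =
      2m - 1 the bound on the norm of w2 gains a factor |\<pi>| by parity, so the trace part is
      small already and one class of r in q succeeds.\<close>
    case odd
    show ?thesis
    proof (rule that[of "{0} \<times> Rk" 0 B], goal_cases)
      case (4 w1 w2 w3)
      have b0: "tr_b 0 0 = 0" by (simp add: tr_b_def)
      have vf: "v (form w1 w2 w3) < 1" using 4 odd pi_pow_less_one by simp
      have S: "{(b, r) \<in> {0} \<times> Rk. v (w3 + tr_b 0 b * w2 + tr_g 0 B b r * w1) \<le> v \<pi> ^ Suc B} =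
         {0} \<times> {r \<in> Rk. v (w3 + \<pi> ^ B * \<delta> * r * w1) < v \<pi> ^ B}"
        unfolding v_less_pow by (auto simp: tr_g_def b0)
      show ?case
      proof (cases "v w3 \<le> v \<pi> ^ B")
        case True
        then have "v w3 < 1" using pB by simp
        then have w1: "v w1 = 1" using v_w1_unit 4 vf by blast
        obtain m where m: "B = 2 * m - 1" "m \<ge> 1" using odd(1) by (metis B add_diff_cancel_right' le_add2 oddE distrib_left mult_2 nat_mult_1_right one_add_one add.assoc diff_Suc_1 Suc_eq_plus1 mult_Suc_right)
        have "v (form w1 w2 w3) \<le> v \<pi> ^ B" using 4(2) odd(2) mono[of B l] by simp
        then have "v w2 \<le> v \<pi> ^ m" using w1 True
          by (rule_tac v_w2_bound[of w1 w3]) (simp_all add: m(1))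
        then have "v (w2 * star w2) \<le> v \<pi> ^ (2 * m)"
          using v_simps(1) by (simp add: v_norm power_mult_distrib power_mono mult.commute power_mult)
        then have "v (w2 * star w2) \<le> v \<pi> ^ Suc B" using m by simp
        moreover have "v (form w1 w2 w3) \<le> v \<pi> ^ Suc B" using 4(2) odd(2) mono[of "Suc B" l] by simp
        ultimately have "v (form w1 w2 w3 - w2 * star w2) \<le> v \<pi> ^ Suc B" by (intro v_diff_le[OF v])
        then have "v (star w1 * w3 + w1 * star w3) < v \<pi> ^ B" unfolding v_less_pow by (simp add: form_def)
        then have "card {r \<in> Rk. v (w3 + \<pi> ^ B * \<delta> * r * w1) < v \<pi> ^ B} = 1"
          by (rule skew_count[OF w1 True])
        then show ?thesis unfolding S using True odd q0 Rk(2) by (simp add: card_cartesian_product rho_def)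
      next
        case False
        have "\<not> v (w3 + \<pi> ^ B * \<delta> * r * w1) < v \<pi> ^ B" if "r \<in> Rk" for r
        proof
          assume "v (w3 + \<pi> ^ B * \<delta> * r * w1) < v \<pi> ^ B"
          moreover have "v (\<pi> ^ B * \<delta> * r * w1) \<le> v \<pi> ^ B"
            using Rk_mem(2)[OF that] 4(1) v_simps(1) pi_props(1)
            by (simp add: v_simps delta primitive_def mult.assoc mult_left_le mult_le_one)
          ultimately have "v ((w3 + \<pi> ^ B * \<delta> * r * w1) - \<pi> ^ B * \<delta> * r * w1) \<le> v \<pi> ^ B"
            by (intro v_diff_le[OF v]) auto
          then show False using False by simp
        qed
        then have "{r \<in> Rk. v (w3 + \<pi> ^ B * \<delta> * r * w1) < v \<pi> ^ B} = {}" by blast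
        then show ?thesis unfolding S using False
          by (simp only: if_False card.empty Sigma_empty1 Sigma_empty2 of_nat_0)
      qed
    qed (use zO RO Rne fin in auto)
  next
    \<comment> \<open>For odd \<open>l\<close>, |w3| cannot fall below q^(-l) by
      \<open>v_w2_exact\<close>. The level after \<open>B\<close> is therefore empty, and the
      trivial translate alone suffices.\<close>
    case zero
    show ?thesis
    proof (rule that[of "{0} \<times> {0}" 0 0], goal_cases)
      case (4 w1 w2 w3)
      have "\<not> v w3 \<le> v \<pi> ^ Suc B"
      proof
        assume "v w3 \<le> v \<pi> ^ Suc B"
        also have "\<dots> \<le> v \<pi> ^ Suc l" using zero by (intro mono) simp
        finally have "v w3 < v \<pi> ^ l" unfolding v_less_pow .
        then show False using v_w2_exact[of w1 w3 l w2] 4 zero by (simp add: primitive_def)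
      qed
      then have "{(b, r) \<in> {0} \<times> {0}. v (w3 + tr_b 0 b * w2 + tr_g 0 0 b r * w1) \<le> v \<pi> ^ Suc B} = {}"
        by (auto simp: tr_b_def tr_g_def)
      then have "card {(b, r) \<in> {0} \<times> {0}. v (w3 + tr_b 0 b * w2 + tr_g 0 0 b r * w1) \<le> v \<pi> ^ Suc B} = 0"
        by (simp only: card.empty)
      moreover have "rho l B = 0" using zero by (simp add: rho_def)
      ultimately show ?case by (simp only:) simp
    qed (use zO in auto)
  next
    \<comment> \<open>Both parameters are averaged, at the depths m and 2m where their contributions
      to w3 have the same bound. If a translate did fall below, invariance of the form would bound
      the translated w2, hence w2, hence the original w3.\<close>
    case even
    then obtain m where m: "B = 2 * m" "m \<ge> 1" using B by (auto elim!: evenE)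
    show ?thesis
    proof (rule that[of "Rk' \<times> Rk" m "2 * m"], goal_cases)
      case (4 w1 w2 w3)
      have vf: "v (form w1 w2 w3) < 1" using 4 even B pi_pow_less_one by simp
      have vfB: "v (form w1 w2 w3) \<le> v \<pi> ^ (2 * m - 1)" using 4 even m by (auto intro: mono)
      have w1: "v w1 \<le> 1" using 4 by (simp add: primitive_def)
      have S: "{(b, r) \<in> Rk' \<times> Rk. v (w3 + tr_b m b * w2 + tr_g m (2 * m) b r * w1) \<le> v \<pi> ^ Suc B} =
        {(b, r) \<in> Rk' \<times> Rk. v (w3 + tr_b m b * w2 + tr_g m (2 * m) b r * w1) < v \<pi> ^ (2 * m)}"
        unfolding v_less_pow m(1) ..
      have small: "v w3 \<le> v \<pi> ^ (2 * m - 1)" if "v w3 \<le> v \<pi> ^ (2 * m)" for w3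
        using that mono[of "2 * m - 1" "2 * m"] by simp
      show ?case
      proof (cases "v w3 \<le> v \<pi> ^ B")
        case True
        then have w1': "v w1 = 1" using v_w1_unit[OF 4(1) _ vf] pB by simp
        have w2: "v w2 \<le> v \<pi> ^ m" using v_w2_bound[OF w1 small vfB] True m by simp
        have inj: "v \<pi> ^ l = v \<pi> ^ (2 * m) \<longleftrightarrow> l = 2 * m" using pi_props by (auto simp: power_inject_exp')
        show ?thesis
          unfolding S using heis_count[OF w1' w2, of w3] True q0 even
          by (auto simp: m(1) 4(2) inj card_cartesian_product Rk Rk' rho_def power2_eq_square power3_eq_cube)
      next
        case False
        have "\<not> v (w3 + tr_b m b * w2 + tr_g m (2 * m) b r * w1) < v \<pi> ^ (2 * m)"
          if br: "b \<in> Rk'" "r \<in> Rk" for b r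
        proof
          let ?w3 = "w3 + tr_b m b * w2 + tr_g m (2 * m) b r * w1"
          let ?w2 = "w2 - star (tr_b m b) * w1"
          assume w3': "v ?w3 < v \<pi> ^ (2 * m)"
          have f: "form w1 ?w2 ?w3 = form w1 w2 w3"
            by (rule form_invariant) (simp add: tr_g_trace Rk_mem br)
          have vb: "v (tr_b m b) \<le> v \<pi> ^ m" using Rk'_mem(1)[OF br(1)] pi_props(1)
            by (simp add: v_tr_b mult_left_le)
          have vg: "v (tr_g m (2 * m) b r) \<le> v \<pi> ^ (2 * m)"
            by (rule v_tr_g) (auto simp: Rk'_mem(1) Rk_mem br)
          have "v ?w2 \<le> v \<pi> ^ m" using v_w2_bound[OF w1 small, of ?w3 ?w2] w3' vfB f by simp
          moreover have sb: "v (star (tr_b m b) * w1) \<le> v \<pi> ^ m"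
            using vb w1 v_simps(1) mult_right_le_one_le[of "v (tr_b m b)" "v w1"] by (simp add: v_simps(3))
          ultimately have "v (?w2 + star (tr_b m b) * w1) \<le> v \<pi> ^ m" by (rule v_add_le[OF v])
          then have w2: "v w2 \<le> v \<pi> ^ m" by simp
          have "v (tr_b m b * w2) \<le> v \<pi> ^ m * v \<pi> ^ m"
            unfolding v_simps(3) using vb w2 pi_props(1) v_simps(1) by (intro mult_mono) auto
          then have 1: "v (tr_b m b * w2) \<le> v \<pi> ^ (2 * m)" by (simp add: mult_2 power_add)
          have 2: "v (tr_g m (2 * m) b r * w1) \<le> v \<pi> ^ (2 * m)"
            using vg w1 v_simps(1) mult_right_le_one_le[of "v (tr_g m (2 * m) b r)" "v w1"] by (simp add: v_simps(3))
          have "v (?w3 - tr_g m (2 * m) b r * w1 - tr_b m b * w2) \<le> v \<pi> ^ (2 * m)"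
            using w3' 1 2 by (intro v_diff_le[OF v]) auto
          then show False using False m by simp
        qed
        then have "{(b, r) \<in> Rk' \<times> Rk. v (w3 + tr_b m b * w2 + tr_g m (2 * m) b r * w1) < v \<pi> ^ (2 * m)} = {}"
          by blast
        then show ?thesis unfolding S using False
          by (simp only: if_False card.empty Sigma_empty1 Sigma_empty2 of_nat_0)
      qed
    qed (use zO RO Rne fin in auto)
  next
    \<comment> \<open>Here w3 is smaller than the form, so |w2| = q^(-l/2) exactly and w3 moves
      linearly in b. The depth j = B - l/2 makes that motion of size q^(-B), and j > l/2 makes the
      \<gamma> term negligible. The skew parameter stays 0.\<close>
    case tail
    define m where "m = l div 2"
    define j where "j = B - m"
    have mj: "l = 2 * m" "B = j + m" "m < j" using tail by (auto simp: m_def j_def)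
    show ?thesis
    proof (rule that[of "Rk' \<times> {0}" j 0], goal_cases)
      case (4 w1 w2 w3)
      have w1: "v w1 \<le> 1" using 4 by (simp add: primitive_def)
      have Bl: "v \<pi> ^ B < v \<pi> ^ l" using tail pi_props by (intro power_strict_decreasing) auto
      have S: "{(b, r) \<in> Rk' \<times> {0}. v (w3 + tr_b j b * w2 + tr_g j 0 b r * w1) \<le> v \<pi> ^ Suc B} =
        {b \<in> Rk'. v (w3 + tr_b j b * w2 + tr_g j 0 b 0 * w1) < v \<pi> ^ (j + m)} \<times> {0}"
        unfolding v_less_pow mj(2) by auto
      show ?case
      proof (cases "v w3 \<le> v \<pi> ^ B")
        case True
        then have "v w2 = v \<pi> ^ m" using v_w2_exact[OF w1 _ 4(2)] Bl by (simp add: m_def)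
        from beta_count[OF w1 this _ mj(3), of w3 0] show ?thesis
          unfolding S using True mj tail q0 by (simp add: card_cartesian_product Rk' rho_def)
      next
        case False
        have "\<not> v (w3 + tr_b j b * w2 + tr_g j 0 b 0 * w1) < v \<pi> ^ (j + m)" if b: "b \<in> Rk'" for b
        proof
          let ?w3 = "w3 + tr_b j b * w2 + tr_g j 0 b 0 * w1"
          let ?w2 = "w2 - star (tr_b j b) * w1"
          assume w3': "v ?w3 < v \<pi> ^ (j + m)"
          have f: "form w1 ?w2 ?w3 = form w1 w2 w3"
            by (rule form_invariant) (simp add: tr_g_trace k_closed)
          have vb: "v (tr_b j b) \<le> v \<pi> ^ j" using Rk'_mem(1)[OF b] pi_props(1)
            by (simp add: v_tr_b mult_left_le)
          have g0: "tr_g j 0 b 0 = tr_g j (2 * j) b 0" by (simp add: tr_g_def)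
          have vg: "v (tr_g j 0 b 0) \<le> v \<pi> ^ (2 * j)" unfolding g0
            by (rule v_tr_g) (auto simp: Rk'_mem(1) b v_simps)
          have "v ?w3 < v \<pi> ^ l" using w3' Bl unfolding mj(2) by (rule less_trans)
          moreover have "v (form w1 ?w2 ?w3) = v \<pi> ^ l" using f 4(2) by simp
          ultimately have "v ?w2 = v \<pi> ^ (l div 2)" using v_w2_exact[OF w1] by blast
          then have "v ?w2 \<le> v \<pi> ^ m" by (simp add: m_def)
          moreover have "v (star (tr_b j b) * w1) \<le> v \<pi> ^ j"
            using vb w1 v_simps(1) mult_right_le_one_le[of "v (tr_b j b)" "v w1"] by (simp add: v_simps(3))
          then have "v (star (tr_b j b) * w1) \<le> v \<pi> ^ m" using mono[of m j] mj(3) by simp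
          ultimately have "v (?w2 + star (tr_b j b) * w1) \<le> v \<pi> ^ m" by (rule v_add_le[OF v])
          then have w2: "v w2 \<le> v \<pi> ^ m" by simp
          have "v (tr_b j b * w2) \<le> v \<pi> ^ j * v \<pi> ^ m"
            unfolding v_simps(3) using vb w2 pi_props(1) v_simps(1) by (intro mult_mono) auto
          then have 1: "v (tr_b j b * w2) \<le> v \<pi> ^ (j + m)" by (simp add: power_add)
          have "v (tr_g j 0 b 0 * w1) \<le> v \<pi> ^ (2 * j)"
            using vg w1 v_simps(1) mult_right_le_one_le[of "v (tr_g j 0 b 0)" "v w1"] by (simp add: v_simps(3))
          then have 2: "v (tr_g j 0 b 0 * w1) \<le> v \<pi> ^ (j + m)" using mono[of "j + m" "2 * j"] mj(3) by simp
          have "v (?w3 - tr_g j 0 b 0 * w1 - tr_b j b * w2) \<le> v \<pi> ^ (j + m)"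
            using w3' 1 2 by (intro v_diff_le[OF v]) auto
          then show False using False mj by simp
        qed
        then have "{b \<in> Rk'. v (w3 + tr_b j b * w2 + tr_g j 0 b 0 * w1) < v \<pi> ^ (j + m)} = {}" by blast
        then show ?thesis unfolding S using False
          by (simp only: if_False card.empty Sigma_empty1 Sigma_empty2 of_nat_0)
      qed
    qed (use zO RO Rne fin in auto)
  qed
qed

text \<open>Modulo \<pi> the rows (1, \<beta>, \<gamma>) and (0, 0, 1) are the q^3 + 1 isotropic
  lines over the residue field, the points of a Hermitian curve. Counted are those on the line r w =
  0: a secant with q + 1 points if l = 0, a tangent with one point if l > 0.\<close>

lemma first_count:
  assumes w: "primitive w1 w2 w3" and l: "v (form w1 w2 w3) = v \<pi> ^ l"
  shows "card {(b, r) \<in> Rk' \<times> Rk. v (w1 + tr_b 0 b * w2 + tr_g 0 0 b r * w3) \<le> v \<pi>} +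
     (if v w3 \<le> v \<pi> then 1 else 0) = (if l = 0 then q + 1 else 1)"
proof -
  have lt: "v a \<le> v \<pi> \<longleftrightarrow> v a < 1" for a using v_less_pow[of a 0] by simp
  have w': "v w1 \<le> 1" "v w2 \<le> 1" "v w3 \<le> 1" using w by (auto simp: primitive_def)
  have l0: "v \<pi> ^ l = 1 \<longleftrightarrow> l = 0" using pi_pow_less_one[of l] by (cases "l = 0") auto
  have sym: "form w3 w2 w1 = form w1 w2 w3" by (simp add: form_def algebra_simps)
  show ?thesis
  proof (cases "v w3 < 1")
    case False
    then have "v w3 = 1" using w' by simp
    from heis_count[OF this, of w2 0 w1] show ?thesis
      using False w' l l0 pi_props(2) by (simp add: lt sym)
  next
    case True
    show ?thesis
    proof (cases "l = 0")
      case False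
      then have "v (form w1 w2 w3) < 1" using l pi_pow_less_one by simp
      with w True have w1: "v w1 = 1" by (rule v_w1_unit)
      have "v w2 \<le> v \<pi> ^ 1" using \<open>v (form w1 w2 w3) < 1\<close> True w'
        by (rule_tac v_w2_bound[of w1 w3]) (simp_all add: lt)
      then have w2: "v w2 < 1" using lt by simp
      have "\<not> v (w1 + tr_b 0 b * w2 + tr_g 0 0 b r * w3) < 1" if br: "b \<in> Rk'" "r \<in> Rk" for b r
      proof
        assume a: "v (w1 + tr_b 0 b * w2 + tr_g 0 0 b r * w3) < 1"
        have "v (tr_g 0 0 b r) \<le> 1" by (rule v_tr_g) (auto simp: Rk'_mem(1) Rk_mem br)
        then have 1: "v (tr_g 0 0 b r * w3) < 1" using True v_simps(1) mult_left_le_one_le[of "v w3" "v (tr_g 0 0 b r)"]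
          by (simp add: v_simps(3))
        have 2: "v (tr_b 0 b * w2) < 1" using w2 v_simps(1) mult_left_le_one_le[of "v w2" "v b"] Rk'_mem(1)[OF br(1)]
          by (simp add: v_simps(3) v_tr_b)
        have "v ((w1 + tr_b 0 b * w2 + tr_g 0 0 b r * w3) - tr_g 0 0 b r * w3 - tr_b 0 b * w2) < 1"
          using a 1 2 by (intro v_diff_less[OF v])
        then show False using w1 by simp
      qed
      then have "{(b, r) \<in> Rk' \<times> Rk. v (w1 + tr_b 0 b * w2 + tr_g 0 0 b r * w3) < 1} = {}" by blast
      then have "card {(b, r) \<in> Rk' \<times> Rk. v (w1 + tr_b 0 b * w2 + tr_g 0 0 b r * w3) < 1} = 0"
        by (simp only: card.empty)
      then show ?thesis using False True by (simp add: lt)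
    next
      \<comment> \<open>Here w2 is a unit: one class of b solves the congruence and r is free, so
        that q elements join the row (0, 0, 1).\<close>
      case l0': True
      have "v w3 < v \<pi> ^ l" "v (form w1 w2 w3) = v \<pi> ^ l" using True l l0' by auto
      from v_w2_exact[OF w'(1) this] have w2: "v w2 = 1" using l0' by simp
      have "v (w1 + tr_b 0 b * w2 + tr_g 0 0 b r * w3) < 1 \<longleftrightarrow> v (w1 + b * w2) < 1" if br: "b \<in> Rk'" "r \<in> Rk" for b r
      proof -
        have "v (tr_g 0 0 b r) \<le> 1" by (rule v_tr_g) (auto simp: Rk'_mem(1) Rk_mem br)
        then have 1: "v (tr_g 0 0 b r * w3) < 1" using True v_simps(1) mult_left_le_one_le[of "v w3" "v (tr_g 0 0 b r)"]
          by (simp add: v_simps(3))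
        then show ?thesis
          using v_add_less[OF v _ 1, of "w1 + b * w2"] v_diff_less[OF v _ 1, of "w1 + b * w2 + tr_g 0 0 b r * w3"]
          by (auto simp: tr_b_def)
      qed
      then have "{(b, r) \<in> Rk' \<times> Rk. v (w1 + tr_b 0 b * w2 + tr_g 0 0 b r * w3) < 1} = {b \<in> Rk'. v (w1 + b * w2) < 1} \<times> Rk"
        by blast
      moreover have "card {b \<in> Rk'. v (w1 + b * w2) < 1} = 1"
      proof (rule residue_system_count_root[OF Rk'(1)])
        show "w1 + b * w2 \<in> Ok'" if "b \<in> Ok'" for b
          using that w' w2 by (auto simp: Ok_iff v_simps(3) intro!: v_add_le[OF v])
        show "0 \<in> Ok'" by (simp add: Ok_iff v_simps)
        show "v (a - b) < 1" if "v ((w1 + a * w2) - (w1 + b * w2)) < 1" for a b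
        proof -
          have "(w1 + a * w2) - (w1 + b * w2) = (a - b) * w2" by (simp add: algebra_simps)
          then show ?thesis using that w2 by (simp add: v_simps(3))
        qed
      qed
      ultimately show ?thesis using l0' True by (simp add: lt card_cartesian_product Rk)
    qed
  qed
qed

end

section \<open>Minors of hermitian involutions\<close>

definition mtrace :: "'a::comm_ring_1 mat \<Rightarrow> 'a" where
  "mtrace A = (\<Sum>i<dim_row A. A $$ (i, i))"

definition blk :: "'a mat \<Rightarrow> nat \<Rightarrow> nat \<Rightarrow> nat \<Rightarrow> nat \<Rightarrow> 'a mat" where
  "blk M r nr c nc = mat nr nc (\<lambda>(i, j). M $$ (r + i, c + j))"

lemma blk_carrier [simp]: "blk M r nr c nc \<in> carrier_mat nr nc"
  by (simp add: blk_def)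

lemma blk_dim [simp]: "dim_row (blk M r nr c nc) = nr" "dim_col (blk M r nr c nc) = nc"
  by (simp_all add: blk_def)

lemma index_mult_sum:
  assumes "A \<in> carrier_mat a b" "B \<in> carrier_mat b c" "i < a" "j < c"
  shows "(A * B) $$ (i, j) = (\<Sum>k<b. A $$ (i, k) * B $$ (k, j))"
  using assms by (auto simp: scalar_prod_def atLeast0LessThan intro!: sum.cong)

lemma sum_split3:
  fixes f :: "nat \<Rightarrow> 'a::comm_monoid_add"
  shows "(\<Sum>k<a + b + c. f k) = (\<Sum>k<a. f k) + (\<Sum>k<b. f (a + k)) + (\<Sum>k<c. f (a + b + k))"
proof -
  have "(\<Sum>k<a + b. f k) = (\<Sum>k<a. f k) + (\<Sum>k<b. f (a + k))" for a b and f :: "nat \<Rightarrow> 'a"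
    by (induction b) (auto simp: add.assoc)
  then show ?thesis by (simp add: add.assoc)
qed

lemma mtrace_mult_commute:
  assumes "A \<in> carrier_mat a b" "B \<in> carrier_mat b a"
  shows "mtrace (A * B) = mtrace (B * A)"
proof -
  have "mtrace (A * B) = (\<Sum>i<a. \<Sum>k<b. A $$ (i, k) * B $$ (k, i))"
    using assms by (auto simp: mtrace_def index_mult_sum simp del: index_mult_mat(1) intro!: sum.cong)
  also have "\<dots> = (\<Sum>k<b. \<Sum>i<a. B $$ (k, i) * A $$ (i, k))"
    by (subst sum.swap) (simp add: mult.commute)
  also have "\<dots> = mtrace (B * A)"
    using assms by (auto simp: mtrace_def index_mult_sum simp del: index_mult_mat(1) intro!: sum.cong)
  finally show ?thesis .
qed

lemma mtrace_add: "A \<in> carrier_mat a a \<Longrightarrow> B \<in> carrier_mat a a \<Longrightarrow> mtrace (A + B) = mtrace A + mtrace B"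
  and mtrace_minus: "A \<in> carrier_mat a a \<Longrightarrow> B \<in> carrier_mat a a \<Longrightarrow> mtrace (A - B) = mtrace A - mtrace B"
  by (auto simp: mtrace_def sum.distrib sum_subtractf)

lemma blk_mult:
  assumes "M \<in> carrier_mat (a + b + c) (a + b + c)" "L \<in> carrier_mat (a + b + c) p"
    and "r + nr \<le> a + b + c" "s + ns \<le> p"
  shows "blk (M * L) r nr s ns = blk M r nr 0 a * blk L 0 a s ns + blk M r nr a b * blk L a b s ns
    + blk M r nr (a + b) c * blk L (a + b) c s ns"
proof (rule eq_matI)
  fix i j assume "i < dim_row (blk M r nr 0 a * blk L 0 a s ns + blk M r nr a b * blk L a b s ns
    + blk M r nr (a + b) c * blk L (a + b) c s ns)"
    "j < dim_col (blk M r nr 0 a * blk L 0 a s ns + blk M r nr a b * blk L a b s ns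
    + blk M r nr (a + b) c * blk L (a + b) c s ns)"
  then have ij: "i < nr" "j < ns" by (auto simp: blk_def)
  have "blk (M * L) r nr s ns $$ (i, j) = (\<Sum>k<a + b + c. M $$ (r + i, k) * L $$ (k, s + j))"
    using ij assms index_mult_sum[OF assms(1,2), of "r + i" "s + j"] by (simp add: blk_def)
  also have "\<dots> = (blk M r nr 0 a * blk L 0 a s ns) $$ (i, j) + (blk M r nr a b * blk L a b s ns) $$ (i, j)
      + (blk M r nr (a + b) c * blk L (a + b) c s ns) $$ (i, j)"
    unfolding sum_split3 using ij
    by (simp only: index_mult_sum[OF blk_carrier blk_carrier ij]) (simp add: blk_def)
  finally show "blk (M * L) r nr s ns $$ (i, j) = (blk M r nr 0 a * blk L 0 a s ns + blk M r nr a b * blk L a b s ns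
    + blk M r nr (a + b) c * blk L (a + b) c s ns) $$ (i, j)"
    using ij by (simp add: blk_def)
qed (auto simp: blk_def)

text \<open>The factor (t^2 - 1)^n is even and monic of degree 2n, so only the constant term of t -
  1 contributes. Together with \<open>coeff_char_poly_trace\<close> this turns the condition
  defining X into trace 1.\<close>

lemma coeff_one_lower: "coeff (([:0, 1:]\<^sup>2 - 1) ^ n * ([:0, 1:] - 1) :: 'a::comm_ring_1 poly) (2 * n) = - 1"
proof -
  let ?p = "\<lambda>n. ([:0, 1:]\<^sup>2 - 1) ^ n :: 'a poly"
  have *: "(\<forall>k. odd k \<longrightarrow> coeff (?p n) k = 0) \<and> coeff (?p n) (2 * n) = 1 \<and> (\<forall>k>2 * n. coeff (?p n) k = 0)"
  proof (induction n)
    case 0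
    then show ?case by (auto simp: coeff_eq_0 odd_pos)
  next
    case (Suc n)
    have e: "?p (Suc n) = pCons 0 (pCons 0 (?p n)) - ?p n"
      by (simp add: power2_eq_square left_diff_distrib)
    have c: "coeff (?p (Suc n)) k = (if k < 2 then 0 else coeff (?p n) (k - 2)) - coeff (?p n) k" for k
      unfolding e by (cases k; cases "k - 1") (auto simp: coeff_pCons split: nat.splits)
    show ?case unfolding c using Suc by auto
  qed
  have e: "?p n * ([:0, 1:] - 1) = pCons 0 (?p n) - ?p n" by (subst mult.commute) (simp add: left_diff_distrib)
  show ?thesis unfolding e using * by (cases n) (auto simp: coeff_pCons split: nat.splits)
qed

lemma sum_skip_index:
  fixes f :: "nat \<Rightarrow> 'a::ab_group_add"
  assumes "i < Suc m"
  shows "(\<Sum>j<m. f (if j < i then j else Suc j)) = (\<Sum>j<Suc m. f j) - f i"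
proof -
  have "(\<Sum>j<m. f (if j < i then j else Suc j)) = sum f ({..<Suc m} - {i})"
    using assms by (intro sum.reindex_bij_witness[of _ "\<lambda>j. if j < i then j else j - 1" "\<lambda>j. if j < i then j else Suc j"])
      (auto split: if_splits)
  then show ?thesis using assms by (simp add: sum_diff1)
qed

text \<open>The derivative of a characteristic polynomial is the sum of the characteristic
  polynomials of the principal submatrices omitting one index. By induction this gives the
  coefficient up to the integer factor from differentiation, which cancels in characteristic
  0.\<close>

lemma coeff_char_poly_trace:
  fixes A :: "'a::field_char_0 mat"
  assumes "A \<in> carrier_mat (Suc n) (Suc n)"
  shows "coeff (char_poly A) n = - mtrace A"
  using assms
proof (induction n arbitrary: A)
  case 0
  then have "char_poly A = [:- (A $$ (0, 0)), 1:]"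
    by (simp add: char_poly_defs det_single)
  then show ?case using 0 by (simp add: mtrace_def)
next
  case (Suc m)
  have d: "mat_delete A i i \<in> carrier_mat (Suc m) (Suc m)" for i
    using Suc.prems by (auto simp: mat_delete_def)
  have tr: "mtrace (mat_delete A i i) = mtrace A - A $$ (i, i)" if "i < Suc (Suc m)" for i
  proof -
    have "mtrace (mat_delete A i i) = (\<Sum>j<Suc m. (\<lambda>j. A $$ (j, j)) (if j < i then j else Suc j))"
      using Suc.prems by (auto simp: mtrace_def mat_delete_def intro!: sum.cong)
    also have "\<dots> = mtrace A - A $$ (i, i)"
      using Suc.prems sum_skip_index[OF that, of "\<lambda>j. A $$ (j, j)"] by (simp add: mtrace_def)
    finally show ?thesis .
  qed
  have "of_nat (Suc m) * coeff (char_poly A) (Suc m) = coeff (pderiv (char_poly A)) m"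
    by (simp add: coeff_pderiv)
  also have "\<dots> = (\<Sum>i<Suc (Suc m). - (mtrace A - A $$ (i, i)))"
    unfolding pderiv_char_poly[OF Suc.prems] coeff_sum using Suc.IH[OF d] tr by simp
  also have "\<dots> = - (of_nat (Suc (Suc m)) * mtrace A) + mtrace A"
    using Suc.prems by (simp add: sum_subtractf sum_negf) (simp add: mtrace_def algebra_simps)
  also have "\<dots> = of_nat (Suc m) * (- mtrace A)" by (simp add: algebra_simps)
  finally show ?case by (simp only: mult_cancel_left of_nat_eq_0_iff) simp
qed

text \<open>With \<open>Z\<close> the column block \<open>(- M\<^sub>3\<^sub>1\<inverse> M\<^sub>3\<^sub>2, 1, 0)\<close>, the Schur complement \<open>E\<close> satisfies
  \<open>M Z = Z E\<close>.\<close>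

lemma schur_complement_involution:
  fixes M :: "'a::field mat"
  assumes M: "M \<in> carrier_mat (m + 3 + m) (m + 3 + m)" and MM: "M * M = 1\<^sub>m (m + 3 + m)"
    and I: "I \<in> carrier_mat m m" "I * blk M (m + 3) m 0 m = 1\<^sub>m m" "blk M (m + 3) m 0 m * I = 1\<^sub>m m"
  defines "E \<equiv> blk M m 3 m 3 - blk M m 3 0 m * (I * blk M (m + 3) m m 3)"
  shows "E * E = 1\<^sub>m 3" "mtrace E = mtrace M"
proof -
  let ?M11 = "blk M 0 m 0 m" and ?M12 = "blk M 0 m m 3"
  let ?M21 = "blk M m 3 0 m" and ?M22 = "blk M m 3 m 3" and ?M23 = "blk M m 3 (m + 3) m"
  let ?M31 = "blk M (m + 3) m 0 m" and ?M32 = "blk M (m + 3) m m 3" and ?M33 = "blk M (m + 3) m (m + 3) m"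
  define V where "V = I * ?M32"
  define Zb where "Zb = mat (m + 3 + m) 3 (\<lambda>(i, j). if i < m then - (V $$ (i, j))
    else if i = m + j then 1 else 0)"
  have V: "V \<in> carrier_mat m 3" using I by (simp add: V_def mult_carrier_mat[of _ m m])
  have Ed: "E = ?M22 - ?M21 * V" by (simp add: E_def V_def)
  have E: "E \<in> carrier_mat 3 3" using V unfolding Ed by (intro minus_carrier_mat mult_carrier_mat[of _ 3 m]) auto
  have Zb: "Zb \<in> carrier_mat (m + 3 + m) 3" by (simp add: Zb_def)
  have Zb_blk: "blk Zb 0 m 0 3 = - V" "blk Zb m 3 0 3 = 1\<^sub>m 3" "blk Zb (m + 3) m 0 3 = 0\<^sub>m m 3"
    using V by (auto simp: blk_def Zb_def intro!: eq_matI)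
  have M31V: "?M31 * V = ?M32"
    unfolding V_def using I by (subst assoc_mult_mat[of _ m m _ m _ 3, symmetric]) (auto simp: left_mult_one_mat[of _ m 3])
  define Y where "Y = M * Zb"
  have Y: "Y \<in> carrier_mat (m + 3 + m) 3" using M Zb by (simp add: Y_def)
  have neg: "A * (- V) = - (A * V)" if "A \<in> carrier_mat r m" for A :: "'a mat" and r
    using V that by (intro eq_matI) (auto simp: scalar_prod_def sum_negf)
  have nadd: "- A + B = B - A" if "A \<in> carrier_mat r c" "B \<in> carrier_mat r c" for A B :: "'a mat" and r c
    using that by (intro eq_matI) auto
  have Y3: "blk Y (m + 3) m 0 3 = 0\<^sub>m m 3"
    unfolding Y_def using V blk_mult[OF M Zb, of "m + 3" m 0 3]
    by (simp add: Zb_blk neg[of _ m] M31V right_mult_one_mat[of _ m 3] right_mult_zero_mat[of _ m m])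
  have Y2: "blk Y m 3 0 3 = E"
    unfolding Y_def Ed using V blk_mult[OF M Zb, of m 3 0 3]
    by (simp add: Zb_blk neg[of _ 3] right_mult_one_mat[of _ 3 3] right_mult_zero_mat[of _ 3 m]
        nadd[of _ 3 3] mult_carrier_mat[of _ 3 m] E[unfolded Ed] right_add_zero_mat[of _ 3 3])
  define Y1 where "Y1 = blk Y 0 m 0 3"
  have Y1: "Y1 \<in> carrier_mat m 3" by (simp add: Y1_def)
  have MY: "M * Y = Zb"
    unfolding Y_def using assoc_mult_mat[OF M M Zb] MM Zb by simp
  have last: "0\<^sub>m m 3 = ?M31 * Y1 + ?M32 * E"
    using blk_mult[OF M Y, of "m + 3" m 0 3] E Y1
    by (simp add: MY Zb_blk Y2 Y3 right_mult_zero_mat[of _ m m] right_add_zero_mat[of _ m 3]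
        mult_carrier_mat[of _ m m] mult_carrier_mat[of _ m 3] flip: Y1_def)
  have mid: "1\<^sub>m 3 = ?M21 * Y1 + ?M22 * E"
    using blk_mult[OF M Y, of m 3 0 3] E Y1
    by (simp add: MY Zb_blk Y2 Y3 right_mult_zero_mat[of _ 3 m] right_add_zero_mat[of _ 3 3]
        mult_carrier_mat[of _ 3 m] mult_carrier_mat[of _ 3 3] flip: Y1_def)
  have c: "?M31 * Y1 \<in> carrier_mat m 3" "?M32 * E \<in> carrier_mat m 3" "V * E \<in> carrier_mat m 3"
    "?M21 * V \<in> carrier_mat 3 3" "?M22 * E \<in> carrier_mat 3 3" "?M21 * Y1 \<in> carrier_mat 3 3"
    using Y1 E V by (auto intro: mult_carrier_mat)
  have "0\<^sub>m m 3 = I * (?M31 * Y1 + ?M32 * E)" using I(1) by (simp flip: last add: right_mult_zero_mat[of _ m m])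
  also have "\<dots> = I * (?M31 * Y1) + I * (?M32 * E)" by (rule mult_add_distrib_mat[OF I(1) c(1,2)])
  also have "I * (?M31 * Y1) = Y1"
    unfolding assoc_mult_mat[OF I(1) blk_carrier Y1, symmetric] I(2) using Y1 by simp
  also have "I * (?M32 * E) = V * E"
    unfolding V_def by (rule assoc_mult_mat[OF I(1) blk_carrier E, symmetric])
  finally have s: "0\<^sub>m m 3 = Y1 + V * E" .
  have "Y1 = - (V * E)"
  proof (rule eq_matI)
    fix i j assume ij: "i < dim_row (- (V * E))" "j < dim_col (- (V * E))"
    then have "(0\<^sub>m m 3) $$ (i, j) = (Y1 + V * E) $$ (i, j)" using s by simp
    then show "Y1 $$ (i, j) = (- (V * E)) $$ (i, j)" using ij V E Y1 by (simp add: eq_neg_iff_add_eq_0)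
  qed (use V E Y1 in auto)
  then have "?M21 * Y1 = - (?M21 * (V * E))" using c(3)
    by (intro eq_matI) (auto simp: scalar_prod_def sum_negf)
  also have "?M21 * (V * E) = ?M21 * V * E" using assoc_mult_mat[OF blk_carrier V E] by simp
  finally have "1\<^sub>m 3 = - (?M21 * V * E) + ?M22 * E" using mid by simp
  also have "\<dots> = ?M22 * E - ?M21 * V * E" using c E by (intro eq_matI) auto
  also have "\<dots> = E * E" unfolding Ed
    by (rule minus_mult_distrib_mat[symmetric, OF blk_carrier c(4)]) (use E in \<open>simp add: Ed\<close>)
  finally show "E * E = 1\<^sub>m 3" ..
  \<comment> \<open>The lower left block of \<open>M * M\<close> = 1 is multiplied by
    \<open>I\<close> and traced. By cyclicity it says that the traces of M11, of M21 V and of M33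
    add up to 0, which is the difference between the traces of \<open>M\<close> and
    \<open>E\<close>.\<close>
  have "0\<^sub>m m m = ?M31 * ?M11 + ?M32 * ?M21 + ?M33 * ?M31"
  proof -
    have "blk (1\<^sub>m (m + 3 + m)) (m + 3) m 0 m = (0\<^sub>m m m :: 'a mat)" by (auto simp: blk_def intro!: eq_matI)
    then show ?thesis using blk_mult[OF M M, of "m + 3" m 0 m] unfolding MM by simp
  qed
  then have "0\<^sub>m m m = I * (?M31 * ?M11 + ?M32 * ?M21 + ?M33 * ?M31)"
    using I(1) by (simp flip: \<open>0\<^sub>m m m = _\<close> add: right_mult_zero_mat[of _ m m])
  also have "\<dots> = I * (?M31 * ?M11 + ?M32 * ?M21) + I * (?M33 * ?M31)"
    by (rule mult_add_distrib_mat[OF I(1)]) (auto intro!: add_carrier_mat mult_carrier_mat)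
  also have "I * (?M31 * ?M11 + ?M32 * ?M21) = I * (?M31 * ?M11) + I * (?M32 * ?M21)"
    by (rule mult_add_distrib_mat[OF I(1)]) (auto intro!: mult_carrier_mat)
  also have "I * (?M31 * ?M11) = ?M11"
    unfolding assoc_mult_mat[OF I(1) blk_carrier blk_carrier, symmetric] I(2) by (rule left_mult_one_mat[OF blk_carrier])
  also have "I * (?M32 * ?M21) = V * ?M21"
    unfolding V_def by (rule assoc_mult_mat[OF I(1) blk_carrier blk_carrier, symmetric])
  finally have "mtrace (0\<^sub>m m m :: 'a mat) = mtrace (?M11 + V * ?M21 + I * (?M33 * ?M31))" by simp
  also have "\<dots> = mtrace ?M11 + mtrace (V * ?M21) + mtrace (I * (?M33 * ?M31))"
    using I V by (simp add: mtrace_add[of _ m] add_carrier_mat mult_carrier_mat[of _ m 3] mult_carrier_mat[of _ m m])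
  also have "mtrace (V * ?M21) = mtrace (?M21 * V)" by (rule mtrace_mult_commute[OF V blk_carrier])
  also have "mtrace (I * (?M33 * ?M31)) = mtrace (?M33 * ?M31 * I)"
    by (rule mtrace_mult_commute[OF I(1)]) (auto intro!: mult_carrier_mat)
  also have "?M33 * ?M31 * I = ?M33"
    unfolding assoc_mult_mat[OF blk_carrier blk_carrier I(1)] I(3) by (rule right_mult_one_mat[OF blk_carrier])
  finally have t: "mtrace ?M11 + mtrace (?M21 * V) + mtrace ?M33 = 0" by (simp add: mtrace_def)
  have "mtrace E = mtrace ?M22 - mtrace (?M21 * V)" unfolding Ed by (rule mtrace_minus[OF blk_carrier c(4)])
  also have "\<dots> = mtrace ?M11 + mtrace ?M22 + mtrace ?M33" using t by (simp add: algebra_simps eq_neg_iff_add_eq_0)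
  also have "\<dots> = (\<Sum>i<m + 3 + m. M $$ (i, i))" unfolding sum_split3 by (simp add: mtrace_def) (simp add: blk_def)
  also have "\<dots> = mtrace M" using M by (simp only: mtrace_def carrier_matD)
  finally show "mtrace E = mtrace M" .
qed

text \<open>Column operations by the unipotent \<open>?L\<close> clear the block below the corner,
  leaving a block triangular matrix.\<close>

lemma det_schur_corner:
  fixes D :: "'a::field mat"
  assumes A: "A \<in> carrier_mat 1 1" and R: "R \<in> carrier_mat 1 m" and C: "C \<in> carrier_mat m 1"
    and D: "D \<in> carrier_mat m m" and I: "I \<in> carrier_mat m m" "D * I = 1\<^sub>m m"
  shows "Determinant.det (four_block_mat A R C D) = (A - R * (I * C)) $$ (0, 0) * Determinant.det D"
proof -
  define V where "V = I * C"
  have V: "V \<in> carrier_mat m 1" using I C by (simp add: V_def)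
  let ?T = "four_block_mat A R C D" and ?L = "four_block_mat (1\<^sub>m 1) (0\<^sub>m 1 m) (- V) (1\<^sub>m m)"
  have DV: "D * V = C" unfolding V_def using assoc_mult_mat[OF D I(1) C] I C by simp
  have nR: "R * (- V) = - (R * V)" and nD: "D * (- V) = - (D * V)"
    using V R D by (auto simp: scalar_prod_def sum_negf intro!: eq_matI)
  have "?T * ?L = four_block_mat (A * 1\<^sub>m 1 + R * (- V)) (A * 0\<^sub>m 1 m + R * 1\<^sub>m m) (C * 1\<^sub>m 1 + D * (- V)) (C * 0\<^sub>m 1 m + D * 1\<^sub>m m)"
    by (rule mult_four_block_mat[OF A R C D]) (use V in auto)
  also have "A * 1\<^sub>m 1 + R * (- V) = A - R * V" unfolding nR using A R V by (intro eq_matI) auto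
  also have "A * 0\<^sub>m 1 m + R * 1\<^sub>m m = R" using A R by simp
  also have "C * 1\<^sub>m 1 + D * (- V) = 0\<^sub>m m 1" unfolding nD DV using C by (intro eq_matI) auto
  also have "C * 0\<^sub>m 1 m + D * 1\<^sub>m m = D" using C D by simp
  finally have TL: "?T * ?L = four_block_mat (A - R * V) R (0\<^sub>m m 1) D" .
  have "Determinant.det (?T * ?L) = Determinant.det ?T * Determinant.det ?L"
    by (rule det_mult[of _ "1 + m"]) (use A R C D V in auto)
  also have "Determinant.det ?L = 1"
    using det_four_block_mat_upper_right_zero[of "1\<^sub>m 1" 1 "0\<^sub>m 1 m" m "- V" "1\<^sub>m m"] V by simp
  finally have "Determinant.det ?T = Determinant.det (four_block_mat (A - R * V) R (0\<^sub>m m 1) D)" using TL by simp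
  also have "\<dots> = Determinant.det (A - R * V) * Determinant.det D"
    by (rule det_four_block_mat_lower_left_zero[OF _ R refl D]) (use A R V in auto)
  also have "Determinant.det (A - R * V) = (A - R * V) $$ (0, 0)"
    using A R V by (intro det_single) auto
  finally show ?thesis by (simp add: V_def)
qed

lemma less_3_cases: "(a::nat) < 3 \<Longrightarrow> a = 0 \<or> a = 1 \<or> a = 2"
  by auto

lemma sum_less_3: "(\<Sum>i<3::nat. f i) = f 0 + f 1 + f 2"
  for f :: "nat \<Rightarrow> 'a::comm_monoid_add"
  by (simp add: numeral_3_eq_3 numeral_2_eq_2 add.assoc)

text \<open>The cofactor matrix of a \<open>3 \<times> 3\<close> matrix \<open>F\<close> is \<open>F\<^sup>2 - tr F \<cdot> F + e\<^sub>2(F)\<close>.\<close>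

lemma idempotent_trace_one_minors:
  fixes F :: "nat \<Rightarrow> nat \<Rightarrow> 'a::field_char_0"
  assumes idem: "\<And>a b. a < 3 \<Longrightarrow> b < 3 \<Longrightarrow> (\<Sum>c<3. F a c * F c b) = F a b"
    and tr: "(\<Sum>a<3. F a a) = 1" and abcd: "a < 3" "b < 3" "c < 3" "d < 3"
  shows "F a b * F c d = F a d * F c b"
proof -
  have i: "F a 0 * F 0 b + F a 1 * F 1 b + F a 2 * F 2 b = F a b" if "a < 3" "b < 3" for a b
    using idem[OF that] by (simp add: sum_less_3)
  have i0: "F 0 0 * F 0 0 + F 0 1 * F 1 0 + F 0 2 * F 2 0 = F 0 0"
    "F 1 0 * F 0 1 + F 1 1 * F 1 1 + F 1 2 * F 2 1 = F 1 1"
    "F 2 0 * F 0 2 + F 2 1 * F 1 2 + F 2 2 * F 2 2 = F 2 2" by (rule i; simp)+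
  have t: "F 0 0 + F 1 1 + F 2 2 = 1" using tr by (simp add: sum_less_3)
  define e where "e = (F 0 0 * F 1 1 - F 0 1 * F 1 0) + (F 0 0 * F 2 2 - F 0 2 * F 2 0)
    + (F 1 1 * F 2 2 - F 1 2 * F 2 1)"
  have "2 * e = (F 0 0 + F 1 1 + F 2 2) * (F 0 0 + F 1 1 + F 2 2)
    - (F 0 0 * F 0 0 + F 0 1 * F 1 0 + F 0 2 * F 2 0) - (F 1 0 * F 0 1 + F 1 1 * F 1 1 + F 1 2 * F 2 1)
    - (F 2 0 * F 0 2 + F 2 1 * F 1 2 + F 2 2 * F 2 2)"
    by (simp add: e_def algebra_simps)
  also have "\<dots> = 1 - F 0 0 - F 1 1 - F 2 2" by (simp only: t i0 mult_1)
  also have "\<dots> = 1 - (F 0 0 + F 1 1 + F 2 2)" by (simp only: diff_diff_eq)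
  finally have e0: "e = 0" by (simp only: t) simp
  define \<Delta> where "\<Delta> a b c d = F a b * F c d - F a d * F c b" for a b c d
  have asym: "\<Delta> c b a d = - \<Delta> a b c d" "\<Delta> a d c b = - \<Delta> a b c d" for a b c d
    by (simp_all add: \<Delta>_def algebra_simps)
  define U where "U a b = F a 0 * F 0 b + F a 1 * F 1 b + F a 2 * F 2 b - (F 0 0 + F 1 1 + F 2 2) * F a b" for a b
  have off: "U a b = 0" if "a < 3" "b < 3" for a b using i[OF that] by (simp only: U_def t) simp
  have cof: "\<Delta> 0 0 1 1 = U 2 2 + e" "\<Delta> 0 0 1 2 = - U 1 2" "\<Delta> 0 1 1 2 = U 0 2" "\<Delta> 0 0 2 1 = - U 2 1"
    "\<Delta> 0 0 2 2 = U 1 1 + e" "\<Delta> 0 1 2 2 = - U 0 1" "\<Delta> 1 0 2 1 = U 2 0" "\<Delta> 1 0 2 2 = - U 1 0" "\<Delta> 1 1 2 2 = U 0 0 + e"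
    by (simp_all add: \<Delta>_def U_def e_def algebra_simps)
  have base: "\<Delta> 0 0 1 1 = 0" "\<Delta> 0 0 1 2 = 0" "\<Delta> 0 1 1 2 = 0" "\<Delta> 0 0 2 1 = 0" "\<Delta> 0 0 2 2 = 0"
    "\<Delta> 0 1 2 2 = 0" "\<Delta> 1 0 2 1 = 0" "\<Delta> 1 0 2 2 = 0" "\<Delta> 1 1 2 2 = 0"
    unfolding cof by (simp_all add: off e0)
  have up: "\<Delta> a b c d = 0" if "a < c" "b < d" "c < 3" "d < 3" for a b c d
  proof -
    have "a = 0 \<and> c = 1 \<or> a = 0 \<and> c = 2 \<or> a = 1 \<and> c = 2" "b = 0 \<and> d = 1 \<or> b = 0 \<and> d = 2 \<or> b = 1 \<and> d = 2"
      using that by auto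
    then show ?thesis using base by (elim disjE conjE) (simp_all only:)
  qed
  have "\<Delta> a b c d = 0" if "a < c" "b < 3" "c < 3" "d < 3" for a b c d
    using up[of a c b d] up[of a c d b] asym(2)[of a d c b] that
    by (cases b d rule: linorder_cases) (auto simp: \<Delta>_def)
  then have "\<Delta> a b c d = 0"
    using abcd asym(1)[of c b a d] by (cases a c rule: linorder_cases) (auto simp: \<Delta>_def)
  then show ?thesis by (simp add: \<Delta>_def)
qed

lemma mult_antidiag:
  fixes A :: "'a::comm_ring_1 mat"
  assumes "A \<in> carrier_mat r c"
  shows "A * antidiag c = mat r c (\<lambda>(i, j). A $$ (i, c - 1 - j))"
proof (rule eq_matI)
  fix i j assume "i < dim_row (mat r c (\<lambda>(i, j). A $$ (i, c - 1 - j)))" "j < dim_col (mat r c (\<lambda>(i, j). A $$ (i, c - 1 - j)))"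
  then have ij: "i < r" "j < c" by auto
  have "(A * antidiag c) $$ (i, j) = (\<Sum>k<c. A $$ (i, k) * antidiag c $$ (k, j))"
    using assms ij by (intro index_mult_sum) (auto simp: antidiag_def)
  also have "\<dots> = (\<Sum>k<c. if k = c - 1 - j then A $$ (i, k) else 0)"
    using ij by (intro sum.cong) (auto simp: antidiag_def)
  also have "\<dots> = A $$ (i, c - 1 - j)" using ij by simp
  finally show "(A * antidiag c) $$ (i, j) = mat r c (\<lambda>(i, j). A $$ (i, c - 1 - j)) $$ (i, j)" using ij by simp
qed (use assms in \<open>auto simp: antidiag_def\<close>)

lemma antidiag_carrier [simp]: "antidiag m \<in> carrier_mat m m"
  by (simp add: antidiag_def)

lemma antidiag_square: "antidiag m * antidiag m = (1\<^sub>m m :: 'a::field mat)"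
  unfolding mult_antidiag[OF antidiag_carrier] by (rule eq_matI) (auto simp: antidiag_def)

context unramified_quadratic
begin

lemma adj_carrier [simp]: "A \<in> carrier_mat r c \<Longrightarrow> adj star A \<in> carrier_mat c r"
  by (simp add: adj_def)

lemma adj_index: "A \<in> carrier_mat r c \<Longrightarrow> i < c \<Longrightarrow> j < r \<Longrightarrow> adj star A $$ (i, j) = star (A $$ (j, i))"
  by (auto simp: adj_def)

lemma adj_mult: "A \<in> carrier_mat r m \<Longrightarrow> B \<in> carrier_mat m c \<Longrightarrow> adj star (A * B) = adj star B * adj star A"
  by (rule eq_matI) (auto simp: adj_def scalar_prod_def star_sum star_simps mult.commute intro!: sum.cong)

lemma adj_adj [simp]: "adj star (adj star A) = A"
  by (rule eq_matI) (auto simp: adj_def)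

lemma adj_one [simp]: "adj star (1\<^sub>m m) = 1\<^sub>m m"
  by (rule eq_matI) (auto simp: adj_def star_simps)

text \<open>Since A j is an involution of trace 1 on a 3-dimensional space, \<open>F\<close> = (1 -
  A j)/2 is an idempotent of trace 1, so its 2 x 2 minors vanish. Then \<open>H\<close> = F j is
  Hermitian of rank one. Its diagonal is not zero, for otherwise the minors would force
  \<open>H\<close> = 0; a column through a nonzero diagonal entry serves as w.\<close>

lemma hermitian_rank_one_form:
  fixes A :: "nat \<Rightarrow> nat \<Rightarrow> 'a"
  assumes herm: "\<And>a b. a < 3 \<Longrightarrow> b < 3 \<Longrightarrow> star (A a b) = A b a"
    and invol: "\<And>a b. a < 3 \<Longrightarrow> b < 3 \<Longrightarrow> (\<Sum>c<3. A a (2 - c) * A c (2 - b)) = (if a = b then 1 else 0)"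
    and tr: "(\<Sum>a<3. A a (2 - a)) = 1"
  obtains w where "form (w 0) (w 1) (w 2) \<noteq> 0" "\<And>a b. a < 3 \<Longrightarrow> b < 3 \<Longrightarrow>
    A a b = (if a + b = 2 then 1 else 0) - 2 * w a * star (w b) / form (w 0) (w 1) (w 2)"
proof -
  define F where "F a b = ((if a = b then 1 else 0) - A a (2 - b)) / 2" for a b
  define H where "H a b = F a (2 - b)" for a b
  have HA: "H a b = ((if a + b = 2 then 1 else 0) - A a b) / 2" if "a < 3" "b < 3" for a b
    using that by (auto simp: H_def F_def)
  have idem: "(\<Sum>c<3. F a c * F c b) = F a b" if "a < 3" "b < 3" for a b
  proof -
    have "(\<Sum>c<3. F a c * F c b) = (\<Sum>c<3. (if a = c then (if a = b then 1 else 0) - A a (2 - b) else 0)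
       - (if c = b then A a (2 - b) else 0) + A a (2 - c) * A c (2 - b)) / 4"
      unfolding F_def sum_divide_distrib
      by (rule sum.cong) (auto simp: field_simps)
    also have "\<dots> = ((if a = b then 1 else 0) - A a (2 - b) - A a (2 - b) + (if a = b then 1 else 0)) / 4"
      using that by (simp add: sum.distrib sum_subtractf invol)
    also have "\<dots> = F a b" by (simp add: F_def field_simps)
    finally show ?thesis .
  qed
  have "(\<Sum>a<3. F a a) = (3 - (\<Sum>a<3. A a (2 - a))) / 2"
    by (simp add: F_def sum_less_3 field_simps)
  then have trF: "(\<Sum>a<3. F a a) = 1" using tr by simp
  have min: "H a b * H c d = H a d * H c b" if "a < 3" "b < 3" "c < 3" "d < 3" for a b c d
    unfolding H_def using that by (intro idempotent_trace_one_minors[of F, OF idem trF]) auto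
  have hH: "star (H a b) = H b a" if "a < 3" "b < 3" for a b
    using that herm by (simp add: HA star_simps add.commute)
  have trH: "H 0 2 + H 1 1 + H 2 0 = 1" using trF by (simp add: H_def sum_less_3)
  have "\<exists>a<3. H a a \<noteq> 0"
  proof (rule ccontr)
    assume n: "\<not> ?thesis"
    have "H a b = 0" if "a < 3" "b < 3" for a b
    proof -
      have "H a b * star (H a b) = 0" using min[OF that(1,2,2,1)] n that by (auto simp: hH)
      then show ?thesis using star_simps(11) by auto
    qed
    then show False using trH by simp
  qed
  then obtain a where a: "a < 3" "H a a \<noteq> 0" by blast
  define w where "w i = H i a" for i
  have sw: "star (w i) = H a i" if "i < 3" for i using that a by (simp add: w_def hH)
  have ww: "w i * star (w j) = H i j * H a a" if "i < 3" "j < 3" for i j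
    using min[OF that(1) a(1) a(1) that(2)] sw that by (simp add: w_def)
  have "form (w 0) (w 1) (w 2) = w 2 * star (w 0) + w 0 * star (w 2) + w 1 * star (w 1)"
    by (simp add: form_def mult.commute)
  also have "\<dots> = (H 0 2 + H 1 1 + H 2 0) * H a a" 
    by (simp add: ww distrib_right add.commute add.left_commute)
  finally have f: "form (w 0) (w 1) (w 2) = H a a" using trH by simp
  show ?thesis
  proof
    show "form (w 0) (w 1) (w 2) \<noteq> 0" using a f by simp
    show "A i j = (if i + j = 2 then 1 else 0) - 2 * w i * star (w j) / form (w 0) (w 1) (w 2)"
      if "i < 3" "j < 3" for i j
    proof -
      have "2 * w i * star (w j) / H a a = 2 * H i j" using ww[OF that] a by (simp add: mult.assoc)
      moreover have "A i j = (if i + j = 2 then 1 else 0) - 2 * H i j" unfolding HA[OF that] by (simp add: diff_divide_distrib)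
      ultimately show ?thesis unfolding f by (simp only:)
    qed
  qed
qed

lemma primitive_multiple:
  assumes "form w1 w2 w3 \<noteq> 0"
  obtains l where "l \<noteq> 0" "primitive (w1 / l) (w2 / l) (w3 / l)"
proof -
  have "Max (v ` {w1, w2, w3}) \<in> v ` {w1, w2, w3}" by (rule Max_in) auto
  then obtain l where l: "Max (v ` {w1, w2, w3}) = v l" "l \<in> {w1, w2, w3}" by (rule imageE)
  have "v w \<le> Max (v ` {w1, w2, w3})" if "w \<in> {w1, w2, w3}" for w using that by (intro Max_ge) auto
  then have max: "v w1 \<le> v l" "v w2 \<le> v l" "v w3 \<le> v l" unfolding l(1)[symmetric] by blast+
  have "l \<noteq> 0"
  proof
    assume "l = 0"
    then have "v w1 \<le> 0" "v w2 \<le> 0" "v w3 \<le> 0" using max by (simp_all add: v_simps(4))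
    then have "w1 = 0" "w2 = 0" "w3 = 0" using v_simps(11) not_less by blast+
    then show False using assms by (simp add: form_def)
  qed
  then have "0 < v l" by (simp add: v_simps)
  then have "primitive (w1 / l) (w2 / l) (w3 / l)"
    using max l(2) by (auto simp: primitive_def v_simps)
  with \<open>l \<noteq> 0\<close> show ?thesis by (rule that)
qed

lemma form_divide: "form (w1 / l) (w2 / l) (w3 / l) = form w1 w2 w3 / (l * star l)"
  by (simp add: form_def star_simps add_divide_distrib mult.commute)

text \<open>Only the rows that meet the lower right minor of size m + 1 are constrained: the last
  row of the middle block, supported there with entries r, and the rows below it.\<close>

definition mid_row :: "nat \<Rightarrow> 'a mat \<Rightarrow> (nat \<Rightarrow> 'a) \<Rightarrow> bool" where
  "mid_row m g r \<longleftrightarrow> g \<in> carrier_mat (m + 3 + m) (m + 3 + m) \<and>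
     (\<forall>j<m + 3 + m. g $$ (m + 2, j) = (if m \<le> j \<and> j < m + 3 then r (j - m) else 0)) \<and>
     (\<forall>i\<in>{m + 3..<m + 3 + m}. \<forall>j<m + 3 + m. g $$ (i, j) = (if i = j then 1 else 0))"

lemma act_index:
  assumes "g \<in> carrier_mat N N" "y \<in> carrier_mat N N" "i < N" "j < N"
  shows "act star g y $$ (i, j) = (\<Sum>b<N. (\<Sum>a<N. g $$ (i, a) * y $$ (a, b)) * star (g $$ (j, b)))"
proof -
  have "act star g y $$ (i, j) = (\<Sum>b<N. (g * y) $$ (i, b) * adj star g $$ (b, j))"
    unfolding act_def using assms by (intro index_mult_sum) (auto intro: mult_carrier_mat)
  also have "\<dots> = (\<Sum>b<N. (\<Sum>a<N. g $$ (i, a) * y $$ (a, b)) * star (g $$ (j, b)))"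
    using assms by (intro sum.cong refl) (simp add: adj_index index_mult_sum[of g N N y N] del: index_mult_mat(1))
  finally show ?thesis .
qed

lemma mid_row_sum:
  assumes "mid_row m g r" "i \<in> {m + 2..<m + 3 + m}"
  shows "(\<Sum>a<m + 3 + m. g $$ (i, a) * f a) = (if i = m + 2 then \<Sum>b<3. r b * f (m + b) else f i)"
    "(\<Sum>a<m + 3 + m. f a * star (g $$ (i, a))) = (if i = m + 2 then \<Sum>b<3. f (m + b) * star (r b) else f i)"
proof -
  have *: "(\<Sum>a<m + 3 + m. h a (g $$ (i, a))) = (if i = m + 2 then \<Sum>b<3. h (m + b) (r b) else h i 1)"
    if h: "\<And>a. h a 0 = 0" for h :: "nat \<Rightarrow> 'a \<Rightarrow> 'a"
  proof (cases "i = m + 2")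
    case True
    then show ?thesis using assms(1) h unfolding sum_split3 by (simp add: mid_row_def)
  next
    case False
    then have "(\<Sum>a<m + 3 + m. h a (g $$ (i, a))) = (\<Sum>a<m + 3 + m. if a = i then h a 1 else 0)"
      using assms h by (intro sum.cong refl) (auto simp: mid_row_def)
    then show ?thesis using False assms(2) by simp
  qed
  show "(\<Sum>a<m + 3 + m. g $$ (i, a) * f a) = (if i = m + 2 then \<Sum>b<3. r b * f (m + b) else f i)"
    using *[of "\<lambda>a x. x * f a"] by simp
  show "(\<Sum>a<m + 3 + m. f a * star (g $$ (i, a))) = (if i = m + 2 then \<Sum>b<3. f (m + b) * star (r b) else f i)"
    using *[of "\<lambda>a x. f a * star x"] by (simp add: star_simps)
qed

lemma mid_row_act:
  assumes g: "mid_row m g r" and y: "y \<in> carrier_mat (m + 3 + m) (m + 3 + m)"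
    and ij: "i \<in> {m + 2..<m + 3 + m}" "j \<in> {m + 2..<m + 3 + m}"
  shows "act star g y $$ (i, j) =
    (if j = m + 2 then \<Sum>b<3. (if i = m + 2 then \<Sum>a<3. r a * y $$ (m + a, m + b) else y $$ (i, m + b)) * star (r b)
     else if i = m + 2 then \<Sum>a<3. r a * y $$ (m + a, j) else y $$ (i, j))"
proof -
  have gc: "g \<in> carrier_mat (m + 3 + m) (m + 3 + m)" using g by (simp add: mid_row_def)
  show ?thesis
    using ij by (subst act_index[OF gc y])
      (simp, simp, simp only: mid_row_sum(1)[OF g ij(1)] mid_row_sum(2)[OF g ij(2)])
qed

lemma lower_right_minor_mid_row:
  assumes g: "mid_row m g r" and y: "y \<in> carrier_mat (m + 3 + m) (m + 3 + m)" and i: "i \<le> m"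
  shows "lower_right_minor i (act star g y) = lower_right_minor i y"
proof -
  have c: "act star g y \<in> carrier_mat (m + 3 + m) (m + 3 + m)"
    using g y by (auto simp: mid_row_def act_def intro!: mult_carrier_mat)
  have e: "act star g y $$ (m + 3 + m - i + a, m + 3 + m - i + b) = y $$ (m + 3 + m - i + a, m + 3 + m - i + b)"
    if "a < i" "b < i" for a b
    using that i by (subst mid_row_act[OF g y]) auto
  have d: "dim_row (act star g y) = m + 3 + m" "dim_col (act star g y) = m + 3 + m"
    "dim_row y = m + 3 + m" "dim_col y = m + 3 + m" using c y by auto
  show ?thesis unfolding lower_right_minor_def d
    by (intro arg_cong[where f = Determinant.det] cong_mat refl) (simp only: prod.case e)
qed

lemma matrix_inverse_exists:
  fixes D :: "'b::field mat"
  assumes "D \<in> carrier_mat m m" "Determinant.det D \<noteq> 0"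
  obtains I where "I \<in> carrier_mat m m" "D * I = 1\<^sub>m m" "I * D = 1\<^sub>m m"
  using det_non_zero_imp_unit[OF assms, of "()"] by (auto simp: Units_def ring_mat_def)

text \<open>The Schur complement \<open>A\<close> of the lower right block \<open>D\<close> is
  Hermitian, and \<open>A * antidiag 3\<close> inherits from y j that it is an involution of trace
  1. So \<open>A\<close> is the antidiagonal matrix minus a rank one term in w, by
  \<open>hermitian_rank_one_form\<close>. By \<open>det_schur_corner\<close> the next minor is det
  \<open>D\<close> times the value of \<open>A\<close> at the row r, and isotropy of r removes the
  antidiagonal part. Scaling w to a primitive vector does not change the quotient.\<close>

lemma lower_right_minor_hermitian_involution:
  assumes y: "y \<in> carrier_mat (m + 3 + m) (m + 3 + m)" and herm: "adj star y = y"
    and inv: "y * antidiag (m + 3 + m) * y = antidiag (m + 3 + m)"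
    and tr: "mtrace (y * antidiag (m + 3 + m)) = 1" and d: "lower_right_minor m y \<noteq> 0"
  obtains w1 w2 w3 where "primitive w1 w2 w3" "form w1 w2 w3 \<noteq> 0"
    "\<And>g r. mid_row m g r \<Longrightarrow> form (r 0) (r 1) (r 2) = 0 \<Longrightarrow>
       lower_right_minor (Suc m) (act star g y) =
       - 2 * lower_right_minor m y * ((r 0 * w1 + r 1 * w2 + r 2 * w3) * star (r 0 * w1 + r 1 * w2 + r 2 * w3))
         / form w1 w2 w3"
proof -
  let ?N = "m + 3 + m"
  define D where "D = blk y (m + 3) m (m + 3) m"
  define B where "B = blk y m 3 (m + 3) m"
  define C where "C = blk y (m + 3) m m 3"
  define A0 where "A0 = blk y m 3 m 3"
  have car: "D \<in> carrier_mat m m" "B \<in> carrier_mat 3 m" "C \<in> carrier_mat m 3" "A0 \<in> carrier_mat 3 3"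
    by (auto simp: D_def B_def C_def A0_def)
  have dD: "lower_right_minor m y = Determinant.det D"
    unfolding lower_right_minor_def D_def blk_def using y by (intro arg_cong[where f = Determinant.det] eq_matI) auto
  then obtain I where I: "I \<in> carrier_mat m m" "D * I = 1\<^sub>m m" "I * D = 1\<^sub>m m"
    using matrix_inverse_exists[OF car(1)] d by auto
  have yh: "star (y $$ (i, j)) = y $$ (j, i)" if "i < ?N" "j < ?N" for i j
    using adj_index[OF y that(2,1)] herm by simp
  have adjs: "adj star D = D" "adj star B = C" "adj star C = B" "adj star A0 = A0"
    by (auto simp: D_def B_def C_def A0_def adj_def blk_def yh intro!: eq_matI)
  have adjI: "adj star I = I"
  proof -
    have "adj star I * D = 1\<^sub>m m" using adj_mult[OF car(1) I(1)] I(2) adjs by simp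
    then have "adj star I * D * I = I" using I by simp
    moreover have "adj star I * D * I = adj star I * (D * I)" using I car by (intro assoc_mult_mat[of _ m m _ m _ m]) auto
    ultimately show ?thesis using I right_mult_one_mat[OF adj_carrier[OF I(1)]] by simp
  qed
  define A where "A = A0 - B * (I * C)"
  have IC: "I * C \<in> carrier_mat m 3" "B * (I * C) \<in> carrier_mat 3 3" using car I by (auto intro!: mult_carrier_mat)
  have A: "A \<in> carrier_mat 3 3" unfolding A_def using IC by (intro minus_carrier_mat)
  have adjBIC: "adj star (B * (I * C)) = B * (I * C)"
  proof -
    have "adj star (B * (I * C)) = (B * I) * C"
      using adj_mult[OF car(2) IC(1)] adj_mult[OF I(1) car(3)] adjs adjI by simp
    also have "\<dots> = B * (I * C)" using car I by (intro assoc_mult_mat) auto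
    finally show ?thesis .
  qed
  have herA: "star (A $$ (a, b)) = A $$ (b, a)" if "a < 3" "b < 3" for a b
    using adj_index[OF IC(2) that(2,1)] adj_index[OF car(4) that(2,1)] adjBIC adjs(4) IC car that
    by (simp add: A_def star_simps del: index_mult_mat(1))
  let ?M = "y * antidiag ?N"
  have M: "?M \<in> carrier_mat ?N ?N" using y by (intro mult_carrier_mat) auto
  have Mi: "?M $$ (i, j) = y $$ (i, ?N - 1 - j)" if "i < ?N" "j < ?N" for i j
    unfolding mult_antidiag[OF y] using that by simp
  have MM: "?M * ?M = 1\<^sub>m ?N"
  proof -
    have "?M * ?M = (?M * y) * antidiag ?N" by (rule assoc_mult_mat[OF M y antidiag_carrier, symmetric])
    then show ?thesis unfolding inv antidiag_square .
  qed
  have Mi3: "?M $$ (i, j) = y $$ (i, m + 3 + (m - 1 - j))" if "i < ?N" "j < m" for i j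
    using that by (subst Mi) (auto intro!: arg_cong[where f = "\<lambda>j. y $$ (i, j)"])
  have Mi2: "?M $$ (i, m + j) = y $$ (i, m + (3 - 1 - j))" if "i < ?N" "j < 3" for i j
    using that by (subst Mi) (auto intro!: arg_cong[where f = "\<lambda>j. y $$ (i, j)"])
  have b31: "blk ?M (m + 3) m 0 m = D * antidiag m"
    unfolding mult_antidiag[OF car(1)] unfolding D_def blk_def
    by (rule cong_mat[OF refl refl]) (subst prod.case, subst prod.case, subst add_0, subst Mi3, simp, simp, subst index_mat, simp_all)
  have b21: "blk ?M m 3 0 m = B * antidiag m"
    unfolding mult_antidiag[OF car(2)] unfolding B_def blk_def
    by (rule cong_mat[OF refl refl]) (subst prod.case, subst prod.case, subst add_0, subst Mi3, simp, simp, subst index_mat, simp_all)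
  have b32: "blk ?M (m + 3) m m 3 = C * antidiag 3"
    unfolding mult_antidiag[OF car(3)] unfolding C_def blk_def
    by (rule cong_mat[OF refl refl]) (subst prod.case, subst prod.case, subst Mi2, simp, simp, subst index_mat, simp_all)
  have b22: "blk ?M m 3 m 3 = A0 * antidiag 3"
    unfolding mult_antidiag[OF car(4)] unfolding A0_def blk_def
    by (rule cong_mat[OF refl refl]) (subst prod.case, subst prod.case, subst Mi2, simp, simp, subst index_mat, simp_all)
  \<comment> \<open>Right multiplication by the antidiagonal matrix reverses columns and so brings
    the block \<open>D\<close> of \<open>y\<close> to the lower left of \<open>?M\<close>, where
    \<open>?J\<close> inverts it.\<close>
  let ?J = "antidiag m * I"
  have J: "?J \<in> carrier_mat m m" using I by (intro mult_carrier_mat) auto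
  have J1: "?J * (D * antidiag m) = 1\<^sub>m m"
  proof -
    have "?J * (D * antidiag m) = antidiag m * (I * (D * antidiag m))"
      using I car by (intro assoc_mult_mat[of _ m m _ m _ m]) auto
    also have "I * (D * antidiag m) = I * D * antidiag m"
      using I car by (intro assoc_mult_mat[symmetric, of _ m m _ m _ m]) auto
    finally show ?thesis unfolding I(3) left_mult_one_mat[OF antidiag_carrier] antidiag_square .
  qed
  have J2: "(D * antidiag m) * ?J = 1\<^sub>m m" using mat_mult_left_right_inverse[OF J _ J1] car by auto
  have E: "blk ?M m 3 m 3 - blk ?M m 3 0 m * (?J * blk ?M (m + 3) m m 3) = A * antidiag 3"
  proof -
    have c1: "antidiag m * (I * (C * antidiag 3)) \<in> carrier_mat m 3" using car I by (auto intro!: mult_carrier_mat)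
    have "?J * (C * antidiag 3) = antidiag m * (I * (C * antidiag 3))"
      using car I by (intro assoc_mult_mat[of _ m m _ m _ 3]) auto
    then have "B * antidiag m * (?J * (C * antidiag 3)) = B * antidiag m * (antidiag m * (I * (C * antidiag 3)))" by simp
    also have "\<dots> = B * (antidiag m * (antidiag m * (I * (C * antidiag 3))))" using car c1 by (intro assoc_mult_mat[of _ 3 m _ m _ 3]) auto
    also have "antidiag m * (antidiag m * (I * (C * antidiag 3))) = antidiag m * antidiag m * (I * (C * antidiag 3))"
      using car I by (intro assoc_mult_mat[symmetric, of _ m m _ m _ 3]) (auto intro!: mult_carrier_mat)
    also have "\<dots> = I * (C * antidiag 3)" using car I by (simp add: antidiag_square mult_carrier_mat[of _ m m] mult_carrier_mat[of _ m 3])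
    also have "\<dots> = I * C * antidiag 3" using car I by (intro assoc_mult_mat[symmetric, of _ m m _ 3 _ 3]) auto
    also have "B * \<dots> = B * (I * C) * antidiag 3" using car IC by (intro assoc_mult_mat[symmetric, of _ 3 m _ 3 _ 3]) auto
    finally show ?thesis unfolding b31 b21 b22 b32 A_def
      using minus_mult_distrib_mat[OF car(4) IC(2) antidiag_carrier] by simp
  qed
  note sc = schur_complement_involution[OF M MM J, unfolded b31, OF J1 J2, folded b31, unfolded E]
  have "A * antidiag 3 \<in> carrier_mat 3 3" using A by (intro mult_carrier_mat) auto
  note AE = index_mult_sum[OF this this]
  have Ai: "(A * antidiag 3) $$ (a, b) = A $$ (a, 2 - b)" if "a < 3" "b < 3" for a b
    unfolding mult_antidiag[OF A] using that by simp
  have invol: "(\<Sum>c<3. A $$ (a, 2 - c) * A $$ (c, 2 - b)) = (if a = b then 1 else 0)" if "a < 3" "b < 3" for a b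
  proof -
    have "(\<Sum>c<3. A $$ (a, 2 - c) * A $$ (c, 2 - b)) = (A * antidiag 3 * (A * antidiag 3)) $$ (a, b)"
      unfolding AE[OF that] using that by (intro sum.cong) (auto simp: Ai)
    then show ?thesis unfolding sc(1) using that by simp
  qed
  have "mtrace (A * antidiag 3) = (\<Sum>a<3. A $$ (a, 2 - a))"
    unfolding mtrace_def mult_antidiag[OF A] by (auto intro!: sum.cong)
  then have trA: "(\<Sum>a<3. A $$ (a, 2 - a)) = 1" using sc(2) tr by simp
  obtain w where w: "form (w 0) (w 1) (w 2) \<noteq> 0" and Aw: "\<And>a b. a < 3 \<Longrightarrow> b < 3 \<Longrightarrow>
    A $$ (a, b) = (if a + b = 2 then 1 else 0) - 2 * w a * star (w b) / form (w 0) (w 1) (w 2)"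
    using hermitian_rank_one_form[of "\<lambda>a b. A $$ (a, b)", OF herA invol trA] by blast
  obtain l where l: "l \<noteq> 0" "primitive (w 0 / l) (w 1 / l) (w 2 / l)" using primitive_multiple[OF w] .
  show ?thesis
  proof (rule that[OF l(2)])
    have sl: "star l \<noteq> 0" using l by (simp add: star_simps)
    show "form (w 0 / l) (w 1 / l) (w 2 / l) \<noteq> 0" using w l sl by (simp add: form_divide)
    fix g r assume g: "mid_row m g r" and r: "form (r 0) (r 1) (r 2) = 0"
    define R where "R = mat 1 3 (\<lambda>(_, b). r b)"
    have R: "R \<in> carrier_mat 1 3" "adj star R \<in> carrier_mat 3 1" by (simp_all add: R_def)
    have Ri: "R $$ (0, b) = r b" "adj star R $$ (b, 0) = star (r b)" if "b < 3" for b
      using that by (auto simp: R_def adj_def)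
    have c: "R * A0 * adj star R \<in> carrier_mat 1 1" "R * B \<in> carrier_mat 1 m" "C * adj star R \<in> carrier_mat m 1"
      "R * A0 \<in> carrier_mat 1 3" using car R by (auto intro!: mult_carrier_mat)
    have gc: "act star g y \<in> carrier_mat ?N ?N"
      using g y by (auto simp: mid_row_def act_def intro!: mult_carrier_mat)
    have ent: "(R * A0 * adj star R) $$ (0, 0) = (\<Sum>b<3. (\<Sum>a<3. r a * y $$ (m + a, m + b)) * star (r b))"
      "\<And>j. j < m \<Longrightarrow> (R * B) $$ (0, j) = (\<Sum>a<3. r a * y $$ (m + a, m + 3 + j))"
      "\<And>i. i < m \<Longrightarrow> (C * adj star R) $$ (i, 0) = (\<Sum>b<3. y $$ (m + 3 + i, m + b) * star (r b))"
      using index_mult_sum[OF c(4) R(2), of 0 0] index_mult_sum[OF R(1) car(4), of 0]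
        index_mult_sum[OF R(1) car(2), of 0] index_mult_sum[OF car(3) R(2), of _ 0]
      by (auto simp: Ri A0_def B_def C_def blk_def simp del: index_mult_mat(1) intro!: sum.cong)
    have dims: "dim_row (R * A0 * adj star R) = 1" "dim_col (R * A0 * adj star R) = 1"
      "dim_row D = m" "dim_col D = m" "dim_row y = m + 3 + m"
      "dim_row (act star g y) - Suc m = m + 2" "dim_col (act star g y) - Suc m = m + 2"
      using carrier_matD[OF c(1)] carrier_matD[OF car(1)] carrier_matD[OF y] carrier_matD[OF gc] by simp_all
    define T where "T = four_block_mat (R * A0 * adj star R) (R * B) (C * adj star R) D"
    have dT: "dim_row T = Suc m" "dim_col T = Suc m" by (simp_all only: T_def index_mat_four_block dims plus_1_eq_Suc)
    have T: "T $$ (i, j) = (if i < 1 then if j < 1 then (R * A0 * adj star R) $$ (i, j) else (R * B) $$ (i, j - 1)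
        else if j < 1 then (C * adj star R) $$ (i - 1, j) else D $$ (i - 1, j - 1))" if "i < Suc m" "j < Suc m" for i j
      unfolding T_def using that by (subst index_mat_four_block(1)) (simp_all add: dims del: index_mult_mat)
    have "lower_right_minor (Suc m) (act star g y) =
       Determinant.det (four_block_mat (R * A0 * adj star R) (R * B) (C * adj star R) D)"
      unfolding lower_right_minor_def T_def[symmetric]
    proof (rule arg_cong[where f = Determinant.det], rule eq_matI)
      fix i j assume "i < dim_row T" "j < dim_col T"
      then have ij: "i < Suc m" "j < Suc m" by (simp_all only: dT)
      have e: "act star g y $$ (m + 2 + i, m + 2 + j) = T $$ (i, j)"
        unfolding T[OF ij] using ij ent
        by (subst mid_row_act[OF g y]) (auto simp: D_def blk_def not_less Suc_le_eq gr0_conv_Suc numeral_3_eq_3 simp del: index_mult_mat)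
      then show "mat (Suc m) (Suc m) (\<lambda>(a, b). act star g y $$ (dim_row (act star g y) - Suc m + a,
          dim_col (act star g y) - Suc m + b)) $$ (i, j) = T $$ (i, j)"
        using ij by (simp only: index_mat prod.case dims)
    qed (simp_all only: dT dim_row_mat dim_col_mat)
    also have "\<dots> = (R * A0 * adj star R - R * B * (I * (C * adj star R))) $$ (0, 0) * lower_right_minor m y"
      unfolding dD by (rule det_schur_corner[OF c(1-3) car(1) I(1,2)])
    also have "R * B * (I * (C * adj star R)) = R * (B * (I * C)) * adj star R"
    proof -
      have "I * (C * adj star R) = I * C * adj star R" using I car R by (intro assoc_mult_mat[symmetric, of _ m m _ 3 _ 1]) auto
      then have "R * B * (I * (C * adj star R)) = R * B * (I * C * adj star R)" by simp
      also have "\<dots> = R * B * (I * C) * adj star R" using IC c R by (intro assoc_mult_mat[symmetric, of _ 1 m _ 3 _ 1]) auto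
      also have "R * B * (I * C) = R * (B * (I * C))" by (rule assoc_mult_mat[OF R(1) car(2) IC(1)])
      finally show ?thesis .
    qed
    also have "R * A0 * adj star R - R * (B * (I * C)) * adj star R = (R * A0 - R * (B * (I * C))) * adj star R"
      by (rule minus_mult_distrib_mat[symmetric, OF c(4) mult_carrier_mat[OF R(1) IC(2)] R(2)])
    also have "R * A0 - R * (B * (I * C)) = R * A"
      unfolding A_def by (rule mult_minus_distrib_mat[symmetric, OF R(1) car(4) IC(2)])
    also have "(R * A * adj star R) $$ (0, 0) = (\<Sum>b<3. (\<Sum>a<3. r a * A $$ (a, b)) * star (r b))"
    proof -
      have RA: "R * A \<in> carrier_mat 1 3" by (rule mult_carrier_mat[OF R(1) A])
      show ?thesis using index_mult_sum[OF RA R(2), of 0 0] index_mult_sum[OF R(1) A, of 0]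
        by (auto simp: Ri simp del: index_mult_mat(1) intro!: sum.cong)
    qed
    also have "\<dots> = form (r 0) (r 1) (r 2) - 2 * ((r 0 * w 0 + r 1 * w 1 + r 2 * w 2) * star (r 0 * w 0 + r 1 * w 1 + r 2 * w 2))
         / form (w 0) (w 1) (w 2)"
    proof -
      define c where "c = inverse (form (w 0) (w 1) (w 2))"
      have Ac: "A $$ (a, b) = (if a + b = 2 then 1 else 0) - 2 * w a * star (w b) * c" if "a < 3" "b < 3" for a b
        unfolding Aw[OF that] c_def by (simp only: divide_inverse)
      show ?thesis
        unfolding sum_less_3 divide_inverse c_def[symmetric]
        by (simp add: Ac form_def star_simps) (simp add: algebra_simps)
    qed
    finally have fin: "lower_right_minor (Suc m) (act star g y) = (form (r 0) (r 1) (r 2) -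
        2 * ((r 0 * w 0 + r 1 * w 1 + r 2 * w 2) * star (r 0 * w 0 + r 1 * w 1 + r 2 * w 2)) / form (w 0) (w 1) (w 2)) * lower_right_minor m y" .
    have e: "r 0 * (w 0 / l) + r 1 * (w 1 / l) + r 2 * (w 2 / l) = (r 0 * w 0 + r 1 * w 1 + r 2 * w 2) / l"
      by (simp add: add_divide_distrib)
    define x where "x = r 0 * w 0 + r 1 * w 1 + r 2 * w 2"
    have "x / l * star (x / l) / (form (w 0) (w 1) (w 2) / (l * star l)) = x * star x / form (w 0) (w 1) (w 2)"
      using l(1) sl by (simp add: star_simps(8))
    then have "- 2 * d * (x / l * star (x / l)) / (form (w 0) (w 1) (w 2) / (l * star l)) =
        (0 - 2 * (x * star x) / form (w 0) (w 1) (w 2)) * d" for d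
      by (simp only: times_divide_eq_right[symmetric]) (simp add: algebra_simps)
    then show "lower_right_minor (Suc m) (act star g y) =
       - 2 * lower_right_minor m y * ((r 0 * (w 0 / l) + r 1 * (w 1 / l) + r 2 * (w 2 / l)) * star (r 0 * (w 0 / l) + r 1 * (w 1 / l) + r 2 * (w 2 / l)))
         / form (w 0 / l) (w 1 / l) (w 2 / l)"
      by (simp only: fin e form_divide r x_def[symmetric])
  qed
qed

end

section \<open>The maximal compact subgroup\<close>

lemma Max_image_le_iff2:
  fixes f :: "nat \<Rightarrow> nat \<Rightarrow> real"
  assumes "N > 0"
  shows "Max {f i j |i j. i < N \<and> j < N} \<le> r \<longleftrightarrow> (\<forall>i<N. \<forall>j<N. f i j \<le> r)"
    "Max {f i j |i j. i < N \<and> j < N} \<in> {f i j |i j. i < N \<and> j < N}"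
proof -
  have e: "{f i j |i j. i < N \<and> j < N} = (\<lambda>(i, j). f i j) ` ({..<N} \<times> {..<N})" by auto
  have fin: "finite {f i j |i j. i < N \<and> j < N}" unfolding e by simp
  have ne: "{f i j |i j. i < N \<and> j < N} \<noteq> {}" using assms by auto
  show "Max {f i j |i j. i < N \<and> j < N} \<le> r \<longleftrightarrow> (\<forall>i<N. \<forall>j<N. f i j \<le> r)"
    unfolding Max_le_iff[OF fin ne] by blast
  show "Max {f i j |i j. i < N \<and> j < N} \<in> {f i j |i j. i < N \<and> j < N}" by (rule Max_in[OF fin ne])
qed

lemma square_mult: "A \<in> carrier_mat a a \<Longrightarrow> B \<in> carrier_mat a a \<Longrightarrow> A * B \<in> carrier_mat a a"
  by (rule mult_carrier_mat)

lemma square_assoc: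
  fixes A :: "'a::semiring_1 mat"
  shows "A \<in> carrier_mat a a \<Longrightarrow> B \<in> carrier_mat a a \<Longrightarrow> C \<in> carrier_mat a a \<Longrightarrow> A * B * C = A * (B * C)"
    "A \<in> carrier_mat a a \<Longrightarrow> A * 1\<^sub>m a = A" "A \<in> carrier_mat a a \<Longrightarrow> 1\<^sub>m a * A = A"
  by (rule assoc_mult_mat, auto)

context unramified_quadratic
begin

text \<open>Telescoping; by the ultrametric inequality the number of terms does not enter. It makes
  the minors Lipschitz functions on the compact group.\<close>

lemma v_prod_diff_le:
  assumes "finite S" "\<And>i. i \<in> S \<Longrightarrow> v (f i) \<le> C" "\<And>i. i \<in> S \<Longrightarrow> v (g i) \<le> C"
    "\<And>i. i \<in> S \<Longrightarrow> v (f i - g i) \<le> C * e" "1 \<le> C" "0 \<le> e"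
  shows "v (prod f S - prod g S) \<le> C ^ card S * e" "v (prod f S) \<le> C ^ card S"
proof -
  have "v (prod f S - prod g S) \<le> C ^ card S * e \<and> v (prod f S) \<le> C ^ card S"
    using assms(1-4)
  proof (induction S rule: finite_induct)
    case empty
    then show ?case using assms(6) by (simp add: v_simps)
  next
    case (insert i S)
    have C0: "0 \<le> C" "0 \<le> C ^ card S" using assms(5) by auto
    have IH: "v (prod f S - prod g S) \<le> C ^ card S * e" "v (prod f S) \<le> C ^ card S"
      using insert by auto
    have b: "v (f i) \<le> C" "v (g i) \<le> C" "v (f i - g i) \<le> C * e" using insert by auto
    have e: "prod f (insert i S) - prod g (insert i S) = (f i - g i) * prod f S + g i * (prod f S - prod g S)"
      using insert(1,2) by (simp add: algebra_simps)
    have "v ((f i - g i) * prod f S) \<le> (C * e) * C ^ card S"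
      unfolding v_simps(3) using b IH C0 assms(6) v_simps(1) by (intro mult_mono) auto
    moreover have "v (g i * (prod f S - prod g S)) \<le> C * (C ^ card S * e)"
      unfolding v_simps(3) using b IH C0 assms(6) v_simps(1) by (intro mult_mono) auto
    ultimately have "v (prod f (insert i S) - prod g (insert i S)) \<le> C ^ card (insert i S) * e"
      unfolding e using insert(1,2) by (intro v_add_le[OF v]) (simp_all add: mult_ac)
    moreover have "v (prod f (insert i S)) \<le> C ^ card (insert i S)"
      using insert(1,2) IH(2) b(1) C0 v_simps(1) by (simp add: v_simps(3) mult_mono)
    ultimately show ?case by blast
  qed
  then show "v (prod f S - prod g S) \<le> C ^ card S * e" "v (prod f S) \<le> C ^ card S" by auto
qed

lemma v_det_diff_le:
  assumes "A \<in> carrier_mat i i" "B \<in> carrier_mat i i"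
    "\<And>a b. a < i \<Longrightarrow> b < i \<Longrightarrow> v (A $$ (a, b)) \<le> C" "\<And>a b. a < i \<Longrightarrow> b < i \<Longrightarrow> v (B $$ (a, b)) \<le> C"
    "\<And>a b. a < i \<Longrightarrow> b < i \<Longrightarrow> v (A $$ (a, b) - B $$ (a, b)) \<le> C * e" "1 \<le> C" "0 \<le> e"
  shows "v (Determinant.det A - Determinant.det B) \<le> C ^ i * e" "v (Determinant.det A) \<le> C ^ i"
proof -
  have vs: "v (signof p * z) = v z" for p :: "nat \<Rightarrow> nat" and z
    by (simp add: sign_def v_simps)
  have per: "p a < i" if "p permutes {0..<i}" "a \<in> {0..<i}" for p a
    using permutes_in_image[OF that(1)] that(2) by simp
  have fin: "finite {p. p permutes {0..<i}}" by (simp add: finite_permutations)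
  have P: "v ((\<Prod>a = 0..<i. A $$ (a, p a)) - (\<Prod>a = 0..<i. B $$ (a, p a))) \<le> C ^ i * e"
    "v (\<Prod>a = 0..<i. A $$ (a, p a)) \<le> C ^ i" if "p permutes {0..<i}" for p
    using v_prod_diff_le[of "{0..<i}" "\<lambda>a. A $$ (a, p a)" C "\<lambda>a. B $$ (a, p a)" e] assms per[OF that]
    by simp_all
  have e: "Determinant.det A - Determinant.det B =
      (\<Sum>p | p permutes {0..<i}. signof p * ((\<Prod>a = 0..<i. A $$ (a, p a)) - (\<Prod>a = 0..<i. B $$ (a, p a))))"
    using assms(1,2) by (simp add: det_def' sum_subtractf right_diff_distrib)
  show "v (Determinant.det A - Determinant.det B) \<le> C ^ i * e"
    unfolding e using P(1) assms(6,7) by (intro v_sum_le[OF v fin]) (auto simp: vs)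
  show "v (Determinant.det A) \<le> C ^ i"
    unfolding det_def'[OF assms(1)] using P(2) assms(6) by (intro v_sum_le[OF v fin]) (auto simp: vs)
qed

end

text \<open>Here m = n - 1, so that 2n + 1 = m + 3 + m displays the middle 3 x 3 block between two
  blocks of size m.\<close>

locale haar_setup = unramified_quadratic p Qp k star v \<pi>
  for p :: nat and Qp k :: "'a::field_char_0 set"
    and star :: "'a \<Rightarrow> 'a" and v :: "'a \<Rightarrow> real" and \<pi> :: 'a +
  fixes m :: nat and M :: "'a mat measure" and x :: "'a mat"
  assumes haar: "normalized_Haar star v (Suc m) M" and x: "x \<in> X_space star (Suc m)"
begin

abbreviation N :: nat where "N \<equiv> m + 3 + m"
abbreviation J :: "'a mat" where "J \<equiv> antidiag N"
abbreviation K :: "'a mat set" where "K \<equiv> K_grp star v (Suc m)"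

lemma N_eq: "2 * Suc m + 1 = N" by simp

lemma unitary_inverse:
  assumes g: "g \<in> carrier_mat N N" "adj star g * J * g = J"
  shows "(J * adj star g * J) * g = 1\<^sub>m N" "g * (J * adj star g * J) = 1\<^sub>m N" "g * J * adj star g = J"
proof -
  note c = antidiag_carrier[of N] adj_carrier[OF g(1)] g(1)
  have JA: "J * adj star g \<in> carrier_mat N N" and I: "J * adj star g * J \<in> carrier_mat N N"
    using square_mult[OF c(1,2)] square_mult[OF square_mult[OF c(1,2)] c(1)] by blast+
  have "(J * adj star g * J) * g = J * (adj star g * J * g)"
    using c JA by (simp add: square_assoc(1)[of _ N] square_mult)
  then show 1: "(J * adj star g * J) * g = 1\<^sub>m N" using g antidiag_square by simp
  show 2: "g * (J * adj star g * J) = 1\<^sub>m N" by (rule mat_mult_left_right_inverse[OF I g(1) 1])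
  have "g * J * adj star g = g * (J * adj star g * J) * J"
    using c JA by (simp add: square_assoc(1)[of _ N] square_assoc(2,3) square_mult antidiag_square)
  then show "g * J * adj star g = J" unfolding 2 by (simp add: square_assoc(3))
qed

lemma G_iff: "g \<in> G_grp star (Suc m) \<longleftrightarrow> g \<in> carrier_mat N N \<and> adj star g * J * g = J"
proof -
  have "invertible_mat g" if g: "g \<in> carrier_mat N N" "adj star g * J * g = J"
    using unitary_inverse[OF g] g(1) unfolding invertible_mat_def inverts_mat_def
    by (intro conjI exI[of _ "J * adj star g * J"]) (auto simp: antidiag_def)
  then show ?thesis unfolding G_grp_def N_eq by blast
qed

lemma K_iff: "g \<in> K \<longleftrightarrow> g \<in> carrier_mat N N \<and> adj star g * J * g = J \<and> (\<forall>i<N. \<forall>j<N. v (g $$ (i, j)) \<le> 1)"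
  unfolding K_grp_def mem_Collect_eq G_iff N_eq by (auto simp: integers_of_def)

lemma K_carrier: "g \<in> K \<Longrightarrow> g \<in> carrier_mat N N"
  by (simp add: K_iff)

lemma K_entry: "g \<in> K \<Longrightarrow> i < N \<Longrightarrow> j < N \<Longrightarrow> v (g $$ (i, j)) \<le> 1"
  by (simp add: K_iff)

text \<open>The inverse of a unitary matrix; its entries are conjugates of entries of g in reflected
  positions (\<open>kinv_index\<close>), so its integrality is visible.\<close>

definition kinv :: "'a mat \<Rightarrow> 'a mat" where "kinv g = J * adj star g * J"

lemma kinv_carrier: "g \<in> carrier_mat N N \<Longrightarrow> kinv g \<in> carrier_mat N N"
  unfolding kinv_def by (intro square_mult adj_carrier antidiag_carrier)

lemma kinv_index: assumes "g \<in> carrier_mat N N" "i < N" "j < N"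
  shows "kinv g $$ (i, j) = star (g $$ (N - 1 - j, N - 1 - i))"
proof -
  have c: "J * adj star g \<in> carrier_mat N N" using assms by (intro square_mult) auto
  have "kinv g $$ (i, j) = (J * adj star g) $$ (i, N - 1 - j)"
    unfolding kinv_def mult_antidiag[OF c] using assms by simp
  also have "\<dots> = (\<Sum>a<N. J $$ (i, a) * adj star g $$ (a, N - 1 - j))"
    using assms by (intro index_mult_sum[of _ N N _ N]) auto
  also have "\<dots> = (\<Sum>a<N. if a = N - 1 - i then adj star g $$ (a, N - 1 - j) else 0)"
    using assms by (intro sum.cong) (auto simp: antidiag_def)
  also have "\<dots> = star (g $$ (N - 1 - j, N - 1 - i))"
    using assms by (simp add: adj_index[OF assms(1)])
  finally show ?thesis .
qed

lemma kinv: "g \<in> K \<Longrightarrow> kinv g * g = 1\<^sub>m N" "g \<in> K \<Longrightarrow> g * kinv g = 1\<^sub>m N"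
  unfolding kinv_def using unitary_inverse by (auto simp: K_iff)

lemma K_mult: assumes "g \<in> K" "h \<in> K" shows "g * h \<in> K"
proof -
  have c: "g \<in> carrier_mat N N" "h \<in> carrier_mat N N" "adj star g \<in> carrier_mat N N" "adj star h \<in> carrier_mat N N"
    "adj star g * J \<in> carrier_mat N N" "adj star h * (adj star g * J) \<in> carrier_mat N N"
    using assms by (auto simp: K_iff intro!: square_mult)
  have "adj star (g * h) * J * (g * h) = adj star h * (adj star g * J * g) * h"
    unfolding adj_mult[OF c(1,2)] using c
    by (simp add: square_assoc(1)[of _ N] square_mult)
  then have "adj star (g * h) * J * (g * h) = J" using assms by (simp add: K_iff)
  moreover have "v ((g * h) $$ (i, j)) \<le> 1" if "i < N" "j < N" for i j
    unfolding index_mult_sum[OF c(1,2) that]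
    by (intro v_sum_le[OF v]) (auto simp: v_simps intro!: mult_le_one K_entry assms that v_simps)
  ultimately show ?thesis using c by (auto simp: K_iff intro!: square_mult)
qed

lemma K_one: "1\<^sub>m N \<in> K"
  by (auto simp: K_iff v_simps left_mult_one_mat[OF antidiag_carrier] right_mult_one_mat[OF antidiag_carrier])

lemma K_inv: assumes g: "g \<in> K" shows "kinv g \<in> K"
proof -
  have gc: "g \<in> carrier_mat N N" using g by (simp add: K_iff)
  have gJ: "g * J * adj star g = J" using unitary_inverse(3)[of g] g by (simp add: K_iff)
  have aJ: "adj star J = J" by (rule eq_matI) (auto simp: adj_def antidiag_def star_simps)
  have cc: "J * adj star g \<in> carrier_mat N N" "adj star g \<in> carrier_mat N N" using gc by (auto intro: square_mult)
  have a: "adj star (kinv g) = J * (g * J)"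
    unfolding kinv_def adj_mult[OF cc(1) antidiag_carrier] adj_mult[OF antidiag_carrier cc(2)] aJ by simp
  have "adj star (kinv g) * J * kinv g = J * (g * (J * J) * (J * adj star g * J))"
    unfolding a unfolding kinv_def using gc cc
    by (simp add: square_assoc(1)[of _ N] square_mult)
  also have "\<dots> = J * (g * kinv g)" using gc by (simp add: antidiag_square kinv_def)
  also have "\<dots> = J" using kinv(2)[OF g] by (simp add: square_assoc(2,3))
  finally show ?thesis using kinv_carrier[OF gc] K_entry[OF g] by (auto simp: K_iff kinv_index[OF gc])
qed

lemma kinv_cancel: assumes "g \<in> K" "h \<in> carrier_mat N N"
  shows "kinv g * (g * h) = h" "g * (kinv g * h) = h" "h * kinv g * g = h"
proof -
  have c: "g \<in> carrier_mat N N" "kinv g \<in> carrier_mat N N" using assms K_inv by (auto simp: K_iff)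
  show "kinv g * (g * h) = h" "g * (kinv g * h) = h" "h * kinv g * g = h"
    using assoc_mult_mat[OF c(2,1) assms(2)] assoc_mult_mat[OF c assms(2)] assoc_mult_mat[OF assms(2) c(2,1)]
      kinv[OF assms(1)] assms(2) by simp_all
qed

lemma act_mult: assumes "g \<in> carrier_mat N N" "h \<in> carrier_mat N N" "y \<in> carrier_mat N N"
  shows "act star (g * h) y = act star g (act star h y)"
  unfolding act_def adj_mult[OF assms(1,2)] using assms
  by (simp add: square_assoc(1)[of _ N] square_mult)

section \<open>The unitary group of the middle block and its unipotent elements\<close>

definition K1 :: "'a mat set" where
  "K1 = {g \<in> K. \<forall>i<N. \<forall>j<N. (i \<notin> {m..<m + 3} \<or> j \<notin> {m..<m + 3}) \<longrightarrow> g $$ (i, j) = (if i = j then 1 else 0)}"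

lemma K1_K: "g \<in> K1 \<Longrightarrow> g \<in> K" by (simp add: K1_def)

lemma K1_off: "g \<in> K1 \<Longrightarrow> i < N \<Longrightarrow> j < N \<Longrightarrow> i \<notin> {m..<m + 3} \<or> j \<notin> {m..<m + 3} \<Longrightarrow>
    g $$ (i, j) = (if i = j then 1 else 0)"
  by (simp add: K1_def)

lemma K1_mult: assumes g: "g \<in> K1" and h: "h \<in> K1" shows "g * h \<in> K1"
proof -
  have c: "g \<in> carrier_mat N N" "h \<in> carrier_mat N N" using g h by (auto simp: K1_def K_iff)
  have "(g * h) $$ (i, j) = (if i = j then 1 else 0)"
    if ij: "i < N" "j < N" "i \<notin> {m..<m + 3} \<or> j \<notin> {m..<m + 3}" for i j
  proof (cases "i \<in> {m..<m + 3}")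
    case False
    have "(g * h) $$ (i, j) = (\<Sum>a<N. if a = i then h $$ (a, j) else 0)"
      unfolding index_mult_sum[OF c ij(1,2)] using K1_off[OF g ij(1)] False by (intro sum.cong) auto
    also have "\<dots> = h $$ (i, j)" using ij by simp
    also have "\<dots> = (if i = j then 1 else 0)" using K1_off[OF h ij(1,2)] False by blast
    finally show ?thesis .
  next
    case True
    have "(g * h) $$ (i, j) = (\<Sum>a<N. if a = j then g $$ (i, a) else 0)"
      unfolding index_mult_sum[OF c ij(1,2)] using K1_off[OF h _ ij(2)] True ij(3) by (intro sum.cong) auto
    also have "\<dots> = g $$ (i, j)" using ij by simp
    also have "\<dots> = (if i = j then 1 else 0)" using K1_off[OF g ij(1,2)] True ij by blast
    finally show ?thesis .
  qed
  then show ?thesis using K_mult[OF K1_K[OF g] K1_K[OF h]] unfolding K1_def by blast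
qed

lemma K1_inv: assumes g: "g \<in> K1" shows "kinv g \<in> K1"
proof -
  have gc: "g \<in> carrier_mat N N" using g by (auto simp: K1_def K_iff)
  have "kinv g $$ (i, j) = (if i = j then 1 else 0)"
    if ij: "i < N" "j < N" "i \<notin> {m..<m + 3} \<or> j \<notin> {m..<m + 3}" for i j
  proof -
    have "N - 1 - j < N" "N - 1 - i < N" "N - 1 - j \<notin> {m..<m + 3} \<or> N - 1 - i \<notin> {m..<m + 3}" using ij by auto
    then have "g $$ (N - 1 - j, N - 1 - i) = (if N - 1 - j = N - 1 - i then 1 else 0)" by (rule K1_off[OF g])
    moreover have "N - 1 - j = N - 1 - i \<longleftrightarrow> i = j" using ij by auto
    ultimately show ?thesis unfolding kinv_index[OF gc ij(1,2)] by (simp add: star_simps)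
  qed
  then show ?thesis using K_inv[OF K1_K[OF g]] unfolding K1_def by blast
qed

lemma K1_one: "1\<^sub>m N \<in> K1"
  using K_one by (auto simp: K1_def)

lemma K1_mid_row: assumes g: "g \<in> K1" shows "mid_row m g (\<lambda>b. g $$ (m + 2, m + b))"
  using g by (auto simp: mid_row_def K1_def K_iff)

lemma K1_row_isotropic:
  assumes g: "g \<in> K1" shows "form (g $$ (m + 2, m + 0)) (g $$ (m + 2, m + 1)) (g $$ (m + 2, m + 2)) = 0"
proof -
  have gc: "g \<in> carrier_mat N N" and gK: "g \<in> K" using g by (auto simp: K1_def K_iff)
  have i: "m + 2 < N" by simp
  have "g * J * adj star g = J" using unitary_inverse(3)[OF gc] gK by (simp add: K_iff)
  then have "(g * J * adj star g) $$ (m + 2, m + 2) = 0" by (simp add: antidiag_def)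
  moreover have "(g * J * adj star g) $$ (m + 2, m + 2) = (\<Sum>a<N. (g * J) $$ (m + 2, a) * adj star g $$ (a, m + 2))"
    using gc i by (intro index_mult_sum[of _ N N _ N]) (auto intro: square_mult)
  moreover have "\<dots> = (\<Sum>a<N. g $$ (m + 2, N - 1 - a) * star (g $$ (m + 2, a)))"
    unfolding mult_antidiag[OF gc] using i by (intro sum.cong refl) (auto simp: adj_index[OF gc])
  moreover have "\<dots> = (\<Sum>b<3. g $$ (m + 2, m + (2 - b)) * star (g $$ (m + 2, m + b)))"
  proof -
    have z: "g $$ (m + 2, a) = 0" if "a < m \<or> m + 3 \<le> a \<and> a < N" for a
      using K1_off[OF g i, of a] that by auto
    have "N - 1 - (m + b) = m + (2 - b)" if "b < 3" for b using that by auto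
    then show ?thesis unfolding sum_split3 using z by (simp add: star_simps)
  qed
  ultimately show ?thesis unfolding sum_less_3 by (simp add: form_def algebra_simps)
qed

definition emb :: "(nat \<Rightarrow> nat \<Rightarrow> 'a) \<Rightarrow> 'a mat" where
  "emb h = mat N N (\<lambda>(i, j). if i \<in> {m..<m + 3} \<and> j \<in> {m..<m + 3} then h (i - m) (j - m)
     else if i = j then 1 else 0)"

lemma emb_K1:
  assumes int: "\<And>a b. a < 3 \<Longrightarrow> b < 3 \<Longrightarrow> v (h a b) \<le> 1"
    and uni: "\<And>a b. a < 3 \<Longrightarrow> b < 3 \<Longrightarrow> (\<Sum>c<3. star (h (2 - c) a) * h c b) = (if a + b = 2 then 1 else 0)"
  shows "emb h \<in> K1"
proof -
  have gc: "emb h \<in> carrier_mat N N" by (simp add: emb_def)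
  have ac: "adj star (emb h) \<in> carrier_mat N N" by (rule adj_carrier[OF gc])
  have "adj star (emb h) * J * emb h = J"
  proof (rule eq_matI)
    fix i j assume "i < dim_row J" "j < dim_col J"
    then have ij: "i < N" "j < N" by (auto simp: antidiag_def)
    have "(adj star (emb h) * J * emb h) $$ (i, j) = (\<Sum>a<N. (adj star (emb h) * J) $$ (i, a) * emb h $$ (a, j))"
      using ij gc ac by (intro index_mult_sum[of _ N N _ N]) (auto intro: square_mult)
    also have "\<dots> = (\<Sum>a<N. star (emb h $$ (N - 1 - a, i)) * emb h $$ (a, j))"
      unfolding mult_antidiag[OF ac] using ij by (intro sum.cong refl) (auto simp: adj_index[OF gc])
    also have "\<dots> = (\<Sum>a<m. if a = j then (if i + j + 1 = N then 1 else 0) else 0) +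
       (if i \<in> {m..<m + 3} \<and> j \<in> {m..<m + 3} then \<Sum>c<3. star (h (2 - c) (i - m)) * h c (j - m) else 0) +
       (\<Sum>a<m. if a = j - (m + 3) \<and> m + 3 \<le> j then (if i + j + 1 = N then 1 else 0) else 0)"
      unfolding sum_split3
    proof (intro arg_cong2[where f = "(+)"])
      show "(\<Sum>a<m. star (emb h $$ (N - 1 - a, i)) * emb h $$ (a, j)) =
         (\<Sum>a<m. if a = j then (if i + j + 1 = N then 1 else 0) else 0)"
        using ij by (intro sum.cong refl) (auto simp: emb_def star_simps)
      show "(\<Sum>a<m. star (emb h $$ (N - 1 - (m + 3 + a), i)) * emb h $$ (m + 3 + a, j)) =
         (\<Sum>a<m. if a = j - (m + 3) \<and> m + 3 \<le> j then (if i + j + 1 = N then 1 else 0) else 0)"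
        using ij by (intro sum.cong refl) (auto simp: emb_def star_simps)
      have e: "N - 1 - (m + c) = m + (2 - c)" if "c < 3" for c using that by auto
      show "(\<Sum>c<3. star (emb h $$ (N - 1 - (m + c), i)) * emb h $$ (m + c, j)) =
         (if i \<in> {m..<m + 3} \<and> j \<in> {m..<m + 3} then \<Sum>c<3. star (h (2 - c) (i - m)) * h c (j - m) else 0)"
      proof (cases "i \<in> {m..<m + 3} \<and> j \<in> {m..<m + 3}")
        case True
        have "emb h $$ (N - 1 - (m + c), i) = h (2 - c) (i - m)" "emb h $$ (m + c, j) = h c (j - m)" if "c < 3" for c
          unfolding e[OF that] using that True ij by (auto simp: emb_def)
        then show ?thesis using True by simp
      next
        case False
        have "emb h $$ (N - 1 - (m + c), i) = 0 \<or> emb h $$ (m + c, j) = 0" if "c < 3" for c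
          unfolding e[OF that] using that False ij by (auto simp: emb_def)
        then show ?thesis unfolding if_not_P[OF False] by (intro sum.neutral) (auto simp: star_simps)
      qed
    qed
    also have "\<dots> = J $$ (i, j)"
      using ij by (auto simp: uni antidiag_def)
    finally show "(adj star (emb h) * J * emb h) $$ (i, j) = J $$ (i, j)" .
  qed (use carrier_matD[OF ac] carrier_matD[OF gc] in \<open>auto simp: antidiag_def\<close>)
  moreover have "v (emb h $$ (i, j)) \<le> 1" if "i < N" "j < N" for i j
    using that int[of "i - m" "j - m"] by (auto simp: emb_def v_simps)
  ultimately show ?thesis using gc by (auto simp: K1_def K_iff) (auto simp: emb_def)
qed

definition lo :: "'a \<Rightarrow> 'a \<Rightarrow> 'a mat" where
  "lo \<beta> \<gamma> = emb (\<lambda>a b. [[1, 0, 0], [- star \<beta>, 1, 0], [\<gamma>, \<beta>, 1]] ! a ! b)"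

text \<open>This is \<open>lo\<close> with the three middle columns reversed, that is, multiplied by
  the Weyl element. Its last row (1, \<beta>, \<gamma>) reaches the isotropic lines other than that
  of (0, 0, 1).\<close>

definition lo' :: "'a \<Rightarrow> 'a \<Rightarrow> 'a mat" where
  "lo' \<beta> \<gamma> = emb (\<lambda>a b. [[0, 0, 1], [0, 1, - star \<beta>], [1, \<beta>, \<gamma>]] ! a ! b)"

lemma lo_K1:
  assumes "v \<beta> \<le> 1" "v \<gamma> \<le> 1" and t: "\<gamma> + star \<gamma> + \<beta> * star \<beta> = 0"
  shows "lo \<beta> \<gamma> \<in> K1" "lo' \<beta> \<gamma> \<in> K1"
proof -
  have t': "star \<gamma> + (\<gamma> + \<beta> * star \<beta>) = 0" "\<gamma> + (star \<gamma> + \<beta> * star \<beta>) = 0"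
    using t by (simp_all add: algebra_simps)
  show "lo \<beta> \<gamma> \<in> K1" unfolding lo_def
    by (rule emb_K1; drule less_3_cases; drule less_3_cases)
       (use assms t' in \<open>auto simp: sum_less_3 star_simps v_simps algebra_simps\<close>)
  show "lo' \<beta> \<gamma> \<in> K1" unfolding lo'_def
    by (rule emb_K1; drule less_3_cases; drule less_3_cases)
       (use assms t' in \<open>auto simp: sum_less_3 star_simps v_simps algebra_simps\<close>)
qed

lemma lo_row: "lo \<beta> \<gamma> $$ (m + 2, m + 0) = \<gamma>" "lo \<beta> \<gamma> $$ (m + 2, m + 1) = \<beta>" "lo \<beta> \<gamma> $$ (m + 2, m + 2) = 1"
  "lo' \<beta> \<gamma> $$ (m + 2, m + 0) = 1" "lo' \<beta> \<gamma> $$ (m + 2, m + 1) = \<beta>" "lo' \<beta> \<gamma> $$ (m + 2, m + 2) = \<gamma>"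
  by (auto simp: lo_def lo'_def emb_def)

section \<open>Averaging over the compact group\<close>

definition kdist :: "'a mat \<Rightarrow> 'a mat \<Rightarrow> real" where "kdist = mat_dist v N"

lemma kdist_le: "kdist A B \<le> r \<longleftrightarrow> (\<forall>i<N. \<forall>j<N. v (A $$ (i, j) - B $$ (i, j)) \<le> r)"
  unfolding kdist_def mat_dist_def by (rule Max_image_le_iff2) simp

lemma kdist_entry: "i < N \<Longrightarrow> j < N \<Longrightarrow> v (A $$ (i, j) - B $$ (i, j)) \<le> kdist A B"
  using kdist_le[of A B "kdist A B"] by blast

lemma kdist_nonneg: "0 \<le> kdist A B"
  using kdist_entry[of 0 0 A B] v_simps(1) by (meson order_trans zero_less_numeral add_pos_nonneg add_nonneg_pos zero_le)

lemma K_metric: "Metric_space K (mat_dist v (2 * Suc m + 1))"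
  unfolding N_eq kdist_def[symmetric]
proof
  fix A B C
  show "0 \<le> kdist A B" by (rule kdist_nonneg)
  show "kdist A B = kdist B A"
    unfolding kdist_def mat_dist_def by (simp add: v_minus_commute[OF v])
  show "kdist A B = 0 \<longleftrightarrow> A = B" if "A \<in> K" "B \<in> K"
  proof
    assume "kdist A B = 0"
    then have "A $$ (i, j) = B $$ (i, j)" if "i < N" "j < N" for i j
      using kdist_entry[OF that, of A B] v_simps(1,2)[of "A $$ (i, j) - B $$ (i, j)"] by simp
    then show "A = B" using K_carrier[OF that(1)] K_carrier[OF that(2)] by (intro eq_matI) auto
  next
    assume "A = B"
    then have "kdist A B \<le> 0" by (simp add: kdist_le v_simps)
    then show "kdist A B = 0" using kdist_nonneg by (rule antisym)
  qed
  show "kdist A C \<le> kdist A B + kdist B C"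
    unfolding kdist_le
  proof (intro allI impI)
    fix i j assume ij: "i < N" "j < N"
    have "v ((A $$ (i, j) - B $$ (i, j)) + (B $$ (i, j) - C $$ (i, j))) \<le> kdist A B + kdist B C"
      using kdist_entry[OF ij, of A B] kdist_entry[OF ij, of B C] kdist_nonneg[of A B] kdist_nonneg[of B C]
      by (intro v_add_le[OF v]) linarith+
    then show "v (A $$ (i, j) - C $$ (i, j)) \<le> kdist A B + kdist B C" by simp
  qed
qed

lemma openK: "openin (K_topology star v (Suc m)) U \<longleftrightarrow>
    U \<subseteq> K \<and> (\<forall>h\<in>U. \<exists>r>0. \<forall>h'\<in>K. kdist h h' < r \<longrightarrow> h' \<in> U)"
proof -
  have ms: "Metric_space K kdist" using K_metric unfolding N_eq kdist_def .
  show ?thesis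
    unfolding K_topology_def N_eq kdist_def[symmetric] Metric_space.openin_mtopology[OF ms]
      Metric_space.mball_def[OF ms] by blast
qed

lemma space_M: "space M = K" and sets_M: "sets M = sigma_sets K {U. openin (K_topology star v (Suc m)) U}"
  and emeasure_K: "emeasure M K = 1"
  and emeasure_translate: "g \<in> K \<Longrightarrow> A \<in> sets M \<Longrightarrow> emeasure M ((\<lambda>h. g * h) ` A) = emeasure M A"
  using haar by (auto simp: normalized_Haar_def)

lemma finite_M: "finite_measure M"
  by (rule finite_measureI) (simp add: space_M emeasure_K)

lemma open_in_sets: "openin (K_topology star v (Suc m)) U \<Longrightarrow> U \<in> sets M"
  unfolding sets_M by (rule sigma_sets.Basic) simp

lemma lipschitz_measurable:
  fixes f :: "'a mat \<Rightarrow> real"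
  assumes L: "0 \<le> L" "\<And>h h'. h \<in> K \<Longrightarrow> h' \<in> K \<Longrightarrow> \<bar>f h - f h'\<bar> \<le> L * kdist h h'"
  shows "f \<in> borel_measurable M"
proof (rule borel_measurableI)
  fix S :: "real set" assume S: "open S"
  have "openin (K_topology star v (Suc m)) (f -` S \<inter> space M)"
    unfolding openK
  proof (intro conjI ballI)
    fix h assume h: "h \<in> f -` S \<inter> space M"
    then obtain e where e: "e > 0" "\<And>y. dist y (f h) < e \<Longrightarrow> y \<in> S" using S unfolding open_dist by blast
    have "h' \<in> f -` S \<inter> space M" if "h' \<in> K" "kdist h h' < e / (L + 1)" for h'
    proof -
      have "\<bar>f h - f h'\<bar> \<le> L * kdist h h'" using L(2) h that by (simp add: space_M)
      also have "\<dots> \<le> (L + 1) * kdist h h'" using kdist_nonneg by (simp add: distrib_right)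
      also have "\<dots> < e" using that(2) L(1) by (simp add: pos_less_divide_eq mult.commute)
      finally show ?thesis using e(2)[of "f h'"] that by (simp add: dist_real_def abs_minus_commute space_M)
    qed
    then show "\<exists>r>0. \<forall>h'\<in>K. kdist h h' < r \<longrightarrow> h' \<in> f -` S \<inter> space M"
      using e(1) L(1) by (intro exI[of _ "e / (L + 1)"]) auto
  qed (auto simp: space_M)
  then show "f -` S \<inter> space M \<in> sets M" by (rule open_in_sets)
qed

lemma kdist_translate: assumes "g \<in> K" "h \<in> K" "h' \<in> K" shows "kdist (g * h) (g * h') \<le> kdist h h'"
  unfolding kdist_le
proof (intro allI impI)
  fix i j assume ij: "i < N" "j < N"
  note c = K_carrier[OF assms(1)] K_carrier[OF assms(2)] K_carrier[OF assms(3)]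
  have "(g * h) $$ (i, j) - (g * h') $$ (i, j) = (\<Sum>a<N. g $$ (i, a) * (h $$ (a, j) - h' $$ (a, j)))"
    unfolding index_mult_sum[OF c(1,2) ij] index_mult_sum[OF c(1,3) ij]
    by (simp add: sum_subtractf right_diff_distrib)
  also have "v \<dots> \<le> kdist h h'"
  proof (rule v_sum_le[OF v])
    fix a assume "a \<in> {..<N}"
    then have "v (g $$ (i, a)) \<le> 1" "v (h $$ (a, j) - h' $$ (a, j)) \<le> kdist h h'"
      using K_entry[OF assms(1) ij(1)] kdist_entry[of a j h h'] ij by auto
    then show "v (g $$ (i, a) * (h $$ (a, j) - h' $$ (a, j))) \<le> kdist h h'"
      using v_simps(1) mult_left_le_one_le[of "v (h $$ (a, j) - h' $$ (a, j))" "v (g $$ (i, a))"]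
      by (simp add: v_simps(3))
  qed (auto simp: kdist_nonneg)
  finally show "v ((g * h) $$ (i, j) - (g * h') $$ (i, j)) \<le> kdist h h'" .
qed

lemma translate_measurable: assumes g: "g \<in> K" shows "(\<lambda>h. g * h) \<in> measurable M M"
proof (rule measurable_sigma_sets[OF sets_M])
  show "{U. openin (K_topology star v (Suc m)) U} \<subseteq> Pow K" by (auto simp: openK)
  show "(\<lambda>h. g * h) \<in> space M \<rightarrow> K" using K_mult[OF g] by (auto simp: space_M)
  fix U assume "U \<in> {U. openin (K_topology star v (Suc m)) U}"
  then have U: "U \<subseteq> K" "\<And>h. h \<in> U \<Longrightarrow> \<exists>r>0. \<forall>h'\<in>K. kdist h h' < r \<longrightarrow> h' \<in> U" by (auto simp: openK)
  have "openin (K_topology star v (Suc m)) ((\<lambda>h. g * h) -` U \<inter> space M)"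
    unfolding openK
  proof (intro conjI ballI)
    fix h assume "h \<in> (\<lambda>h. g * h) -` U \<inter> space M"
    then have h: "g * h \<in> U" "h \<in> K" by (auto simp: space_M)
    from U(2)[OF h(1)] obtain r where r: "r > 0" "\<And>h'. h' \<in> K \<Longrightarrow> kdist (g * h) h' < r \<Longrightarrow> h' \<in> U" by blast
    have "h' \<in> (\<lambda>h. g * h) -` U \<inter> space M" if "h' \<in> K" "kdist h h' < r" for h'
      using r(2)[OF K_mult[OF g that(1)]] kdist_translate[OF g h(2) that(1)] that by (auto simp: space_M)
    then show "\<exists>r>0. \<forall>h'\<in>K. kdist h h' < r \<longrightarrow> h' \<in> (\<lambda>h. g * h) -` U \<inter> space M" using r(1) by blast
  qed (auto simp: space_M)
  then show "(\<lambda>h. g * h) -` U \<inter> space M \<in> sets M" by (rule open_in_sets)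
qed

text \<open>Invariance is assumed for images of sets under left translation; the preimage under g is
  the image under \<open>kinv g\<close>.\<close>

lemma distr_translate: assumes g: "g \<in> K" shows "distr M M (\<lambda>h. g * h) = M"
proof (rule measure_eqI)
  fix A assume "A \<in> sets (distr M M (\<lambda>h. g * h))"
  then have A: "A \<in> sets M" by simp
  have AK: "A \<subseteq> K" using sets.sets_into_space[OF A] by (simp add: space_M)
  have "(\<lambda>h. g * h) -` A \<inter> space M = (\<lambda>h. kinv g * h) ` A"
  proof (intro equalityI subsetI)
    fix h assume "h \<in> (\<lambda>h. g * h) -` A \<inter> space M"
    then have "g * h \<in> A" "h \<in> K" by (auto simp: space_M)
    then show "h \<in> (\<lambda>h. kinv g * h) ` A" using kinv_cancel(1)[OF g K_carrier] by (metis imageI)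
  next
    fix h assume "h \<in> (\<lambda>h. kinv g * h) ` A"
    then obtain h' where h': "h' \<in> A" "h = kinv g * h'" by blast
    then have "h' \<in> K" using AK by blast
    then show "h \<in> (\<lambda>h. g * h) -` A \<inter> space M"
      using h' kinv_cancel(2)[OF g K_carrier] K_mult[OF K_inv[OF g]] by (simp add: space_M)
  qed
  then show "emeasure (distr M M (\<lambda>h. g * h)) A = emeasure M A"
    using emeasure_distr[OF translate_measurable[OF g] A] emeasure_translate[OF K_inv[OF g] A] by simp
qed simp

lemma integral_translate:
  fixes f :: "'a mat \<Rightarrow> complex"
  assumes g: "g \<in> K" and f: "f \<in> borel_measurable M"
  shows "(LINT h|M. f (g * h)) = (LINT h|M. f h)"
  using integral_distr[OF translate_measurable[OF g] f] by (simp add: distr_translate[OF g])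

lemma bounded_integrable:
  fixes f :: "'a mat \<Rightarrow> complex"
  assumes "f \<in> borel_measurable M" "\<And>h. h \<in> K \<Longrightarrow> norm (f h) \<le> C"
  shows "integrable M f"
  by (rule finite_measure.integrable_const_bound[OF finite_M, of _ C])
     (use assms in \<open>auto simp: space_M intro!: AE_I2\<close>)

text \<open>By left invariance the integral of \<open>f\<close> is the integral of its mean over
  finitely many translates. Applied to elements of \<open>K1\<close> it stands in for integration
  over that subgroup, for which no measure is introduced.\<close>

lemma average:
  fixes f f' :: "'a mat \<Rightarrow> complex"
  assumes I: "finite I" "\<And>i. i \<in> I \<Longrightarrow> g i \<in> K"
    and f: "f \<in> borel_measurable M" "\<And>h. h \<in> K \<Longrightarrow> norm (f h) \<le> C"
    and eq: "\<And>h. h \<in> K \<Longrightarrow> (\<Sum>i\<in>I. f (g i * h)) = c * f' h"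
  shows "of_nat (card I) * (LINT h|M. f h) = c * (LINT h|M. f' h)"
proof -
  have int: "integrable M (\<lambda>h. f (g i * h))" if "i \<in> I" for i
    using f K_mult[OF I(2)[OF that]] measurable_compose[OF translate_measurable[OF I(2)[OF that]] f(1)]
    by (intro bounded_integrable[of _ C]) auto
  have "of_nat (card I) * (LINT h|M. f h) = (\<Sum>i\<in>I. LINT h|M. f (g i * h))"
    using integral_translate[OF I(2) f(1)] by simp
  also have "\<dots> = (LINT h|M. (\<Sum>i\<in>I. f (g i * h)))"
    by (rule Bochner_Integration.integral_sum[symmetric]) (rule int)
  also have "\<dots> = (LINT h|M. c * f' h)"
    by (rule Bochner_Integration.integral_cong) (auto simp: space_M eq)
  finally show ?thesis by simp
qed

section \<open>The minors as functions on the group\<close>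

definition D :: "nat \<Rightarrow> 'a mat \<Rightarrow> real" where "D i h = v (lower_right_minor i (act star h x))"

lemma x_props: "x \<in> carrier_mat N N" "adj star x = x" "adj star x * J * x = J" "mtrace (x * J) = 1"
proof -
  have g: "x \<in> G_grp star (Suc m)" and a: "adj star x = x"
    and c: "char_poly (x * antidiag (2 * Suc m + 1)) = ([:0, 1:]\<^sup>2 - 1) ^ Suc m * ([:0, 1:] - 1)"
    using x by (auto simp: X_space_def)
  from g show xc: "x \<in> carrier_mat N N" "adj star x * J * x = J" by (auto simp: G_iff)
  show "adj star x = x" by (rule a)
  have "x * J \<in> carrier_mat (Suc (2 * Suc m)) (Suc (2 * Suc m))"
    by (rule back_subst[of "\<lambda>a. x * J \<in> carrier_mat a a", OF square_mult[OF xc(1) antidiag_carrier]]) simp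
  from coeff_char_poly_trace[OF this] show "mtrace (x * J) = 1"
    using c coeff_one_lower[of "Suc m", where ?'a = 'a] unfolding N_eq by simp
qed

lemma act_props:
  assumes "h \<in> K"
  shows "act star h x \<in> carrier_mat N N" "adj star (act star h x) = act star h x"
    "act star h x * J * act star h x = J" "mtrace (act star h x * J) = 1"
proof -
  have hc: "h \<in> carrier_mat N N" "adj star h \<in> carrier_mat N N" and hh: "adj star h * J * h = J"
    using assms by (auto simp: K_iff)
  note c = hc x_props(1) antidiag_carrier[of N] square_mult[OF hc(1) x_props(1)]
  note ring = square_assoc(1)[of _ N] square_mult
  show "act star h x \<in> carrier_mat N N" unfolding act_def using c by (intro square_mult)
  show "adj star (act star h x) = act star h x"
    unfolding act_def adj_mult[OF c(5,2)] adj_mult[OF c(1,3)] x_props(2) adj_adj using c by (simp add: ring)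
  have "act star h x * J * act star h x = h * (x * (adj star h * J * h) * x) * adj star h"
    unfolding act_def using c by (simp add: ring)
  also have "\<dots> = h * J * adj star h" unfolding hh using x_props(2,3) by simp
  finally show "act star h x * J * act star h x = J" using unitary_inverse(3)[OF hc(1) hh] by simp
  have "mtrace (act star h x * J) = mtrace (h * (x * (adj star h * J)))"
    unfolding act_def using c by (simp add: ring)
  also have "\<dots> = mtrace (x * (adj star h * J) * h)"
    by (rule mtrace_mult_commute[OF c(1)]) (use c in \<open>intro square_mult\<close>)
  also have "x * (adj star h * J) * h = x * (adj star h * J * h)" using c by (simp add: ring)
  finally show "mtrace (act star h x * J) = 1" unfolding hh by (simp only: x_props(4))
qed

lemma x_bound: obtains C where "1 \<le> C" "\<And>i j. i < N \<Longrightarrow> j < N \<Longrightarrow> v (x $$ (i, j)) \<le> C"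
proof
  let ?S = "\<Sum>(i, j)\<in>{..<N} \<times> {..<N}. v (x $$ (i, j))"
  show "1 \<le> 1 + ?S" using v_simps(1) by (simp add: sum_nonneg split_def)
  show "v (x $$ (i, j)) \<le> 1 + ?S" if "i < N" "j < N" for i j
    using member_le_sum[of "(i, j)" "{..<N} \<times> {..<N}" "\<lambda>(i, j). v (x $$ (i, j))"] that v_simps(1) by auto
qed

text \<open>The entries of h x and of its Hermitian transform are bounded and Lipschitz in h because
  h has integral entries. The same constant serves for both claims: the Lipschitz bound gives
  measurability, the upper bound integrability.\<close>

lemma D_lipschitz:
  assumes i: "i \<le> N"
  obtains L where "0 \<le> L" "\<And>h h'. h \<in> K \<Longrightarrow> h' \<in> K \<Longrightarrow> \<bar>D i h - D i h'\<bar> \<le> L * kdist h h'"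
    "\<And>h. h \<in> K \<Longrightarrow> D i h \<le> L"
proof -
  obtain C where C: "1 \<le> C" "\<And>i j. i < N \<Longrightarrow> j < N \<Longrightarrow> v (x $$ (i, j)) \<le> C" using x_bound by blast
  have C0: "0 \<le> C" using C(1) by simp
  have half: "v (\<Sum>a<N. z a * x $$ (a, b)) \<le> C * e" if "\<And>a. a < N \<Longrightarrow> v (z a) \<le> e" "b < N" "0 \<le> e" for z b e
    using C that C0 v_simps(1) by (intro v_sum_le[OF v]) (auto simp: v_simps(3) mult.commute[of C] intro!: mult_mono)
  have ent: "v (act star h x $$ (i, j)) \<le> C" if "h \<in> K" "i < N" "j < N" for h i j
    unfolding act_index[OF K_carrier[OF that(1)] x_props(1) that(2,3)]
  proof (rule v_sum_le[OF v])
    fix b assume b: "b \<in> {..<N}"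
    have "v (\<Sum>a<N. h $$ (i, a) * x $$ (a, b)) \<le> C * 1" using b by (intro half K_entry that) auto
    moreover have "v (star (h $$ (j, b))) \<le> 1" using b K_entry[OF that(1,3)] by simp
    ultimately show "v ((\<Sum>a<N. h $$ (i, a) * x $$ (a, b)) * star (h $$ (j, b))) \<le> C"
      using mult_mono[of _ "C * 1" _ 1] v_simps(1) C0 by (simp add: v_simps(3)) 
  qed (use C0 in auto)
  have dif: "v (act star h x $$ (i, j) - act star h' x $$ (i, j)) \<le> C * kdist h h'"
    if hh: "h \<in> K" "h' \<in> K" and ij: "i < N" "j < N" for h h' i j
  proof -
    have "act star h x $$ (i, j) - act star h' x $$ (i, j) =
       (\<Sum>b<N. (\<Sum>a<N. (h $$ (i, a) - h' $$ (i, a)) * x $$ (a, b)) * star (h $$ (j, b)) +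
         (\<Sum>a<N. h' $$ (i, a) * x $$ (a, b)) * star (h $$ (j, b) - h' $$ (j, b)))"
      unfolding act_index[OF K_carrier[OF hh(1)] x_props(1) ij] act_index[OF K_carrier[OF hh(2)] x_props(1) ij]
        sum_subtractf[symmetric] left_diff_distrib star_simps(4)
      by (intro sum.cong refl) (simp add: sum_subtractf left_diff_distrib right_diff_distrib)
    also have "v \<dots> \<le> C * kdist h h'"
    proof (rule v_sum_le[OF v], simp, rule v_add_le[OF v])
      fix b assume b: "b \<in> {..<N}"
      have "v (\<Sum>a<N. (h $$ (i, a) - h' $$ (i, a)) * x $$ (a, b)) \<le> C * kdist h h'"
        using b ij kdist_nonneg by (intro half kdist_entry) auto
      moreover have "v (star (h $$ (j, b))) \<le> 1" using b K_entry[OF hh(1) ij(2)] by simp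
      ultimately show "v ((\<Sum>a<N. (h $$ (i, a) - h' $$ (i, a)) * x $$ (a, b)) * star (h $$ (j, b))) \<le> C * kdist h h'"
        using mult_mono[of _ "C * kdist h h'" _ 1] v_simps(1) C0 kdist_nonneg[of h h'] by (simp add: v_simps(3))
      have "v (\<Sum>a<N. h' $$ (i, a) * x $$ (a, b)) \<le> C * 1" using b by (intro half K_entry hh ij) auto
      moreover have "v (star (h $$ (j, b) - h' $$ (j, b))) \<le> kdist h h'" using b kdist_entry[OF ij(2)] by simp
      ultimately show "v ((\<Sum>a<N. h' $$ (i, a) * x $$ (a, b)) * star (h $$ (j, b) - h' $$ (j, b))) \<le> C * kdist h h'"
        unfolding v_simps(3) using v_simps(1) C0 by (intro mult_mono) auto
    qed (use C0 kdist_nonneg in simp)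
    finally show ?thesis .
  qed
  define B where "B h = mat i i (\<lambda>(a, b). act star h x $$ (N - i + a, N - i + b))" for h
  have Dd: "D i h = v (Determinant.det (B h))" if "h \<in> K" for h
    using carrier_matD[OF act_props(1)[OF that]] by (simp only: D_def lower_right_minor_def B_def)
  have det: "v (Determinant.det (B h) - Determinant.det (B h')) \<le> C ^ i * kdist h h'" "v (Determinant.det (B h)) \<le> C ^ i"
    if "h \<in> K" "h' \<in> K" for h h'
  proof -
    have "v (B h $$ (a, b)) \<le> C" "v (B h' $$ (a, b)) \<le> C" "v (B h $$ (a, b) - B h' $$ (a, b)) \<le> C * kdist h h'"
      if "a < i" "b < i" for a b
      using that i ent[OF \<open>h \<in> K\<close>, of "N - i + a" "N - i + b"] ent[OF \<open>h' \<in> K\<close>, of "N - i + a" "N - i + b"]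
        dif[OF \<open>h \<in> K\<close> \<open>h' \<in> K\<close>, of "N - i + a" "N - i + b"] by (simp_all add: B_def)
    from v_det_diff_le[OF _ _ this C(1) kdist_nonneg] show
      "v (Determinant.det (B h) - Determinant.det (B h')) \<le> C ^ i * kdist h h'" "v (Determinant.det (B h)) \<le> C ^ i"
      by (auto simp: B_def)
  qed
  have abs: "\<bar>v a - v b\<bar> \<le> v (a - b)" for a b
    using v_add_le[OF v, of "a - b" "v (a - b) + v b" b] v_add_le[OF v, of "b - a" "v (a - b) + v a" a]
      v_simps(1)[of "a - b"] v_simps(1)[of a] v_simps(1)[of b] v_minus_commute[OF v, of a b] by auto
  show ?thesis
  proof (rule that[of "C ^ i"])
    show "0 \<le> C ^ i" using C0 by simp
    show "\<bar>D i h - D i h'\<bar> \<le> C ^ i * kdist h h'" if "h \<in> K" "h' \<in> K" for h h'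
      unfolding Dd[OF that(1)] Dd[OF that(2)] using abs det(1)[OF that] by (rule order_trans)
    show "D i h \<le> C ^ i" if "h \<in> K" for h unfolding Dd[OF that] by (rule det(2)[OF that that])
  qed
qed

lemma D_measurable: "i \<le> N \<Longrightarrow> D i \<in> borel_measurable M"
  by (rule D_lipschitz) (auto intro: lipschitz_measurable)

lemma D_nonneg: "0 \<le> D i h"
  by (simp add: D_def v_simps)

lemma D_zero: "D 0 h = 1"
  by (simp add: D_def lower_right_minor_def v_simps)

lemma D_K1: assumes "g \<in> K1" "h \<in> K" "i \<le> m" shows "D i (g * h) = D i h"
  unfolding D_def act_mult[OF K_carrier[OF K1_K[OF assms(1)]] K_carrier[OF assms(2)] x_props(1)]
    lower_right_minor_mid_row[OF K1_mid_row[OF assms(1)] act_props(1)[OF assms(2)] assms(3)] ..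

definition dot :: "'a mat \<Rightarrow> 'a \<Rightarrow> 'a \<Rightarrow> 'a \<Rightarrow> 'a" where
  "dot g w1 w2 w3 = g $$ (m + 2, m + 0) * w1 + g $$ (m + 2, m + 1) * w2 + g $$ (m + 2, m + 2) * w3"

lemma minor_vector:
  assumes h: "h \<in> K" and D: "D m h \<noteq> 0"
  obtains w1 w2 w3 l where "primitive w1 w2 w3" "v (form w1 w2 w3) = v \<pi> ^ l"
    "\<And>g. g \<in> K1 \<Longrightarrow> D (Suc m) (g * h) = D m h * v (dot g w1 w2 w3) ^ 2 / v \<pi> ^ l"
proof -
  note y = act_props[OF h]
  have "lower_right_minor m (act star h x) \<noteq> 0" using D by (auto simp: D_def v_simps)
  from lower_right_minor_hermitian_involution[OF y this] obtain w1 w2 w3 where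
    w: "primitive w1 w2 w3" "form w1 w2 w3 \<noteq> 0" and *: "\<And>g r. mid_row m g r \<Longrightarrow> form (r 0) (r 1) (r 2) = 0 \<Longrightarrow>
       lower_right_minor (Suc m) (act star g (act star h x)) =
       - 2 * lower_right_minor m (act star h x) * ((r 0 * w1 + r 1 * w2 + r 2 * w3) * star (r 0 * w1 + r 1 * w2 + r 2 * w3))
         / form w1 w2 w3" by blast
  have w': "v w1 \<le> 1" "v w2 \<le> 1" "v w3 \<le> 1" using w(1) by (auto simp: primitive_def)
  have "v (form w1 w2 w3) \<le> 1"
    unfolding form_def using w' v_simps(1)
    by (intro v_add_le[OF v]) (auto simp: v_simps(3) intro!: mult_le_one)
  obtain a where a: "v (form w1 w2 w3) = v \<pi> powi a" using w(2) v_discrete by blast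
  have "a \<ge> 0"
  proof (rule ccontr)
    assume "\<not> a \<ge> 0"
    then have "v \<pi> powi a > 1" using pi_props(1) one_less_inverse[OF _ pi_pow_less_one[of "nat (- a)"]]
      by (simp add: power_int_def power_inverse)
    then show False using a \<open>v (form w1 w2 w3) \<le> 1\<close> by simp
  qed
  then have l: "v (form w1 w2 w3) = v \<pi> ^ nat a" using a by (simp add: power_int_def)
  show ?thesis
  proof (rule that[OF w(1) l])
    fix g assume g: "g \<in> K1"
    show "D (Suc m) (g * h) = D m h * v (dot g w1 w2 w3) ^ 2 / v \<pi> ^ nat a"
      unfolding D_def act_mult[OF K_carrier[OF K1_K[OF g]] K_carrier[OF h] x_props(1)]
        *[OF K1_mid_row[OF g] K1_row_isotropic[OF g]] dot_def[symmetric]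
      by (simp only: v_simps(3,6,8) v_norm v_two l mult_1 v_star) (simp add: power2_eq_square)
  qed
qed

end

section \<open>The generating function\<close>

text \<open>\<open>tail_prob\<close> at B = c + 1 without its powers of q. The product of
  \<open>rho l (Suc c)\<close>, q^2 and the weight at c is the weight at c + 1: the values 1/q and
  1/q^3 of \<open>rho\<close> alternate and produce 1, q, 1, q, and so on up to l.\<close>

definition tail_wt :: "nat \<Rightarrow> nat \<Rightarrow> nat \<Rightarrow> complex" where
  "tail_wt q l c = (if c < l then (if even c then 1 else of_nat q) else if even l then of_nat q + 1 else 0)"

text \<open>\<open>tail_prob q l B\<close> is the probability that the last row \<open>r\<close> of a random element of the middle
  unitary group satisfies \<open>\<bar>r \<cdot> w\<bar> \<le> q\<^sup>-\<^sup>B\<close>, for a primitive vector \<open>w\<close> with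
  \<open>\<bar>\<langle>w, w\<rangle>\<bar> = q\<^sup>-\<^sup>l\<close>.\<close>

definition tail_prob :: "nat \<Rightarrow> nat \<Rightarrow> nat \<Rightarrow> complex" where
  "tail_prob q l B = (case B of 0 \<Rightarrow> 1 | Suc c \<Rightarrow> tail_wt q l c / (of_nat q ^ (2 * c) * (of_nat q ^ 3 + 1)))"

text \<open>Closed form of the sum over b of X^b times the probability of |r w| = q^(-b), written in
  Y = X/q^2, the variable that \<open>tau\<close> inverts.\<close>

definition gen_fun :: "nat \<Rightarrow> nat \<Rightarrow> complex \<Rightarrow> complex" where
  "gen_fun q l Y = (of_nat q + Y) * ((of_nat q ^ 2 - Y) - (1 - of_nat q ^ 2 * Y) * (- Y) ^ l) /
     ((1 - Y\<^sup>2) * (of_nat q ^ 3 + 1))"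

text \<open>From l to l + 1 the weights change only at c >= l: by q at c = l and by q + 1 beyond,
  both with the sign (-1)^(l+1). Adding this geometric series is the induction step.\<close>

lemma tail_wt_sums:
  assumes Y: "norm Y < 1"
  shows "(\<lambda>c. tail_wt q l c * Y ^ c) sums (((1 + of_nat q * Y) + (of_nat q + Y) * (- Y) ^ l) / (1 - Y\<^sup>2))"
proof -
  have Y1: "1 - Y \<noteq> 0" using Y by force
  have Y2: "1 + Y \<noteq> 0" using Y by (metis add_eq_0_iff norm_minus_cancel norm_one order_less_irrefl)
  have YY: "1 - Y\<^sup>2 = (1 - Y) * (1 + Y)" by (simp add: power2_eq_square algebra_simps)
  show ?thesis
  proof (induction l)
    case 0
    have "(\<lambda>c. (of_nat q + 1) * Y ^ c) sums ((of_nat q + 1) * (1 / (1 - Y)))"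
      by (intro sums_mult geometric_sums Y)
    moreover have "(of_nat q + 1) * (1 / (1 - Y)) = ((1 + of_nat q * Y) + (of_nat q + Y)) / (1 - Y\<^sup>2)"
      unfolding YY using Y1 Y2 by (simp add: divide_simps) (simp add: algebra_simps)
    ultimately show ?case by (simp add: tail_wt_def)
  next
    case (Suc l)
    have "(\<lambda>c. (of_nat q + 1) * Y ^ c * Y ^ Suc l) sums ((of_nat q + 1) * (1 / (1 - Y)) * Y ^ Suc l)"
      by (intro sums_mult sums_mult2 geometric_sums Y)
    then have "(\<lambda>c. (of_nat q + 1) * Y ^ (c + Suc l)) sums ((of_nat q + 1) * (1 / (1 - Y)) * Y ^ Suc l)"
      by (simp add: power_add mult_ac)
    then have "(\<lambda>c. if c < Suc l then 0 else (of_nat q + 1) * Y ^ c) sums ((of_nat q + 1) * (1 / (1 - Y)) * Y ^ Suc l)"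
      by (subst sums_zero_iff_shift[symmetric, of "Suc l"]) auto
    moreover have "(\<lambda>c. if c = l then of_nat q * Y ^ l else 0) sums (of_nat q * Y ^ l)"
      by (rule sums_single)
    ultimately have "(\<lambda>c. (-1) ^ Suc l * ((if c = l then of_nat q * Y ^ l else 0) +
        (if c < Suc l then 0 else (of_nat q + 1) * Y ^ c))) sums
        ((-1) ^ Suc l * (of_nat q * Y ^ l + (of_nat q + 1) * (1 / (1 - Y)) * Y ^ Suc l))"
      by (intro sums_mult sums_add)
    from sums_add[OF Suc this] have "(\<lambda>c. tail_wt q (Suc l) c * Y ^ c) sums
       (((1 + of_nat q * Y) + (of_nat q + Y) * (- Y) ^ l) / (1 - Y\<^sup>2) +
        (-1) ^ Suc l * (of_nat q * Y ^ l + (of_nat q + 1) * (1 / (1 - Y)) * Y ^ Suc l))"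
      by (rule sums_cong[THEN iffD1, rotated]) (auto simp: tail_wt_def less_Suc_eq algebra_simps)
    moreover have "((1 + of_nat q * Y) + (of_nat q + Y) * (- Y) ^ l) / (1 - Y\<^sup>2) +
        (-1) ^ Suc l * (of_nat q * Y ^ l + (of_nat q + 1) * (1 / (1 - Y)) * Y ^ Suc l) =
        ((1 + of_nat q * Y) + (of_nat q + Y) * (- Y) ^ Suc l) / (1 - Y\<^sup>2)"
    proof -
      have p: "(- Y) ^ l = (-1) ^ l * Y ^ l" by (metis power_minus)
      have "of_nat q * Y ^ l + (of_nat q + 1) * (1 / (1 - Y)) * Y ^ Suc l = (of_nat q + Y) * Y ^ l / (1 - Y)"
        using Y1 by (simp add: divide_simps) (simp add: algebra_simps)
      then show ?thesis unfolding YY using Y1 Y2 by (simp add: p divide_simps) (simp add: algebra_simps)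
    qed
    ultimately show ?case by simp
  qed
qed

text \<open>Partial summation passes from tails to point probabilities, and X = q^2 Y absorbs the
  powers q^(2c) in the denominators of \<open>tail_prob\<close>.\<close>

lemma tail_prob_sums:
  assumes X: "norm X \<le> 1" and q: "q \<ge> 2"
  shows "(\<lambda>b. (tail_prob q l b - tail_prob q l (Suc b)) * X ^ b) sums gen_fun q l (X / of_nat q ^ 2)"
proof -
  define Q where "Q = (of_nat q :: complex)"
  define Y where "Y = X / Q ^ 2"
  have nQ: "norm Q = real q" by (simp add: Q_def)
  have Q0: "Q \<noteq> 0" "Q ^ 3 + 1 \<noteq> 0"
  proof -
    show "Q \<noteq> 0" using q by (simp add: Q_def)
    have "Q ^ 3 + 1 = of_nat (q ^ 3 + 1)" by (simp add: Q_def)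
    then show "Q ^ 3 + 1 \<noteq> 0" by (metis add_eq_0_iff_both_eq_0 of_nat_eq_0_iff zero_neq_one)
  qed
  have "1 < real q ^ 2" using q by (simp add: one_less_power)
  then have nY: "norm Y < 1" using X by (simp add: Y_def norm_divide norm_power nQ divide_less_eq)
  have Y2: "1 - Y\<^sup>2 \<noteq> 0"
  proof
    assume "1 - Y\<^sup>2 = 0"
    then have "norm (Y\<^sup>2) = 1" by simp
    moreover have "norm (Y\<^sup>2) < 1" using nY by (simp add: norm_power power_less_one_iff)
    ultimately show False by simp
  qed
  have XY: "X = Q ^ 2 * Y" using Q0 by (simp add: Y_def)
  let ?S = "((1 + Q * Y) + (Q + Y) * (- Y) ^ l) / (1 - Y\<^sup>2)"
  have "(\<lambda>c. tail_wt q l c * Y ^ c / (Q ^ 3 + 1)) sums (?S / (Q ^ 3 + 1))"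
    unfolding Q_def by (intro sums_divide tail_wt_sums nY)
  moreover have "tail_wt q l c * Y ^ c / (Q ^ 3 + 1) = tail_prob q l (Suc c) * X ^ c" for c
    using Q0 by (simp add: tail_prob_def XY power_mult_distrib power_mult flip: Q_def)
  ultimately have s: "(\<lambda>c. tail_prob q l (Suc c) * X ^ c) sums (?S / (Q ^ 3 + 1))" by simp
  then have "(\<lambda>c. tail_prob q l (Suc c) * X ^ Suc c) sums (X * (?S / (Q ^ 3 + 1)))"
    using sums_mult[OF s, of X] by (simp add: mult_ac)
  then have "(\<lambda>c. tail_prob q l c * X ^ c) sums (X * (?S / (Q ^ 3 + 1)) + tail_prob q l 0 * X ^ 0)"
    by (subst (asm) sums_Suc_iff) simp
  from sums_diff[OF this s] have "(\<lambda>b. (tail_prob q l b - tail_prob q l (Suc b)) * X ^ b) sums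
     (X * (?S / (Q ^ 3 + 1)) + 1 - ?S / (Q ^ 3 + 1))"
    by (simp add: left_diff_distrib tail_prob_def)
  moreover have "X * (?S / (Q ^ 3 + 1)) + 1 - ?S / (Q ^ 3 + 1) = gen_fun q l Y"
  proof -
    have "X * (?S / (Q ^ 3 + 1)) + 1 - ?S / (Q ^ 3 + 1) = ((Q ^ 3 + 1) - (1 - X) * ?S) / (Q ^ 3 + 1)"
    proof -
      have "X * (S / R) + 1 - S / R = (R - (1 - X) * S) / R" if "R \<noteq> 0" for S R :: complex
        using that by (simp add: field_simps)
      from this[OF Q0(2)] show ?thesis .
    qed
    also have "(Q ^ 3 + 1) - (1 - X) * ?S =
       ((Q ^ 3 + 1) * (1 - Y\<^sup>2) - (1 - Q\<^sup>2 * Y) * ((1 + Q * Y) + (Q + Y) * (- Y) ^ l)) / (1 - Y\<^sup>2)"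
    proof -
      have "R - c * (A / E) = (R * E - c * A) / E" if "E \<noteq> 0" for R c A E :: complex
        using that by (simp add: field_simps)
      from this[OF Y2] show ?thesis unfolding XY .
    qed
    also have "(Q ^ 3 + 1) * (1 - Y\<^sup>2) - (1 - Q\<^sup>2 * Y) * ((1 + Q * Y) + (Q + Y) * (- Y) ^ l) =
       (Q + Y) * ((Q\<^sup>2 - Y) - (1 - Q\<^sup>2 * Y) * (- Y) ^ l)"
      by (simp add: power2_eq_square power3_eq_cube algebra_simps)
    finally show ?thesis by (simp add: gen_fun_def Q_def)
  qed
  ultimately show ?thesis by (simp add: Y_def Q_def)
qed

text \<open>Dominated convergence with |f| as majorant. The cells cover the support of f only,
  because the decompositions below leave out points where some minor vanishes.\<close>

lemma (in finite_measure) integral_partition_sums: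
  fixes f :: "'a \<Rightarrow> complex"
  assumes f: "integrable M f" and S: "\<And>i. S i \<in> sets M" "disjoint_family S"
    and cover: "\<And>h. h \<in> space M \<Longrightarrow> f h \<noteq> 0 \<Longrightarrow> \<exists>i. h \<in> S i"
  shows "(\<lambda>i::nat. LINT h|M. (if h \<in> S i then f h else 0)) sums (LINT h|M. f h)"
proof -
  have part: "(\<Sum>i<n. if h \<in> S i then f h else 0) = (if \<exists>i<n. h \<in> S i then f h else 0)" for n h
  proof (cases "\<exists>i<n. h \<in> S i")
    case True
    then obtain j where j: "j < n" "h \<in> S j" by blast
    then have "(h \<in> S i) = (i = j)" for i using S(2) by (auto simp: disjoint_family_on_def)
    then show ?thesis using j by auto
  qed auto
  have meas: "(\<lambda>h. if h \<in> S i then f h else 0) \<in> borel_measurable M" for i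
    using f S(1)[of i] by (intro measurable_If_set) auto
  have int: "integrable M (\<lambda>h. if h \<in> S i then f h else 0)" for i
    by (rule Bochner_Integration.integrable_bound[OF f meas]) auto
  have lim: "(\<lambda>n. LINT h|M. (\<Sum>i<n. if h \<in> S i then f h else 0)) \<longlonglongrightarrow> (LINT h|M. f h)"
  proof (rule integral_dominated_convergence[where w = "\<lambda>h. norm (f h)"])
    show "AE h in M. (\<lambda>n. \<Sum>i<n. if h \<in> S i then f h else 0) \<longlonglongrightarrow> f h"
    proof (rule AE_I2)
      fix h assume h: "h \<in> space M"
      show "(\<lambda>n. \<Sum>i<n. if h \<in> S i then f h else 0) \<longlonglongrightarrow> f h"
      proof (cases "f h = 0")
        case True
        then have "(\<Sum>i<n. if h \<in> S i then f h else 0) = 0" for n unfolding part by simp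
        then show ?thesis using True by simp
      next
        case False
        then obtain i where i: "h \<in> S i" using cover h by blast
        have "(\<Sum>j<n. if h \<in> S j then f h else 0) = f h" if "n \<ge> Suc i" for n
          unfolding part using i that by auto
        then show ?thesis by (intro tendsto_eventually) (auto simp: eventually_sequentially)
      qed
    qed
    show "AE h in M. norm (\<Sum>i<n. if h \<in> S i then f h else 0) \<le> norm (f h)" for n
      unfolding part by auto
    show "(\<lambda>h. \<Sum>i<n. if h \<in> S i then f h else 0) \<in> borel_measurable M" for n
      using meas by (intro borel_measurable_sum)
  qed (use f in auto)
  have "(LINT h|M. (\<Sum>i<n. if h \<in> S i then f h else 0)) = (\<Sum>i<n. LINT h|M. (if h \<in> S i then f h else 0))" for n
    by (rule Bochner_Integration.integral_sum) (rule int)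
  then show ?thesis using lim by (simp add: sums_def)
qed

context haar_setup
begin

section \<open>Decomposition of K by the size of d_m and of the form at the reflection
  vector\<close>

abbreviation ep :: real where "ep \<equiv> v \<pi>"

lemma ep_powi_le: "ep powi a \<le> ep powi b \<longleftrightarrow> b \<le> a"
proof -
  have *: "ep powi a < ep powi b" if "b < a" for a b
    using power_int_strict_decreasing[OF that pi_props(1,2)] .
  show ?thesis
  proof
    assume "ep powi a \<le> ep powi b"
    then show "b \<le> a" using *[where a = b and b = a] by linarith
  next
    assume "b \<le> a"
    then show "ep powi a \<le> ep powi b" using *[where a = a and b = b] by (cases "b = a") auto
  qed
qed

lemma ep_powi_inj: "ep powi a = ep powi b \<longleftrightarrow> a = b"
proof
  assume "ep powi a = ep powi b"
  then have "ep powi a \<le> ep powi b" "ep powi b \<le> ep powi a" by simp_all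
  then show "a = b" unfolding ep_powi_le by simp
qed simp

lemma ep_powi_add: "ep powi (a + b) = ep powi a * ep powi b"
  by (rule power_int_add) (simp add: pi_props(3) v_simps(2))

lemma dot_one: "dot (1\<^sub>m N) w1 w2 w3 = w3"
  by (simp add: dot_def)

lemma dot_lo: "dot (lo \<beta> \<gamma>) w1 w2 w3 = w3 + \<beta> * w2 + \<gamma> * w1" "dot (lo' \<beta> \<gamma>) w1 w2 w3 = w1 + \<beta> * w2 + \<gamma> * w3"
  unfolding dot_def lo_row by simp_all

lemma dot_le:
  assumes "primitive w1 w2 w3" "g \<in> K1"
  shows "v (dot g w1 w2 w3) \<le> 1"
  unfolding dot_def
proof (intro v_add_le[OF v])
  have e: "v (g $$ (m + 2, m + b)) \<le> 1" if "b < 3" for b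
    using that by (intro K_entry[OF K1_K[OF assms(2)]]) auto
  show "v (g $$ (m + 2, m + 0) * w1) \<le> 1" "v (g $$ (m + 2, m + 1) * w2) \<le> 1" "v (g $$ (m + 2, m + 2) * w3) \<le> 1"
    using e[of 0] e[of 1] e[of 2] assms(1) v_simps(1) by (auto simp: v_simps(3) primitive_def intro!: mult_le_one)
qed

lemma dot_unit:
  assumes w: "primitive w1 w2 w3"
  shows "\<exists>g\<in>K1. v (dot g w1 w2 w3) = 1"
proof (cases "v w1 = 1 \<or> v w3 = 1")
  case True
  have "lo' 0 0 \<in> K1" by (rule lo_K1) (auto simp: v_simps star_simps)
  moreover have "dot (lo' 0 0) w1 w2 w3 = w1" unfolding dot_lo by simp
  ultimately show ?thesis using True K1_one dot_one[of w1 w2 w3] by metis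
next
  case False
  then have w2: "v w2 = 1" "v w1 < 1" "v w3 < 1" using w by (auto simp: primitive_def)
  \<comment> \<open>With \<beta> = 1 unitarity asks for \<gamma> of trace -1, whence -1/2. In the
    resulting combination of coordinates the unit w2 dominates.\<close>
  have "lo' 1 (- 1 / 2) \<in> K1"
    by (rule lo_K1) (auto simp: v_simps v_two star_simps)
  moreover have "v (w1 + 1 * w2 + (- 1 / 2) * w3) = 1"
  proof -
    have "v ((- 1 / 2) * w3) < 1" using w2 by (simp add: v_simps v_two)
    then have "v (w1 + (- 1 / 2) * w3) < 1" using w2(2) by (intro v_add_less[OF v])
    then have "v ((w1 + (- 1 / 2) * w3) + w2) = 1" using v_add_eq[OF v, of "w1 + (- 1 / 2) * w3" w2] w2(1) by simp
    moreover have "(w1 + (- 1 / 2) * w3) + w2 = w1 + 1 * w2 + (- 1 / 2) * w3" by simp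
    ultimately show ?thesis by metis
  qed
  ultimately show ?thesis unfolding dot_lo(2)[symmetric] by blast
qed

text \<open>\<open>norm_class a l\<close> is the set where \<open>\<bar>d\<^sub>m\<bar> = q\<^sup>-\<^sup>a\<close> and the reflection vector \<open>w\<close> has
  \<open>\<bar>\<langle>w, w\<rangle>\<bar> = q\<^sup>-\<^sup>l\<close>. In place of a measurable choice of \<open>w\<close> it is described by the largest value
  of \<open>\<bar>d\<^sub>m\<^sub>+\<^sub>1\<bar>\<close> on the orbit, which is an open condition.\<close>

definition orbit_reaches :: "'a mat \<Rightarrow> real \<Rightarrow> bool" where
  "orbit_reaches h e \<longleftrightarrow> (\<exists>g\<in>K1. e \<le> D (Suc m) (g * h))"

definition norm_class :: "int \<Rightarrow> nat \<Rightarrow> 'a mat set" where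
  "norm_class a l = {h \<in> K. (\<forall>i\<in>{1..m}. D i h \<noteq> 0) \<and> D m h = ep powi a \<and>
     orbit_reaches h (ep powi (a - int l)) \<and> \<not> orbit_reaches h (ep powi (a - int l - 1))}"

lemma orbit_reaches_iff:
  assumes w: "primitive w1 w2 w3" and D: "\<And>g. g \<in> K1 \<Longrightarrow> D (Suc m) (g * h) = E * v (dot g w1 w2 w3) ^ 2"
    and E: "0 \<le> E"
  shows "orbit_reaches h e \<longleftrightarrow> e \<le> E"
proof
  assume "orbit_reaches h e"
  then obtain g where g: "g \<in> K1" "e \<le> E * v (dot g w1 w2 w3) ^ 2" using D by (auto simp: orbit_reaches_def)
  have "v (dot g w1 w2 w3) ^ 2 \<le> 1" using dot_le[OF w g(1)] v_simps(1) by (simp add: power_le_one)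
  then have "E * v (dot g w1 w2 w3) ^ 2 \<le> E" using E by (simp add: mult_left_le)
  with g show "e \<le> E" by simp
next
  assume "e \<le> E"
  obtain g where g: "g \<in> K1" "v (dot g w1 w2 w3) = 1" using dot_unit[OF w] by blast
  then have "D (Suc m) (g * h) = E" using D[OF g(1)] by simp
  then show "orbit_reaches h e" using g(1) \<open>e \<le> E\<close> by (auto simp: orbit_reaches_def)
qed

definition refl_vec :: "'a mat \<Rightarrow> int \<Rightarrow> nat \<Rightarrow> 'a \<Rightarrow> 'a \<Rightarrow> 'a \<Rightarrow> bool" where
  "refl_vec h a l w1 w2 w3 \<longleftrightarrow> primitive w1 w2 w3 \<and> v (form w1 w2 w3) = ep ^ l \<and>
     (\<forall>g\<in>K1. D (Suc m) (g * h) = ep powi (a - int l) * v (dot g w1 w2 w3) ^ 2)"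

lemma refl_vec_top: "refl_vec h a l w1 w2 w3 \<Longrightarrow> orbit_reaches h e \<longleftrightarrow> e \<le> ep powi (a - int l)"
  unfolding refl_vec_def using pi_props(1) by (intro orbit_reaches_iff[of w1 w2 w3]) (auto intro: less_imp_le)

lemma good_vector:
  assumes h: "h \<in> K" and nz: "\<forall>i\<in>{1..m}. D i h \<noteq> 0" and a: "D m h = ep powi a"
  shows "\<exists>l w1 w2 w3. h \<in> norm_class a l \<and> refl_vec h a l w1 w2 w3"
proof -
  have "D m h \<noteq> 0" using a pi_props(1) by simp
  then have "\<exists>l w1 w2 w3. refl_vec h a l w1 w2 w3"
  proof (rule minor_vector[OF h])
    fix w1 w2 w3 l assume w: "primitive w1 w2 w3" "v (form w1 w2 w3) = ep ^ l"
      and D: "\<And>g. g \<in> K1 \<Longrightarrow> D (Suc m) (g * h) = D m h * v (dot g w1 w2 w3) ^ 2 / ep ^ l"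
    have "D (Suc m) (g * h) = ep powi (a - int l) * v (dot g w1 w2 w3) ^ 2" if "g \<in> K1" for g
      unfolding D[OF that] a using pi_props(1) by (simp add: power_int_diff)
    then show "\<exists>l w1 w2 w3. refl_vec h a l w1 w2 w3" using w unfolding refl_vec_def by blast
  qed
  then obtain l w1 w2 w3 where w: "refl_vec h a l w1 w2 w3" by blast
  then have "h \<in> norm_class a l" using h nz a by (simp add: norm_class_def refl_vec_top[OF w] ep_powi_le)
  then show ?thesis using w by blast
qed

lemma norm_class_vector:
  assumes "h \<in> norm_class a l"
  shows "\<exists>w1 w2 w3. refl_vec h a l w1 w2 w3"
proof -
  have h: "h \<in> K" "\<forall>i\<in>{1..m}. D i h \<noteq> 0" "D m h = ep powi a" "orbit_reaches h (ep powi (a - int l))"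
    "\<not> orbit_reaches h (ep powi (a - int l - 1))" using assms by (auto simp: norm_class_def)
  from good_vector[OF h(1-3)] obtain l' w1 w2 w3 where w: "refl_vec h a l' w1 w2 w3" by blast
  then have "l' = l" using h(4,5) by (simp add: refl_vec_top[OF w] ep_powi_le)
  then show ?thesis using w by blast
qed

lemma norm_class_disjoint: "h \<in> norm_class a l \<Longrightarrow> h \<in> norm_class a' l' \<Longrightarrow> a = a' \<and> l = l'"
proof -
  assume h: "h \<in> norm_class a l" "h \<in> norm_class a' l'"
  then have a: "a = a'" by (simp add: norm_class_def ep_powi_inj)
  from norm_class_vector[OF h(1)] obtain w1 w2 w3 where w: "refl_vec h a l w1 w2 w3" by blast
  then show ?thesis using h(2) a by (auto simp: norm_class_def refl_vec_top[OF w] ep_powi_le)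
qed

lemma norm_class_K: "h \<in> norm_class a l \<Longrightarrow> h \<in> K" by (simp add: norm_class_def)

lemma orbit_reaches_K1: assumes "g \<in> K1" "h \<in> K" shows "orbit_reaches (g * h) e \<longleftrightarrow> orbit_reaches h e"
proof
  note c = K_carrier[OF K1_K] K_carrier[OF assms(2)]
  assume "orbit_reaches (g * h) e"
  then obtain f where f: "f \<in> K1" "e \<le> D (Suc m) (f * (g * h))" by (auto simp: orbit_reaches_def)
  have "f * (g * h) = f * g * h" using square_assoc(1)[OF c(1)[OF f(1)] c(1)[OF assms(1)] c(2)] by simp
  then show "orbit_reaches h e" using f K1_mult[OF f(1) assms(1)] by (auto simp: orbit_reaches_def)
next
  note c = K_carrier[OF K1_K] K_carrier[OF assms(2)]
  assume "orbit_reaches h e"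
  then obtain f where f: "f \<in> K1" "e \<le> D (Suc m) (f * h)" by (auto simp: orbit_reaches_def)
  have fi: "f * kinv g \<in> K1" using f(1) assms(1) K1_inv K1_mult by blast
  have "f * kinv g * (g * h) = f * h"
    using square_assoc(1)[OF c(1)[OF fi] c(1)[OF assms(1)] c(2)] kinv_cancel(3)[OF K1_K[OF assms(1)] c(1)[OF f(1)]] by simp
  then show "orbit_reaches (g * h) e" unfolding orbit_reaches_def using f(2) fi by metis
qed

lemma norm_class_K1: assumes "g \<in> K1" "h \<in> K" shows "g * h \<in> norm_class a l \<longleftrightarrow> h \<in> norm_class a l"
  using assms K_mult[OF K1_K[OF assms(1)]] by (auto simp: norm_class_def D_K1 orbit_reaches_K1)

lemma D_lipschitz_ex:
  assumes "i \<le> N"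
  shows "\<exists>L\<ge>0. (\<forall>h\<in>K. \<forall>h'\<in>K. \<bar>D i h - D i h'\<bar> \<le> L * kdist h h') \<and> (\<forall>h\<in>K. D i h \<le> L)"
  by (rule D_lipschitz[OF assms]) blast

lemma ep_powi_two: "ep powi (2 * int B) = (ep ^ B) ^ 2"
proof -
  have "2 * int B = int (B * 2)" by simp
  then show ?thesis by (simp only: power_int_of_nat power_mult)
qed

text \<open>As the values of |.| are discrete, being at least |\<pi>|^j is the strict inequality
  with |\<pi>|^(j+1). The set is thus a union, over g in \<open>K1\<close>, of open conditions on
  h.\<close>

lemma orbit_reaches_sets: "{h \<in> K. orbit_reaches h (ep powi j)} \<in> sets M"
proof -
  obtain L where L: "0 \<le> L" "\<And>h h'. h \<in> K \<Longrightarrow> h' \<in> K \<Longrightarrow> \<bar>D (Suc m) h - D (Suc m) h'\<bar> \<le> L * kdist h h'"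
    using D_lipschitz_ex[of "Suc m"] by (auto simp del: mult_Suc)
  have big: "ep powi j \<le> D (Suc m) h \<longleftrightarrow> ep powi (j + 1) < D (Suc m) h" for h
    using v_less_powi[of "lower_right_minor (Suc m) (act star h x)" j] ep_powi_le[of j "j + 1"]
    unfolding D_def by linarith
  have "openin (K_topology star v (Suc m)) {h \<in> K. orbit_reaches h (ep powi j)}"
    unfolding openK
  proof (intro conjI ballI)
    fix h assume "h \<in> {h \<in> K. orbit_reaches h (ep powi j)}"
    then obtain g where g: "h \<in> K" "g \<in> K1" "ep powi (j + 1) < D (Suc m) (g * h)" by (auto simp: orbit_reaches_def big)
    define r where "r = (D (Suc m) (g * h) - ep powi (j + 1)) / (L + 1)"
    have "h' \<in> {h \<in> K. orbit_reaches h (ep powi j)}" if h': "h' \<in> K" "kdist h h' < r" for h'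
    proof -
      have "\<bar>D (Suc m) (g * h) - D (Suc m) (g * h')\<bar> \<le> L * kdist (g * h) (g * h')"
        by (intro L(2) K_mult K1_K g h')
      also have "\<dots> \<le> L * kdist h h'" by (intro mult_left_mono kdist_translate K1_K g h' L(1))
      also have "\<dots> \<le> (L + 1) * kdist h h'" using kdist_nonneg by (simp add: distrib_right)
      also have "\<dots> < D (Suc m) (g * h) - ep powi (j + 1)"
        using h'(2) L(1) unfolding r_def by (simp add: pos_less_divide_eq mult.commute)
      finally have "ep powi (j + 1) < D (Suc m) (g * h')" by linarith
      then show ?thesis using h'(1) g(2) by (auto simp: orbit_reaches_def big)
    qed
    then show "\<exists>r>0. \<forall>h'\<in>K. kdist h h' < r \<longrightarrow> h' \<in> {h \<in> K. orbit_reaches h (ep powi j)}"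
      using g(3) L(1) by (intro exI[of _ r]) (auto simp: r_def)
  qed auto
  then show ?thesis by (rule open_in_sets)
qed

lemma D_sets: "i \<le> N \<Longrightarrow> {h \<in> K. P (D i h)} \<in> sets M" if "{y. P y} \<in> sets borel"
  using measurable_sets[OF D_measurable that, of i] by (simp add: space_M vimage_def Int_def conj_commute)

lemma good_sets: "{h \<in> K. \<forall>i\<in>{1..m}. D i h \<noteq> 0} \<in> sets M"
proof -
  have "{h \<in> K. \<forall>i\<in>{1..m}. D i h \<noteq> 0} = K - (\<Union>i\<in>{1..m}. {h \<in> K. D i h = 0})" by auto
  moreover have "K \<in> sets M" using sets.top[of M] by (simp add: space_M)
  ultimately show ?thesis
    using D_sets[of "\<lambda>y. y = 0"] by (auto intro!: sets.Diff sets.finite_UN)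
qed

lemma level_sets: "{h \<in> K. (\<forall>i\<in>{1..m}. D i h \<noteq> 0) \<and> D m h = y} \<in> sets M"
proof -
  have "{h \<in> K. (\<forall>i\<in>{1..m}. D i h \<noteq> 0) \<and> D m h = y} = {h \<in> K. \<forall>i\<in>{1..m}. D i h \<noteq> 0} \<inter> {h \<in> K. D m h = y}"
    by auto
  then show ?thesis using good_sets D_sets[of "\<lambda>z. z = y" m] by (auto intro!: sets.Int)
qed

lemma norm_class_sets: "norm_class a l \<in> sets M"
proof -
  have "norm_class a l = ({h \<in> K. (\<forall>i\<in>{1..m}. D i h \<noteq> 0) \<and> D m h = ep powi a} \<inter> {h \<in> K. orbit_reaches h (ep powi (a - int l))})
     - {h \<in> K. orbit_reaches h (ep powi (a - int l - 1))}"
    by (auto simp: norm_class_def)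
  then show ?thesis using level_sets orbit_reaches_sets by (auto intro!: sets.Diff sets.Int)
qed

text \<open>For a reflection vector w of h the condition is |w3| <= q^(-B), see
  \<open>sublevel_iff_one\<close>; the factor 2 comes from the norm of r w in d_(m+1). Formulated
  through the minor, it needs no choice of w.\<close>

definition sublevel :: "int \<Rightarrow> nat \<Rightarrow> nat \<Rightarrow> 'a mat set" where
  "sublevel a l B = {h \<in> norm_class a l. D (Suc m) h \<le> ep powi (a - int l + 2 * int B)}"

lemma sublevel_sets: "sublevel a l B \<in> sets M"
proof -
  have "sublevel a l B = norm_class a l \<inter> {h \<in> K. D (Suc m) h \<le> ep powi (a - int l + 2 * int B)}"
    by (auto simp: sublevel_def norm_class_K)
  then show ?thesis using norm_class_sets D_sets[of "\<lambda>y. y \<le> ep powi (a - int l + 2 * int B)" "Suc m"] by auto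
qed

lemma sq_le_iff: "ep powi b * v y ^ 2 \<le> ep powi (b + 2 * int B) \<longleftrightarrow> v y \<le> ep ^ B"
proof -
  have "ep powi (b + 2 * int B) = ep powi b * (ep ^ B) ^ 2"
    unfolding ep_powi_add ep_powi_two ..
  moreover have "v y ^ 2 \<le> (ep ^ B) ^ 2 \<longleftrightarrow> v y \<le> ep ^ B"
    using v_simps(1) pi_props(1) by (intro power_mono_iff) auto
  ultimately show ?thesis using pi_props(1) by simp
qed

lemma sublevel_iff:
  assumes "h \<in> norm_class a l" "g \<in> K1" "refl_vec h a l w1 w2 w3"
  shows "g * h \<in> sublevel a l B \<longleftrightarrow> v (dot g w1 w2 w3) \<le> ep ^ B"
proof -
  have "D (Suc m) (g * h) = ep powi (a - int l) * v (dot g w1 w2 w3) ^ 2" using assms by (simp add: refl_vec_def)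
  then show ?thesis
    using assms(1) norm_class_K1[OF assms(2) norm_class_K[OF assms(1)], of a l] by (simp only: sublevel_def sq_le_iff mem_Collect_eq simp_thms)
qed

lemma sublevel_iff_one:
  assumes "h \<in> norm_class a l" "refl_vec h a l w1 w2 w3"
  shows "h \<in> sublevel a l B \<longleftrightarrow> v w3 \<le> ep ^ B"
  using sublevel_iff[OF assms(1) K1_one assms(2), of B]
  unfolding dot_one left_mult_one_mat[OF K_carrier[OF norm_class_K[OF assms(1)]]] .

lemma sublevel_0: "sublevel a l 0 = norm_class a l"
proof -
  have "h \<in> sublevel a l 0" if h: "h \<in> norm_class a l" for h
  proof -
    from norm_class_vector[OF h] obtain w1 w2 w3 where w: "refl_vec h a l w1 w2 w3" by blast
    show ?thesis unfolding sublevel_iff_one[OF h w] using w by (simp add: primitive_def refl_vec_def)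
  qed
  then show ?thesis by (auto simp: sublevel_def)
qed

lemma sublevel_Suc: "sublevel a l (Suc B) \<subseteq> sublevel a l B"
  using ep_powi_le[of "a - int l + 2 * int (Suc B)" "a - int l + 2 * int B"] by (auto simp: sublevel_def)

lemma cell_value:
  assumes "h \<in> sublevel a l B - sublevel a l (Suc B)"
  shows "D (Suc m) h = ep powi (a - int l + 2 * int B)"
proof -
  have h: "h \<in> norm_class a l" using assms by (simp add: sublevel_def)
  from norm_class_vector[OF h] obtain w1 w2 w3 where w: "refl_vec h a l w1 w2 w3" by blast
  have "v w3 \<le> ep ^ B" "\<not> v w3 \<le> ep ^ Suc B" using assms sublevel_iff_one[OF h w] by auto
  then have w3: "v w3 = ep ^ B" using v_less_pow[of w3 B] by linarith
  have "D (Suc m) (1\<^sub>m N * h) = ep powi (a - int l) * v (dot (1\<^sub>m N) w1 w2 w3) ^ 2"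
    using w K1_one unfolding refl_vec_def by blast
  then have "D (Suc m) h = ep powi (a - int l) * v w3 ^ 2"
    unfolding dot_one left_mult_one_mat[OF K_carrier[OF norm_class_K[OF h]]] .
  then show ?thesis
    unfolding w3 ep_powi_add ep_powi_two .
qed

lemma sublevel_exhaust:
  assumes "h \<in> norm_class a l" "D (Suc m) h \<noteq> 0"
  shows "\<exists>B. h \<in> sublevel a l B - sublevel a l (Suc B)"
proof -
  have D: "0 < D (Suc m) h / ep powi (a - int l)"
    using assms(2) D_nonneg[of "Suc m" h] pi_props(1) by simp
  obtain B where B: "ep ^ B < D (Suc m) h / ep powi (a - int l)"
    using real_arch_pow_inv[OF D pi_props(2)] by blast
  have "h \<notin> sublevel a l B"
  proof
    assume "h \<in> sublevel a l B"
    then have "D (Suc m) h \<le> ep powi (a - int l) * ep powi (2 * int B)" by (simp add: sublevel_def ep_powi_add)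
    also have "\<dots> \<le> ep powi (a - int l) * ep powi (int B)"
      using pi_props(1) ep_powi_le[of "2 * int B" "int B"] by (intro mult_left_mono) (auto intro: less_imp_le)
    finally show False using B pi_props(1) by (simp add: pos_less_divide_eq mult.commute)
  qed
  then have "h \<notin> sublevel a l B" "h \<in> sublevel a l 0" using assms(1) sublevel_0 by auto
  then show ?thesis by (induction B) auto
qed

lemma sublevel_cell_disjoint: "disjoint_family (\<lambda>B. sublevel a l B - sublevel a l (Suc B))"
proof -
  have "sublevel a l B' \<subseteq> sublevel a l (Suc B)" if "B < B'" for B B'
    using lift_Suc_antimono_le[of "sublevel a l", OF sublevel_Suc, of "Suc B" B'] that by simp
  then have "(sublevel a l B - sublevel a l (Suc B)) \<inter> (sublevel a l B' - sublevel a l (Suc B')) = {}" if "B < B'" for B B'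
    using that by blast
  then show ?thesis unfolding disjoint_family_on_def by (metis Int_commute linorder_neqE_nat)
qed

end

section \<open>The zeta integral as a power series\<close>

context haar_setup
begin

lemma powr_measurable:
  assumes "i \<le> N" shows "(\<lambda>h. complex_of_real (D i h) powr s) \<in> borel_measurable M"
proof -
  have c: "continuous_on UNIV (\<lambda>y. exp (s * complex_of_real y))" by (intro continuous_intros)
  have "(\<lambda>h. exp (s * complex_of_real (ln (D i h)))) \<in> borel_measurable M"
    by (rule measurable_compose[OF borel_measurable_ln[OF D_measurable[OF assms]] borel_measurable_continuous_onI[OF c]])
  moreover have "{h \<in> space M. D i h = 0} \<in> sets M"
    using D_sets[of "\<lambda>y. y = 0" i] assms by (simp add: space_M)
  ultimately have "(\<lambda>h. if D i h = 0 then 0 else exp (s * complex_of_real (ln (D i h)))) \<in> borel_measurable M"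
    by (intro measurable_If) auto
  moreover have "(if D i h = 0 then 0 else exp (s * complex_of_real (ln (D i h)))) = complex_of_real (D i h) powr s" for h
    using D_nonneg[of i h] by (simp add: powr_def Ln_of_real)
  ultimately show ?thesis by simp
qed

lemma powr_bounded:
  assumes "i \<le> N" "0 \<le> Re s"
  shows "\<exists>C\<ge>0. \<forall>h\<in>K. norm (complex_of_real (D i h) powr s) \<le> C"
proof -
  obtain L where L: "\<forall>h\<in>K. D i h \<le> L" "0 \<le> L" using D_lipschitz_ex[OF assms(1)] by blast
  have "norm (complex_of_real (D i h) powr s) \<le> L powr Re s" if "h \<in> K" for h
    using L that D_nonneg[of i h] assms(2) by (simp add: norm_powr_real_powr powr_mono2)
  then show ?thesis by (intro exI[of _ "L powr Re s"]) simp
qed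

lemma prod_powr_measurable:
  assumes "\<And>i. i \<in> S \<Longrightarrow> i \<le> N"
  shows "(\<lambda>h. \<Prod>i\<in>S. complex_of_real (D i h) powr s i) \<in> borel_measurable M"
  using assms by (intro borel_measurable_prod powr_measurable) auto

lemma prod_powr_bounded:
  assumes "finite S" "\<And>i. i \<in> S \<Longrightarrow> i \<le> N" "\<And>i. i \<in> S \<Longrightarrow> 0 \<le> Re (s i)"
  shows "\<exists>C\<ge>0. \<forall>h\<in>K. norm (\<Prod>i\<in>S. complex_of_real (D i h) powr s i) \<le> C"
  using assms
proof (induction S rule: finite_induct)
  case empty
  then show ?case by (intro exI[of _ 1]) simp
next
  case (insert i S)
  then obtain C where C: "C \<ge> 0" "\<forall>h\<in>K. norm (\<Prod>i\<in>S. complex_of_real (D i h) powr s i) \<le> C" by auto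
  obtain B where B: "B \<ge> 0" "\<forall>h\<in>K. norm (complex_of_real (D i h) powr s i) \<le> B"
    using powr_bounded[of i "s i"] insert.prems by auto
  have "norm (\<Prod>i\<in>insert i S. complex_of_real (D i h) powr s i) \<le> B * C" if "h \<in> K" for h
    using B C that insert(1,2) by (simp add: norm_mult mult_mono)
  then show ?case using B(1) C(1) by (intro exI[of _ "B * C"]) simp
qed

text \<open>The product stops before m: |d_m| is constant on each class and leaves the integral as a
  power. What stays inside depends on s_1, ..., s_(m-1) only, and these are not changed by
  \<open>tau\<close>.\<close>

definition phi :: "(nat \<Rightarrow> complex) \<Rightarrow> 'a mat \<Rightarrow> complex" where
  "phi s h = (\<Prod>i\<in>{1..<m}. complex_of_real (D i h) powr s i)"

lemma phi_K1: "g \<in> K1 \<Longrightarrow> h \<in> K \<Longrightarrow> phi s (g * h) = phi s h"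
  by (simp add: phi_def D_K1)

definition sublevel_fun :: "(nat \<Rightarrow> complex) \<Rightarrow> int \<Rightarrow> nat \<Rightarrow> nat \<Rightarrow> 'a mat \<Rightarrow> complex" where
  "sublevel_fun s a l B h = (if h \<in> sublevel a l B then phi s h else 0)"

definition mass :: "(nat \<Rightarrow> complex) \<Rightarrow> int \<Rightarrow> nat \<Rightarrow> nat \<Rightarrow> complex" where
  "mass s a l B = (LINT h|M. sublevel_fun s a l B h)"

definition re_nonneg :: "(nat \<Rightarrow> complex) \<Rightarrow> bool" where
  "re_nonneg s \<longleftrightarrow> (\<forall>i\<in>{1..Suc m}. 0 \<le> Re (s i))"

lemma sublevel_fun_measurable: "sublevel_fun s a l B \<in> borel_measurable M"
  unfolding sublevel_fun_def[abs_def] phi_def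
  by (intro measurable_If_set prod_powr_measurable) (auto simp: sublevel_sets)

lemma sublevel_fun_bounded: assumes "re_nonneg s" shows "\<exists>C. \<forall>h\<in>K. norm (sublevel_fun s a l B h) \<le> C"
proof -
  obtain C where "C \<ge> 0" "\<forall>h\<in>K. norm (phi s h) \<le> C"
    using prod_powr_bounded[of "{1..<m}" s] assms unfolding phi_def re_nonneg_def by auto
  then show ?thesis by (intro exI[of _ C]) (auto simp: sublevel_fun_def)
qed

lemma sublevel_fun_integrable: assumes "re_nonneg s" shows "integrable M (sublevel_fun s a l B)"
  using sublevel_fun_bounded[OF assms, of a l B] bounded_integrable[OF sublevel_fun_measurable] by blast

lemma sublevel_fun_translate:
  assumes "h \<in> norm_class a l" "g \<in> K1" "refl_vec h a l w1 w2 w3"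
  shows "sublevel_fun s a l B (g * h) = (if v (dot g w1 w2 w3) \<le> ep ^ B then phi s h else 0)"
  unfolding sublevel_fun_def sublevel_iff[OF assms] phi_K1[OF assms(2) norm_class_K[OF assms(1)]] ..

lemma sublevel_fun_outside:
  assumes "h \<in> K" "h \<notin> norm_class a l" "g \<in> K1"
  shows "sublevel_fun s a l B (g * h) = 0" "sublevel_fun s a l B h = 0"
  using norm_class_K1[OF assms(3,1), of a l] assms(2) by (simp_all add: sublevel_fun_def sublevel_def)

lemma sublevel_fun_vec: "h \<in> norm_class a l \<Longrightarrow> refl_vec h a l w1 w2 w3 \<Longrightarrow> sublevel_fun s a l B h = (if v w3 \<le> ep ^ B then phi s h else 0)"
  unfolding sublevel_fun_def by (simp add: sublevel_iff_one)

lemma tr_lo_K1: assumes "b \<in> Ok'" "r \<in> Ok"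
  shows "lo (tr_b j b) (tr_g j i b r) \<in> K1" "lo' (tr_b j b) (tr_g j i b r) \<in> K1"
proof -
  have b: "v (tr_b j b) \<le> 1"
    using assms pi_pow_le_one[of j] v_simps(1) pi_props(1) by (auto simp: v_tr_b Ok_iff intro!: mult_le_one)
  have g: "v (tr_g j i b r) \<le> 1"
    using assms by (intro v_tr_g) (auto simp: Ok_iff pi_pow_le_one)
  have t: "tr_g j i b r + star (tr_g j i b r) + tr_b j b * star (tr_b j b) = 0"
    using assms by (intro tr_g_trace) (simp add: Ok_iff)
  show "lo (tr_b j b) (tr_g j i b r) \<in> K1" "lo' (tr_b j b) (tr_g j i b r) \<in> K1"
    using lo_K1[OF b g t] by auto
qed

lemma sum_if_card: "finite I \<Longrightarrow> (\<Sum>i\<in>I. if P i then c else 0) = of_nat (card {i \<in> I. P i}) * c" for c :: complex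
  by (simp add: sum.If_cases Int_def)

text \<open>The translates of \<open>step_count\<close> lie in \<open>K1\<close>, so they preserve
  the class and \<open>phi\<close>, and averaging reduces to the count at a reflection vector of
  each h.\<close>

lemma mass_step:
  assumes s: "re_nonneg s" and B: "B \<ge> 1"
  shows "mass s a l (Suc B) = of_real (rho l B) * mass s a l B"
proof -
  have "\<exists>I i j. finite I \<and> I \<subseteq> Ok' \<times> Ok \<and> I \<noteq> {} \<and> (\<forall>w1 w2 w3. primitive w1 w2 w3 \<longrightarrow>
    v (form w1 w2 w3) = v \<pi> ^ l \<longrightarrow>
    real (card {(b, r) \<in> I. v (w3 + tr_b j b * w2 + tr_g j i b r * w1) \<le> v \<pi> ^ Suc B}) =
    (if v w3 \<le> v \<pi> ^ B then rho l B * card I else 0))" (is "\<exists>I i j. ?P I i j")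
  proof (rule step_count[OF B, of l])
    fix I i j
    assume I: "finite I" "I \<subseteq> Ok' \<times> Ok" "I \<noteq> {}"
      and c: "\<And>w1 w2 w3. primitive w1 w2 w3 \<Longrightarrow> v (form w1 w2 w3) = v \<pi> ^ l \<Longrightarrow>
        real (card {(b, r) \<in> I. v (w3 + tr_b j b * w2 + tr_g j i b r * w1) \<le> v \<pi> ^ Suc B}) =
        (if v w3 \<le> v \<pi> ^ B then rho l B * card I else 0)"
    have "?P I i j"
      by (intro conjI allI impI I) (rule c)
    then show "\<exists>I i j. ?P I i j" by (intro exI)
  qed
  then obtain I i j where I: "finite I" "I \<subseteq> Ok' \<times> Ok" "I \<noteq> {}" and
    cnt: "\<forall>w1 w2 w3. primitive w1 w2 w3 \<longrightarrow> v (form w1 w2 w3) = v \<pi> ^ l \<longrightarrow>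
    real (card {(b, r) \<in> I. v (w3 + tr_b j b * w2 + tr_g j i b r * w1) \<le> v \<pi> ^ Suc B}) =
    (if v w3 \<le> v \<pi> ^ B then rho l B * card I else 0)"
    by (elim exE conjE)
  define g where "g p = lo (tr_b j (fst p)) (tr_g j i (fst p) (snd p))" for p
  have g: "g p \<in> K1" if "p \<in> I" for p
    unfolding g_def using that I(2) by (intro tr_lo_K1) auto
  have eq: "(\<Sum>p\<in>I. sublevel_fun s a l (Suc B) (g p * h)) = (of_real (rho l B) * of_nat (card I)) * sublevel_fun s a l B h"
    if h: "h \<in> K" for h
  proof (cases "h \<in> norm_class a l")
    case False
    then show ?thesis using sublevel_fun_outside[OF h False] g K1_one by simp
  next
    case True
    from norm_class_vector[OF True] obtain w1 w2 w3 where w: "refl_vec h a l w1 w2 w3" by blast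
    let ?S = "{(b, r) \<in> I. v (w3 + tr_b j b * w2 + tr_g j i b r * w1) \<le> v \<pi> ^ Suc B}"
    have "(\<Sum>p\<in>I. sublevel_fun s a l (Suc B) (g p * h)) = (\<Sum>p\<in>I. if v (dot (g p) w1 w2 w3) \<le> ep ^ Suc B then phi s h else 0)"
      by (intro sum.cong refl sublevel_fun_translate[OF True _ w] g)
    also have "\<dots> = of_nat (card {p \<in> I. v (dot (g p) w1 w2 w3) \<le> ep ^ Suc B}) * phi s h"
      by (rule sum_if_card[OF I(1)])
    also have "{p \<in> I. v (dot (g p) w1 w2 w3) \<le> ep ^ Suc B} = ?S"
      unfolding g_def dot_lo by auto
    also have "of_nat (card ?S) * phi s h = of_real (real (card ?S)) * phi s h" by simp
    also have "\<dots> = (of_real (rho l B) * of_nat (card I)) * sublevel_fun s a l B h"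
      using cnt[rule_format, of w1 w2 w3] w unfolding sublevel_fun_vec[OF True w] refl_vec_def by simp
    finally show ?thesis .
  qed
  obtain C where C: "\<And>h. h \<in> K \<Longrightarrow> norm (sublevel_fun s a l (Suc B) h) \<le> C" using sublevel_fun_bounded[OF s] by blast
  have "of_nat (card I) * mass s a l (Suc B) = (of_real (rho l B) * of_nat (card I)) * mass s a l B"
    unfolding mass_def
    by (rule average[OF I(1) K1_K[OF g] sublevel_fun_measurable C eq])
  then show ?thesis using I(1,3) by simp
qed

lemma mass_first:
  assumes s: "re_nonneg s"
  shows "mass s a l 1 = (if l = 0 then of_nat q + 1 else 1) / (of_nat q ^ 3 + 1) * mass s a l 0"
proof -
  \<comment> \<open>\<open>None\<close> stands for the identity and \<open>Some (b, r)\<close> for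
    \<open>lo'\<close>, so that the q^3 + 1 indices run through the isotropic lines counted in
    \<open>first_count\<close>.\<close>
  define I :: "('a \<times> 'a) option set" where "I = insert None (Some ` (Rk' \<times> Rk))"
  define g where "g p = (case p of None \<Rightarrow> 1\<^sub>m N | Some (b, r) \<Rightarrow> lo' (tr_b 0 b) (tr_g 0 0 b r))" for p
  have fin: "finite (Rk' \<times> Rk)" using Rk_mem(3) Rk'_mem(2) by blast
  then have I: "finite I" by (simp add: I_def)
  have "card (Rk' \<times> Rk) = q ^ 3" by (simp add: card_cartesian_product Rk Rk' power2_eq_square power3_eq_cube)
  then have cI: "card I = q ^ 3 + 1"
    unfolding I_def using fin by (subst card_insert_disjoint) (auto simp: card_image)
  have R: "Rk \<subseteq> Ok" "Rk' \<subseteq> Ok'" using Rk(1) Rk'(1) by (auto simp: residue_system_def)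
  have g: "g p \<in> K1" if "p \<in> I" for p
  proof (cases p)
    case None
    show ?thesis unfolding g_def None option.case by (rule K1_one)
  next
    case (Some y)
    then show ?thesis using that R unfolding I_def g_def by (auto intro!: tr_lo_K1(2))
  qed
  have eq: "(\<Sum>p\<in>I. sublevel_fun s a l 1 (g p * h)) = (if l = 0 then of_nat q + 1 else 1) * sublevel_fun s a l 0 h"
    if h: "h \<in> K" for h
  proof (cases "h \<in> norm_class a l")
    case False
    then show ?thesis using sublevel_fun_outside[OF h False] g K1_one by simp
  next
    case True
    from norm_class_vector[OF True] obtain w1 w2 w3 where w: "refl_vec h a l w1 w2 w3" by blast
    have gN: "dot (g None) w1 w2 w3 = w3" unfolding g_def option.case by (rule dot_one)
    let ?S = "{(b, r) \<in> Rk' \<times> Rk. v (w1 + tr_b 0 b * w2 + tr_g 0 0 b r * w3) \<le> v \<pi>}"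
    have "(\<Sum>p\<in>I. sublevel_fun s a l 1 (g p * h)) = (\<Sum>p\<in>I. if v (dot (g p) w1 w2 w3) \<le> ep ^ 1 then phi s h else 0)"
      by (intro sum.cong refl sublevel_fun_translate[OF True _ w] g)
    also have "\<dots> = (if v w3 \<le> ep then phi s h else 0) +
        (\<Sum>p\<in>Rk' \<times> Rk. if v (dot (g (Some p)) w1 w2 w3) \<le> ep then phi s h else 0)"
      unfolding I_def using fin
      by (subst sum.insert) (auto simp: gN sum.reindex)
    also have "(\<Sum>p\<in>Rk' \<times> Rk. if v (dot (g (Some p)) w1 w2 w3) \<le> ep then phi s h else 0) =
        of_nat (card {p \<in> Rk' \<times> Rk. v (dot (g (Some p)) w1 w2 w3) \<le> ep}) * phi s h"
      by (rule sum_if_card[OF fin])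
    also have "{p \<in> Rk' \<times> Rk. v (dot (g (Some p)) w1 w2 w3) \<le> ep} = ?S"
      by (auto simp: g_def dot_lo)
    also have "(if v w3 \<le> ep then phi s h else 0) + of_nat (card ?S) * phi s h =
        of_nat (card ?S + (if v w3 \<le> ep then 1 else 0)) * phi s h"
      by (simp add: algebra_simps)
    also have "card ?S + (if v w3 \<le> ep then 1 else 0) = (if l = 0 then q + 1 else 1)"
      using w by (intro first_count) (auto simp: refl_vec_def)
    also have "of_nat (if l = 0 then q + 1 else 1) * phi s h = (if l = 0 then of_nat q + 1 else 1) * sublevel_fun s a l 0 h"
      using True by (simp add: sublevel_fun_def sublevel_0)
    finally show ?thesis .
  qed
  obtain C where C: "\<And>h. h \<in> K \<Longrightarrow> norm (sublevel_fun s a l 1 h) \<le> C" using sublevel_fun_bounded[OF s] by blast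
  have "of_nat (card I) * mass s a l 1 = (if l = 0 then of_nat q + 1 else 1) * mass s a l 0"
    unfolding mass_def by (rule average[OF I K1_K[OF g] sublevel_fun_measurable C eq])
  moreover have "(of_nat (card I) :: complex) \<noteq> 0" unfolding cI by (metis Suc_eq_plus1 of_nat_neq_0)
  ultimately have "mass s a l 1 = (if l = 0 then of_nat q + 1 else 1) * mass s a l 0 / of_nat (card I)"
    by (metis nonzero_mult_div_cancel_left)
  then show ?thesis unfolding cI by simp
qed

text \<open>The integral of \<open>phi\<close> over the class splits off: within a class |r w|
  follows the same law whatever the values of the other minors are.\<close>

lemma mass_pl: assumes s: "re_nonneg s" shows "mass s a l B = tail_prob q l B * mass s a l 0"
proof (induction B)
  case 0
  then show ?case by (simp add: tail_prob_def)
next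
  case (Suc B)
  have q0: "(of_nat q :: complex) \<noteq> 0" using pi_props(5) by simp
  show ?case
  proof (cases B)
    case 0
    then show ?thesis using mass_first[OF s, of a l] by (auto simp: tail_prob_def tail_wt_def)
  next
    case (Suc c)
    then have "mass s a l (Suc B) = of_real (rho l B) * (tail_prob q l B * mass s a l 0)"
      using mass_step[OF s, of B a l] Suc.IH by simp
    moreover have "of_real (rho l B) * tail_prob q l B = tail_prob q l (Suc B)"
    proof -
      have e: "(of_nat q :: complex) ^ (2 * Suc c) = of_nat q ^ (2 * c) * of_nat q ^ 2"
        by (simp add: power_add power2_eq_square)
      have "of_real (rho l (Suc c)) * tail_wt q l c * of_nat q ^ 2 = tail_wt q l (Suc c)"
      proof -
        consider "Suc c < l" | "l = Suc c" | "l < Suc c" by linarith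
        then show ?thesis
          using q0 by cases (auto simp: rho_def tail_wt_def power2_eq_square power3_eq_cube)
      qed
      then have *: "of_real (rho l (Suc c)) * tail_wt q l c = tail_wt q l (Suc c) / of_nat q ^ 2"
        using q0 by (simp add: nonzero_eq_divide_eq)
      have "of_real (rho l (Suc c)) * (tail_wt q l c / (of_nat q ^ (2 * c) * (of_nat q ^ 3 + 1))) =
         (of_real (rho l (Suc c)) * tail_wt q l c) / (of_nat q ^ (2 * c) * (of_nat q ^ 3 + 1))" by simp
      also have "\<dots> = tail_wt q l (Suc c) / (of_nat q ^ (2 * c) * of_nat q ^ 2 * (of_nat q ^ 3 + 1))"
        unfolding * by (simp add: mult_ac)
      finally show ?thesis unfolding Suc tail_prob_def nat.case e .
    qed
    ultimately show ?thesis by (simp add: mult.assoc)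
  qed
qed

definition integrand :: "(nat \<Rightarrow> complex) \<Rightarrow> 'a mat \<Rightarrow> complex" where
  "integrand s h = (\<Prod>i\<in>{1..Suc m}. complex_of_real (D i h) powr s i)"

text \<open>Complex powers of 0 are 0, even with exponent 0, so the integrand vanishes by itself
  wherever one of the minors does.\<close>

lemma omega_eq_integral: "omega star v (Suc m) M x s = (LINT h|M. integrand s h)"
  unfolding omega_def set_lebesgue_integral_def
proof (intro Bochner_Integration.integral_cong refl)
  fix h assume "h \<in> space M"
  then have h: "h \<in> K" by (simp add: space_M)
  let ?A = "{h \<in> K. \<forall>i\<in>{1..Suc m}. lower_right_minor i (act star h x) \<noteq> 0}"
  show "indicat_real ?A h *\<^sub>R (\<Prod>i = 1..Suc m. complex_of_real (v (lower_right_minor i (act star h x))) powr s i) = integrand s h"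
  proof (cases "h \<in> ?A")
    case True
    then show ?thesis by (simp add: integrand_def D_def)
  next
    case False
    then obtain i where "i \<in> {1..Suc m}" "lower_right_minor i (act star h x) = 0" using h by auto
    then have "integrand s h = 0" unfolding integrand_def by (intro prod_zero) (auto simp: D_def v_simps intro!: bexI[of _ i])
    then show ?thesis using False by (simp add: indicator_def)
  qed
qed

lemma integrand_split: "integrand s h = phi s h * complex_of_real (D m h) powr s m * complex_of_real (D (Suc m) h) powr s (Suc m)"
proof (cases "m = 0")
  \<comment> \<open>For m = 0 the factor at index 0 is a power of \<open>D 0\<close> = 1, so the
    value of \<open>s 0\<close> does not matter.\<close>
  case True
  then have "{1..Suc m} = {Suc m}" "{1..<m} = {}" "D m h = 1" using D_zero by auto
  then show ?thesis by (simp only: integrand_def phi_def) simp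
next
  case False
  then have "{1..Suc m} = insert (Suc m) (insert m {1..<m})" by auto
  then show ?thesis by (simp add: integrand_def phi_def)
qed

lemma integrand_nz:
  assumes "integrand s h \<noteq> 0" "i \<le> Suc m"
  shows "D i h \<noteq> 0"
proof (cases "i = 0")
  case False
  show ?thesis
  proof
    assume "D i h = 0"
    then have "integrand s h = 0" unfolding integrand_def using assms(2) False
      by (intro prod_zero) (auto intro!: bexI[of _ i])
    with assms(1) show False by simp
  qed
qed (simp add: D_zero)

lemma integrand_measurable: "integrand s \<in> borel_measurable M"
  unfolding integrand_def[abs_def] by (intro prod_powr_measurable) auto

lemma integrand_integrable: assumes "re_nonneg s" shows "integrable M (integrand s)"
proof -
  obtain C where "\<forall>h\<in>K. norm (integrand s h) \<le> C"
    using prod_powr_bounded[of "{1..Suc m}" s] assms unfolding integrand_def re_nonneg_def by auto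
  then show ?thesis using bounded_integrable[OF integrand_measurable] by blast
qed

definition Qs :: "complex \<Rightarrow> complex" where "Qs s = of_nat q powr (- s)"

lemma Qs_nz: "Qs s \<noteq> 0"
  using pi_props(5) by (auto simp: Qs_def powr_def)

lemma Qs_norm: assumes "0 \<le> Re s" shows "norm (Qs s) \<le> 1"
proof -
  have "norm (Qs s) = real q powr (- Re s)"
    unfolding Qs_def using norm_powr_real_powr[of "of_nat q" "- s"] by simp
  also have "\<dots> \<le> real q powr 0" using assms pi_props(5) by (intro powr_mono) auto
  finally show ?thesis using pi_props(5) by simp
qed

lemma ep_powi_powr: "complex_of_real (ep powi a) powr s = Qs s powi a"
proof -
  have q: "0 < real q" using pi_props(5) by simp
  have ep: "ep = exp (- ln (real q))" using q by (simp add: normalized exp_minus inverse_eq_divide)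
  have e: "ep powi a = exp (of_int a * (- ln (real q)))" unfolding ep exp_power_int by simp
  have "complex_of_real (ep powi a) powr s = exp (s * complex_of_real (of_int a * (- ln (real q))))"
    unfolding e powr_def by (simp add: Ln_of_real exp_of_real[symmetric] del: of_real_mult of_real_minus)
  also have "\<dots> = exp (of_int a * (- s * of_real (ln (real q))))" by (simp add: mult_ac)
  also have "\<dots> = exp (- s * of_real (ln (real q))) powi a" by (simp add: exp_power_int)
  also have "exp (- s * of_real (ln (real q))) = Qs s"
    unfolding Qs_def powr_def using q Ln_of_real[of "real q"] by (auto simp: Ln_of_nat)
  finally show ?thesis .
qed

lemma integrand_cell:
  assumes "h \<in> sublevel a l B - sublevel a l (Suc B)"
  shows "integrand s h = (Qs (s m) powi a * Qs (s (Suc m)) powi (a - int l + 2 * int B)) * phi s h"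
proof -
  have "D m h = ep powi a" using assms by (simp add: sublevel_def norm_class_def)
  then show ?thesis unfolding integrand_split cell_value[OF assms] by (simp only: ep_powi_powr mult_ac)
qed

lemma restricted_integrable:
  assumes "integrable M f" "S \<in> sets M"
  shows "integrable M (\<lambda>h. if h \<in> S then f h else (0 :: complex))"
proof (rule Bochner_Integration.integrable_bound[OF assms(1)])
  show "(\<lambda>h. if h \<in> S then f h else 0) \<in> borel_measurable M"
    using assms by (intro measurable_If_set) auto
qed auto

lemma cell_integral:
  assumes s: "re_nonneg s"
  shows "(LINT h|M. (if h \<in> sublevel a l B - sublevel a l (Suc B) then integrand s h else 0)) =
    Qs (s m) powi a * Qs (s (Suc m)) powi (a - int l + 2 * int B) * (mass s a l B - mass s a l (Suc B))"
proof -
  let ?c = "Qs (s m) powi a * Qs (s (Suc m)) powi (a - int l + 2 * int B)"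
  have "(if h \<in> sublevel a l B - sublevel a l (Suc B) then integrand s h else 0) = ?c * (sublevel_fun s a l B h - sublevel_fun s a l (Suc B) h)" for h
    using integrand_cell[of h a l B s] sublevel_Suc[of a l B] by (auto simp: sublevel_fun_def)
  then have "(LINT h|M. (if h \<in> sublevel a l B - sublevel a l (Suc B) then integrand s h else 0)) =
     (LINT h|M. ?c * (sublevel_fun s a l B h - sublevel_fun s a l (Suc B) h))" by simp
  also have "\<dots> = ?c * (mass s a l B - mass s a l (Suc B))"
    unfolding mass_def using sublevel_fun_integrable[OF s]
    by (simp add: Bochner_Integration.integral_diff)
  finally show ?thesis .
qed

text \<open>With t = q^(-s_(m+1)), the last minor contributes t^(a - l) t^(2B) on the cell of level
  \<open>B\<close>; summing over \<open>B\<close> with the probabilities of the cells gives the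
  generating function at X = t^2. The factors with exponent a combine to a power of U, which
  \<open>tau\<close> fixes, and t remains only in t^(-l) and the generating function.\<close>

lemma norm_class_integral:
  assumes s: "re_nonneg s"
  shows "(LINT h|M. (if h \<in> norm_class a l then integrand s h else 0)) =
    (Qs (s m) * Qs (s (Suc m))) powi a * (mass s a l 0 * Qs (s (Suc m)) powi (- int l) *
      gen_fun q l (Qs (s (Suc m)) ^ 2 / of_nat q ^ 2))"
proof -
  interpret finite_measure M by (rule finite_M)
  define t where "t = Qs (s (Suc m))"
  define f where "f h = (if h \<in> norm_class a l then integrand s h else 0)" for h
  have t: "t \<noteq> 0" "norm t \<le> 1"
    using Qs_nz Qs_norm s unfolding t_def re_nonneg_def by auto
  have X: "norm (t ^ 2) \<le> 1" using t(2) by (simp add: norm_power power_le_one)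
  have "(\<lambda>B. LINT h|M. (if h \<in> sublevel a l B - sublevel a l (Suc B) then f h else 0)) sums (LINT h|M. f h)"
  proof (rule integral_partition_sums)
    show "integrable M f" unfolding f_def by (rule restricted_integrable[OF integrand_integrable[OF s] norm_class_sets])
    show "sublevel a l i - sublevel a l (Suc i) \<in> sets M" for i by (intro sets.Diff sublevel_sets)
    show "disjoint_family (\<lambda>B. sublevel a l B - sublevel a l (Suc B))" by (rule sublevel_cell_disjoint)
    show "\<exists>i. h \<in> sublevel a l i - sublevel a l (Suc i)" if "f h \<noteq> 0" for h
      using that integrand_nz[of s h "Suc m"] sublevel_exhaust[of h a l] by (auto simp: f_def split: if_splits)
  qed
  moreover have "(LINT h|M. (if h \<in> sublevel a l B - sublevel a l (Suc B) then f h else 0)) =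
     (Qs (s m) powi a * t powi (a - int l) * mass s a l 0) * ((tail_prob q l B - tail_prob q l (Suc B)) * (t\<^sup>2) ^ B)" for B
  proof -
    have "(if h \<in> sublevel a l B - sublevel a l (Suc B) then f h else 0) =
      (if h \<in> sublevel a l B - sublevel a l (Suc B) then integrand s h else 0)" for h
      by (auto simp: f_def sublevel_def)
    then have "(LINT h|M. (if h \<in> sublevel a l B - sublevel a l (Suc B) then f h else 0)) =
      Qs (s m) powi a * t powi (a - int l + 2 * int B) * (mass s a l B - mass s a l (Suc B))"
      using cell_integral[OF s, of a l B] by (simp add: t_def)
    also have "t powi (a - int l + 2 * int B) = t powi (a - int l) * (t\<^sup>2) ^ B"
      using t(1) by (simp add: power_int_add power_int_mult)
    finally show ?thesis unfolding mass_pl[OF s, of a l B] mass_pl[OF s, of a l "Suc B"]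
      by (simp add: algebra_simps)
  qed
  ultimately have "(\<lambda>B. (Qs (s m) powi a * t powi (a - int l) * mass s a l 0) * ((tail_prob q l B - tail_prob q l (Suc B)) * (t\<^sup>2) ^ B))
     sums (LINT h|M. f h)" by simp
  moreover have "(\<lambda>B. (Qs (s m) powi a * t powi (a - int l) * mass s a l 0) * ((tail_prob q l B - tail_prob q l (Suc B)) * (t\<^sup>2) ^ B))
     sums ((Qs (s m) powi a * t powi (a - int l) * mass s a l 0) * gen_fun q l (t\<^sup>2 / of_nat q ^ 2))"
    by (intro sums_mult tail_prob_sums X pi_props(5))
  ultimately have "(LINT h|M. f h) = (Qs (s m) powi a * t powi (a - int l) * mass s a l 0) * gen_fun q l (t\<^sup>2 / of_nat q ^ 2)"
    by (rule sums_unique2)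
  also have "t powi (a - int l) = t powi a * t powi (- int l)"
    using t(1) power_int_add[of t a "- int l"] by simp
  finally show ?thesis unfolding f_def t_def by (simp add: power_int_mult_distrib mult_ac)
qed

text \<open>On K both |d_m| and |d_(m+1)| are at most q^(a0). The first bound makes the exponents of
  U start at -a0. The second bounds l, because q^(l - a) is attained by |d_(m+1)| on the orbit; so
  every coefficient is a finite sum. The same a0 serves for all s.\<close>

lemma omega_series:
  "\<exists>a0. \<forall>s. re_nonneg s \<longrightarrow> (\<lambda>a. (Qs (s m) * Qs (s (Suc m))) powi (int a - int a0) *
     (\<Sum>l\<le>a. mass s (int a - int a0) l 0 * Qs (s (Suc m)) powi (- int l) *
       gen_fun q l (Qs (s (Suc m)) ^ 2 / of_nat q ^ 2))) sums omega star v (Suc m) M x s"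
proof -
  interpret finite_measure M by (rule finite_M)
  obtain L L' where L: "\<forall>h\<in>K. D m h \<le> L" "\<forall>h\<in>K. D (Suc m) h \<le> L'"
    using D_lipschitz_ex[of m] D_lipschitz_ex[of "Suc m"] by auto
  obtain a0 where "max L L' < (1 / ep) ^ a0"
    using real_arch_pow[of "1 / ep" "max L L'"] pi_props(1,2) by auto
  then have a0: "L \<le> ep powi (- int a0)" "L' \<le> ep powi (- int a0)"
    by (auto simp: power_int_minus power_one_over inverse_eq_divide)
  have series: "(\<lambda>a. (Qs (s m) * Qs (s (Suc m))) powi (int a - int a0) *
     (\<Sum>l\<le>a. mass s (int a - int a0) l 0 * Qs (s (Suc m)) powi (- int l) *
       gen_fun q l (Qs (s (Suc m)) ^ 2 / of_nat q ^ 2))) sums omega star v (Suc m) M x s" if s: "re_nonneg s" for s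
  proof -
    define S where "S a = {h \<in> K. (\<forall>i\<in>{1..m}. D i h \<noteq> 0) \<and> D m h = ep powi (int a - int a0)}" for a :: nat
    have "(\<lambda>a. LINT h|M. (if h \<in> S a then integrand s h else 0)) sums (LINT h|M. integrand s h)"
    proof (rule integral_partition_sums[OF integrand_integrable[OF s]])
      show "S a \<in> sets M" for a unfolding S_def by (rule level_sets)
      show "disjoint_family S" by (auto simp: disjoint_family_on_def S_def ep_powi_inj)
      show "\<exists>a. h \<in> S a" if "h \<in> space M" "integrand s h \<noteq> 0" for h
      proof -
        have h: "h \<in> K" using that(1) by (simp add: space_M)
        have nz: "D i h \<noteq> 0" if "i \<le> Suc m" for i using integrand_nz \<open>integrand s h \<noteq> 0\<close> that by blast
        obtain b where b: "D m h = ep powi b"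
          using nz[of m] v_discrete[of "lower_right_minor m (act star h x)"] by (auto simp: D_def v_simps)
        then have "ep powi b \<le> ep powi (- int a0)" using L(1) a0(1) h by fastforce
        then have "- int a0 \<le> b" unfolding ep_powi_le .
        then have "b = int (nat (b + int a0)) - int a0" by simp
        then have "h \<in> S (nat (b + int a0))" using h nz b unfolding S_def by auto
        then show ?thesis ..
      qed
    qed
    moreover have "(LINT h|M. (if h \<in> S a then integrand s h else 0)) =
      (Qs (s m) * Qs (s (Suc m))) powi (int a - int a0) *
     (\<Sum>l\<le>a. mass s (int a - int a0) l 0 * Qs (s (Suc m)) powi (- int l) *
       gen_fun q l (Qs (s (Suc m)) ^ 2 / of_nat q ^ 2))" for a
    proof -
      define f where "f h = (if h \<in> S a then integrand s h else 0)" for h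
      let ?b = "int a - int a0"
      have sub: "norm_class ?b l \<subseteq> S a" for l by (auto simp: norm_class_def S_def)
      have empty: "norm_class ?b l = {}" if "a < l" for l
      proof (rule ccontr)
        assume "norm_class ?b l \<noteq> {}"
        then obtain h where h: "h \<in> K" "orbit_reaches h (ep powi (?b - int l))" by (auto simp: norm_class_def)
        then obtain g where g: "g \<in> K1" "ep powi (?b - int l) \<le> D (Suc m) (g * h)" by (auto simp: orbit_reaches_def)
        then have "ep powi (?b - int l) \<le> ep powi (- int a0)"
          using L(2) a0(2) K_mult[OF K1_K[OF g(1)] h(1)] by fastforce
        then show False using that unfolding ep_powi_le by simp
      qed
      have "(\<lambda>l. LINT h|M. (if h \<in> norm_class ?b l then f h else 0)) sums (LINT h|M. f h)"
      proof (rule integral_partition_sums)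
        show "integrable M f" unfolding f_def
          unfolding S_def by (rule restricted_integrable[OF integrand_integrable[OF s] level_sets])
        show "norm_class ?b l \<in> sets M" for l by (rule norm_class_sets)
        show "disjoint_family (norm_class ?b)" using norm_class_disjoint by (auto simp: disjoint_family_on_def)
        show "\<exists>l. h \<in> norm_class ?b l" if "f h \<noteq> 0" for h
          using that good_vector[of h ?b] by (auto simp: f_def S_def split: if_splits)
      qed
      moreover have "(if h \<in> norm_class ?b l then f h else 0) = (if h \<in> norm_class ?b l then integrand s h else 0)" for h l
        using sub by (auto simp: f_def)
      ultimately have "(\<lambda>l. LINT h|M. (if h \<in> norm_class ?b l then integrand s h else 0)) sums (LINT h|M. f h)" by simp
      moreover have "(\<lambda>l. LINT h|M. (if h \<in> norm_class ?b l then integrand s h else 0)) sums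
        (\<Sum>l\<le>a. LINT h|M. (if h \<in> norm_class ?b l then integrand s h else 0))"
        by (rule sums_finite) (auto simp: empty)
      ultimately have "(LINT h|M. f h) = (\<Sum>l\<le>a. LINT h|M. (if h \<in> norm_class ?b l then integrand s h else 0))"
        by (rule sums_unique2)
      then show ?thesis unfolding norm_class_integral[OF s] f_def by (simp add: sum_distrib_left)
    qed
    ultimately show ?thesis unfolding omega_eq_integral by simp
  qed
  then show ?thesis by blast
qed

lemma mass_cong:
  assumes "\<And>i. i \<in> {1..<m} \<Longrightarrow> s i = s' i"
  shows "mass s a l B = mass s' a l B"
proof -
  have "phi s h = phi s' h" for h unfolding phi_def using assms by (intro prod.cong) auto
  then show ?thesis by (simp only: mass_def sublevel_fun_def)
qed

end

section \<open>Rational functions\<close>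

definition poly_like :: "(complex \<Rightarrow> complex) \<Rightarrow> bool" where
  "poly_like f \<longleftrightarrow> (\<exists>r. \<forall>t. f t = poly r t)"

lemma poly_like_poly: "poly_like (poly r)"
  by (auto simp: poly_like_def)

lemma poly_like_const: "poly_like (\<lambda>t. c)"
  unfolding poly_like_def by (intro exI[of _ "[:c:]"]) simp

lemma poly_like_id: "poly_like (\<lambda>t. t)"
  unfolding poly_like_def by (intro exI[of _ "[:0, 1:]"]) simp

lemma poly_like_add: assumes "poly_like f" "poly_like g" shows "poly_like (\<lambda>t. f t + g t)"
proof -
  obtain r s where "\<forall>t. f t = poly r t" "\<forall>t. g t = poly s t" using assms unfolding poly_like_def by blast
  then show ?thesis unfolding poly_like_def by (intro exI[of _ "r + s"]) simp
qed

lemma poly_like_mult: assumes "poly_like f" "poly_like g" shows "poly_like (\<lambda>t. f t * g t)"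
proof -
  obtain r s where "\<forall>t. f t = poly r t" "\<forall>t. g t = poly s t" using assms unfolding poly_like_def by blast
  then show ?thesis unfolding poly_like_def by (intro exI[of _ "r * s"]) simp
qed

lemma poly_like_diff: assumes "poly_like f" "poly_like g" shows "poly_like (\<lambda>t. f t - g t)"
  using poly_like_add[OF assms(1) poly_like_mult[OF poly_like_const[of "-1"] assms(2)]] by simp

lemma poly_like_minus: assumes "poly_like f" shows "poly_like (\<lambda>t. - f t)"
  using poly_like_diff[OF poly_like_const[of 0] assms] by simp

lemma poly_like_divide: assumes "poly_like f" shows "poly_like (\<lambda>t. f t / c)"
  using poly_like_mult[OF assms poly_like_const[of "inverse c"]] by (simp add: field_simps)

lemma poly_like_power: assumes "poly_like f" shows "poly_like (\<lambda>t. f t ^ n)"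
  by (induction n) (simp_all add: poly_like_const poly_like_mult assms)

lemma poly_like_sum: assumes "\<And>i. i \<in> S \<Longrightarrow> poly_like (f i)" shows "poly_like (\<lambda>t. \<Sum>i\<in>S. f i t)"
  using assms by (induction S rule: infinite_finite_induct) (simp_all add: poly_like_const poly_like_add)

lemma poly_like_prod: assumes "\<And>i. i \<in> S \<Longrightarrow> poly_like (f i)" shows "poly_like (\<lambda>t. \<Prod>i\<in>S. f i t)"
  using assms by (induction S rule: infinite_finite_induct) (simp_all add: poly_like_const poly_like_mult)

lemmas poly_like_intros = poly_like_const poly_like_id poly_like_add poly_like_mult poly_like_diff poly_like_minus poly_like_divide
  poly_like_power poly_like_sum poly_like_prod

lemma poly_like_eqI:
  assumes "poly_like f" "poly_like g" "infinite T" "\<And>t. t \<in> T \<Longrightarrow> f t = g t"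
  shows "f t = g t"
proof -
  obtain r s where rs: "\<forall>t. f t = poly r t" "\<forall>t. g t = poly s t" using assms(1,2) unfolding poly_like_def by blast
  then have "T \<subseteq> {t. poly (r - s) t = 0}" using assms(4) by auto
  then have "infinite {t. poly (r - s) t = 0}" using assms(3) finite_subset by blast
  then have "r - s = 0" using poly_roots_finite by blast
  then show ?thesis using rs by simp
qed

lemma polynomial_fun_polyex:
  assumes "polynomial_fun n P" "\<And>i. poly_like (\<lambda>w. V w i)"
  shows "poly_like (\<lambda>w. P (V w))"
proof -
  obtain S c where P: "P = (\<lambda>X. \<Sum>m\<in>S. c m * (\<Prod>i=1..n. X i ^ m i))"
    using assms(1) unfolding polynomial_fun_def by blast
  show ?thesis unfolding P by (intro poly_like_sum poly_like_mult poly_like_const poly_like_prod poly_like_power assms(2))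
qed

lemma polynomial_fun_cong:
  assumes "polynomial_fun n P" "\<And>i. i \<in> {1..n} \<Longrightarrow> X i = Y i"
  shows "P X = P Y"
proof -
  obtain S c where P: "P = (\<lambda>X. \<Sum>m\<in>S. c m * (\<Prod>i=1..n. X i ^ m i))"
    using assms(1) unfolding polynomial_fun_def by blast
  show ?thesis unfolding P using assms(2) by simp
qed

lemma polynomial_fun_isCont:
  assumes "polynomial_fun n P" "\<And>i. isCont (\<lambda>w. V w i) w"
  shows "isCont (\<lambda>w. P (V w)) w"
proof -
  obtain S c where P: "P = (\<lambda>X. \<Sum>m\<in>S. c m * (\<Prod>i=1..n. X i ^ m i))"
    using assms(1) unfolding polynomial_fun_def by blast
  show ?thesis unfolding P by (intro continuous_intros assms(2))
qed

lemma polynomial_fun_mult: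
  assumes "polynomial_fun n P" "polynomial_fun n Q"
  shows "polynomial_fun n (\<lambda>X. P X * Q X)"
proof -
  obtain S c where S: "finite S" and P: "P = (\<lambda>X. \<Sum>m\<in>S. c m * (\<Prod>i=1..n. X i ^ m i))"
    using assms(1) unfolding polynomial_fun_def by blast
  obtain T d where T: "finite T" and Q: "Q = (\<lambda>X. \<Sum>m\<in>T. d m * (\<Prod>i=1..n. X i ^ m i))"
    using assms(2) unfolding polynomial_fun_def by blast
  \<comment> \<open>Different pairs of exponents can have the same sum, so the double sum is
    regrouped by the image of \<open>g\<close>.\<close>
  define g :: "(nat \<Rightarrow> nat) \<times> (nat \<Rightarrow> nat) \<Rightarrow> nat \<Rightarrow> nat" where "g y = (\<lambda>i. fst y i + snd y i)" for y
  have "P X * Q X = (\<Sum>u\<in>g ` (S \<times> T). (\<Sum>y\<in>{y \<in> S \<times> T. g y = u}. c (fst y) * d (snd y)) * (\<Prod>i=1..n. X i ^ u i))" for X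
  proof -
    have "P X * Q X = (\<Sum>y\<in>S \<times> T. c (fst y) * d (snd y) * (\<Prod>i=1..n. X i ^ g y i))"
      unfolding P Q sum_product sum.cartesian_product g_def
      by (intro sum.cong refl) (auto simp: power_add prod.distrib mult_ac)
    also have "\<dots> = (\<Sum>u\<in>g ` (S \<times> T). \<Sum>y\<in>{y \<in> S \<times> T. g y = u}. c (fst y) * d (snd y) * (\<Prod>i=1..n. X i ^ g y i))"
      using S T by (intro sum.image_gen) simp
    also have "\<dots> = (\<Sum>u\<in>g ` (S \<times> T). (\<Sum>y\<in>{y \<in> S \<times> T. g y = u}. c (fst y) * d (snd y)) * (\<Prod>i=1..n. X i ^ u i))"
      by (intro sum.cong refl) (simp add: sum_distrib_right)
    finally show ?thesis .
  qed
  then have "(\<lambda>X. P X * Q X) = (\<lambda>X. \<Sum>u\<in>g ` (S \<times> T). (\<Sum>y\<in>{y \<in> S \<times> T. g y = u}. c (fst y) * d (snd y)) * (\<Prod>i=1..n. X i ^ u i))"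
    by blast
  moreover have "finite (g ` (S \<times> T))" using S T by simp
  ultimately show ?thesis unfolding polynomial_fun_def
    by (intro exI[of _ "g ` (S \<times> T)"] exI[of _ "\<lambda>u. \<Sum>y\<in>{y \<in> S \<times> T. g y = u}. c (fst y) * d (snd y)"]) blast
qed

text \<open>The values q^(s_i) in terms of t and U: the coordinates m and m + 1 are t/U and 1/t, the
  others are those of \<open>W\<close>. For m = 0 the entry at index 0 is a dummy outside the range
  of the polynomials.\<close>

definition point :: "nat \<Rightarrow> (nat \<Rightarrow> complex) \<Rightarrow> complex \<Rightarrow> complex \<Rightarrow> nat \<Rightarrow> complex" where
  "point m W U t = W(m := t / U, Suc m := 1 / t)"

definition slice :: "nat \<Rightarrow> (nat \<Rightarrow> complex poly) \<Rightarrow> complex \<Rightarrow> complex poly" where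
  "slice N p t = (\<Sum>j\<le>N. monom (poly (p j) t) j)"

lemma poly_slice: "poly (slice N p t) U = (\<Sum>j\<le>N. poly (p j) t * U ^ j)"
  by (simp add: slice_def poly_sum poly_monom)

lemma poly_like_coeff_slice: "poly_like (\<lambda>t. coeff (slice N p t) j)"
proof -
  have "coeff (slice N p t) j = (\<Sum>i\<le>N. if i = j then poly (p i) t else 0)" for t
    by (simp add: slice_def coeff_sum)
  moreover have "poly_like (\<lambda>t. \<Sum>i\<le>N. if i = j then poly (p i) t else 0)"
  proof (rule poly_like_sum)
    show "poly_like (\<lambda>t. if i = j then poly (p i) t else 0)" for i
      by (cases "i = j") (simp_all add: poly_like_poly poly_like_const)
  qed
  ultimately show ?thesis by simp
qed

lemma monomial_point:
  assumes "U \<noteq> 0" "t \<noteq> 0"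
  shows "(\<Prod>i=1..Suc m. point m W U t i ^ e i) =
    (\<Prod>i\<in>{1..<m}. W i ^ e i) * ((t / U) ^ (if m = 0 then 0 else e m) * (1 / t) ^ e (Suc m))"
proof (cases "m = 0")
  case True
  then show ?thesis by (simp add: point_def)
next
  case False
  then have s: "{1..Suc m} = insert (Suc m) (insert m {1..<m})" by auto
  have "(\<Prod>i\<in>{1..<m}. point m W U t i ^ e i) = (\<Prod>i\<in>{1..<m}. W i ^ e i)"
    by (intro prod.cong) (auto simp: point_def)
  then show ?thesis unfolding s using False by (simp add: point_def)
qed

text \<open>The monomials have negative powers of U and t only through t/U and 1/t, and (U t)^N
  clears them once N is large. All N beyond a bound are allowed so that numerator and denominator
  can share one N.\<close>

lemma polynomial_fun_expansion:
  assumes "polynomial_fun (Suc m) P"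
  shows "\<exists>N0. \<forall>N\<ge>N0. \<exists>p. \<forall>U t. U \<noteq> 0 \<longrightarrow> t \<noteq> 0 \<longrightarrow> (U * t) ^ N * P (point m W U t) = poly (slice N p t) U"
proof -
  obtain S c where S: "finite S" and P: "P = (\<lambda>X. \<Sum>e\<in>S. c e * (\<Prod>i=1..Suc m. X i ^ e i))"
    using assms unfolding polynomial_fun_def by blast
  define a :: "(nat \<Rightarrow> nat) \<Rightarrow> nat" where "a e = (if m = 0 then 0 else e m)" for e
  define b :: "(nat \<Rightarrow> nat) \<Rightarrow> nat" where "b e = e (Suc m)" for e
  define w where "w e = (\<Prod>i\<in>{1..<m}. W i ^ e i)" for e
  have "\<exists>p. \<forall>U t. U \<noteq> 0 \<longrightarrow> t \<noteq> 0 \<longrightarrow> (U * t) ^ N * P (point m W U t) = poly (slice N p t) U"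
    if N: "(\<Sum>e\<in>S. a e + b e) \<le> N" for N
  proof -
    have le: "a e + b e \<le> N" if "e \<in> S" for e
      using member_le_sum[of e S "\<lambda>e. a e + b e"] that S N by simp
    define p where "p j = (\<Sum>e\<in>S. if j = N - a e then monom (c e * w e) (N + a e - b e) else 0)" for j
    have "(U * t) ^ N * P (point m W U t) = poly (slice N p t) U" if U: "U \<noteq> 0" and t: "t \<noteq> 0" for U t
    proof -
      have summand: "(U * t) ^ N * (c e * (\<Prod>i=1..Suc m. point m W U t i ^ e i)) =
          c e * w e * t ^ (N + a e - b e) * U ^ (N - a e)" if "e \<in> S" for e
      proof -
        have "U ^ N = U ^ (N - a e) * U ^ a e" using le[OF that] by (simp flip: power_add)
        moreover have "t ^ N * t ^ a e = t ^ (N + a e - b e) * t ^ b e" using le[OF that] by (simp flip: power_add)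
        moreover have "(U * t) ^ N * ((t / U) ^ a e * (1 / t) ^ b e) = (t ^ N * t ^ a e) * U ^ N / (U ^ a e * t ^ b e)"
          by (simp add: power_mult_distrib power_divide mult_ac)
        ultimately have "(U * t) ^ N * ((t / U) ^ a e * (1 / t) ^ b e) = t ^ (N + a e - b e) * U ^ (N - a e)"
          using U t by (simp only:) simp
        then show ?thesis unfolding monomial_point[OF U t] a_def[symmetric] b_def[symmetric] w_def[symmetric]
          by (simp add: mult_ac)
      qed
      have "(U * t) ^ N * P (point m W U t) = (\<Sum>e\<in>S. c e * w e * t ^ (N + a e - b e) * U ^ (N - a e))"
        unfolding P sum_distrib_left by (intro sum.cong refl summand)
      also have "\<dots> = (\<Sum>e\<in>S. \<Sum>j\<le>N. if j = N - a e then c e * w e * t ^ (N + a e - b e) * U ^ j else 0)"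
        by (intro sum.cong refl) (subst sum.delta, auto)
      also have "\<dots> = (\<Sum>j\<le>N. \<Sum>e\<in>S. if j = N - a e then c e * w e * t ^ (N + a e - b e) * U ^ j else 0)"
        by (rule sum.swap)
      also have "\<dots> = (\<Sum>j\<le>N. poly (p j) t * U ^ j)"
        unfolding p_def poly_sum sum_distrib_right
        by (intro sum.cong refl) (simp add: poly_monom)
      finally show ?thesis unfolding poly_slice .
    qed
    then show ?thesis by blast
  qed
  then show ?thesis by blast
qed

text \<open>Nothing is known at z = 0, since there the coordinate t/U has no meaning. Multiplication
  by \<open>fps_X\<close> makes both sides vanish at 0 and is cancelled afterwards.\<close>

lemma fps_eq_of_punctured:
  fixes f g :: "complex fps"
  assumes "0 < fps_conv_radius f" "0 < fps_conv_radius g" "0 < r"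
    and eq: "\<And>z. z \<noteq> 0 \<Longrightarrow> norm z < r \<Longrightarrow> eval_fps f z = eval_fps g z"
  shows "f = g"
proof -
  have r0: "0 < fps_conv_radius (fps_X * f)" "0 < fps_conv_radius (fps_X * g)"
    using fps_conv_radius_mult[of fps_X f] fps_conv_radius_mult[of fps_X g] assms(1,2) by (auto simp: min_def split: if_splits)
  have "eventually (\<lambda>z :: complex. norm z < fps_conv_radius f \<and> norm z < fps_conv_radius g \<and> norm z < r) (nhds 0)"
  proof -
    have op: "open {z :: complex. norm z < R}" for R :: ereal
    proof (cases R)
      case (real x)
      then have "{z :: complex. norm z < R} = ball 0 x" by auto
      then show ?thesis by simp
    qed auto
    have "eventually (\<lambda>z :: complex. norm z < R) (nhds 0)" if "0 < R" for R :: ereal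
      using eventually_nhds_in_open[OF op[of R], of 0] that by (simp add: zero_ereal_def)
    from this[OF assms(1)] this[OF assms(2)] this[of "ereal r"] show ?thesis
      using assms(3) by (simp add: eventually_conj_iff)
  qed
  then have "eventually (\<lambda>z. eval_fps (fps_X * f) z = eval_fps (fps_X * g) z) (nhds 0)"
  proof (rule eventually_mono)
    fix z :: complex
    assume z: "ereal (norm z) < fps_conv_radius f \<and> ereal (norm z) < fps_conv_radius g \<and> norm z < r"
    then show "eval_fps (fps_X * f) z = eval_fps (fps_X * g) z"
      using eq[of z] by (cases "z = 0") (simp_all add: eval_fps_mult)
  qed
  then have "fps_X * f = fps_X * g" by (intro eval_fps_eqD[OF r0])
  then show ?thesis by simp
qed

text \<open>What the integral contributes to the continuation argument, with the integrals over the
  classes as abstract coefficients \<open>mu\<close>. The relation \<open>PQ\<close> is free of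
  division and holds at the zeros of Q as well.\<close>

locale rational_series =
  fixes m q a0 :: nat and f :: "(nat \<Rightarrow> complex) \<Rightarrow> complex"
    and mu :: "(nat \<Rightarrow> complex) \<Rightarrow> nat \<Rightarrow> nat \<Rightarrow> complex" and P Q :: "(nat \<Rightarrow> complex) \<Rightarrow> complex"
  assumes q: "2 \<le> q"
    and P: "polynomial_fun (Suc m) P" and Q: "polynomial_fun (Suc m) Q"
    and series: "\<And>s. (\<forall>i\<in>{1..Suc m}. 0 \<le> Re (s i)) \<Longrightarrow>
      (\<lambda>a. (of_nat q powr (- s m) * of_nat q powr (- s (Suc m))) powi (int a - int a0) *
        (\<Sum>l\<le>a. mu s a l * (of_nat q powr (- s (Suc m))) powi (- int l) *
          gen_fun q l ((of_nat q powr (- s (Suc m))) ^ 2 / of_nat q ^ 2))) sums f s"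
    and mu_cong: "\<And>s s' a l. (\<And>i. i \<in> {1..<m} \<Longrightarrow> s i = s' i) \<Longrightarrow> mu s a l = mu s' a l"
    and PQ: "\<And>s. (\<forall>i\<in>{1..Suc m}. 0 \<le> Re (s i)) \<Longrightarrow> Q (q_powers q s) * f s = P (q_powers q s)"
begin

abbreviation lq :: complex where "lq \<equiv> complex_of_real (ln (real q))"

lemma lq: "lq \<noteq> 0" "0 < ln (real q)"
  using q by auto

lemma q_powr: "of_nat q powr w = exp (w * lq)"
  using q Ln_of_nat[of q] by (simp add: powr_def)

text \<open>The coefficient of U^a in U^a0 f. As \<open>mu\<close> takes exponents s_i, while
  \<open>W\<close> holds the values q^(s_i), a logarithm is chosen for each.\<close>

definition g :: "(nat \<Rightarrow> complex) \<Rightarrow> nat \<Rightarrow> complex \<Rightarrow> complex" where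
  "g W a t = (\<Sum>l\<le>a. mu (\<lambda>i. Ln (W i) / lq) a l * t powi (- int l) * gen_fun q l (t\<^sup>2 / of_nat q ^ 2))"

text \<open>The bounds on \<open>W\<close>, t and U express Re s_i >= 0 for all i. The existential y
  is U^a0 f(s) for exponents s chosen by logarithms.\<close>

lemma series_point:
  assumes W: "\<forall>i\<in>{1..<m}. 1 \<le> norm (W i)" and t: "t \<noteq> 0" "norm t \<le> 1" and U: "U \<noteq> 0" "norm U \<le> norm t"
  shows "\<exists>y. (\<lambda>a. g W a t * U ^ a) sums y \<and> U ^ a0 * P (point m W U t) = Q (point m W U t) * y"
proof -
  define s where "s i = (if i = m then - Ln (U / t) / lq else if i = Suc m then - Ln t / lq else Ln (W i) / lq)" for i
  have pt: "of_nat q powr (- s (Suc m)) = t" using t(1) lq by (simp add: q_powr s_def)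
  have pU: "of_nat q powr (- s m) = U / t" using t(1) U(1) lq by (simp add: q_powr s_def)
  have re: "Re (w / lq) = Re w / ln (real q)" for w by (rule Re_divide_of_real)
  have nonneg: "\<forall>i\<in>{1..Suc m}. 0 \<le> Re (s i)"
  proof
    fix i assume i: "i \<in> {1..Suc m}"
    consider "i = m" | "i = Suc m" | "i \<in> {1..<m}" using i by fastforce
    then show "0 \<le> Re (s i)"
    proof cases
      case 1
      have "norm (U / t) \<le> 1" using U(2) t(1) by (simp add: norm_divide)
      moreover have "0 < norm (U / t)" using U t by simp
      ultimately have "ln (norm (U / t)) \<le> 0" by (simp only: ln_le_zero_iff)
      then have "0 \<le> Re (- Ln (U / t))" using U t by (simp add: Re_Ln)
      then have "0 \<le> Re (- Ln (U / t) / lq)" unfolding re by (rule divide_nonneg_pos[OF _ lq(2)])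
      then show ?thesis unfolding s_def using 1 by simp
    next
      case 2
      have "0 < norm t" using t by simp
      then have "ln (norm t) \<le> 0" using t(2) by (simp only: ln_le_zero_iff)
      then have "0 \<le> Re (- Ln t)" using t by (simp add: Re_Ln)
      then have "0 \<le> Re (- Ln t / lq)" unfolding re by (rule divide_nonneg_pos[OF _ lq(2)])
      then show ?thesis unfolding s_def using 2 by simp
    next
      case 3
      then have w: "1 \<le> norm (W i)" using W by blast
      then have "W i \<noteq> 0" by auto
      then have "0 \<le> Re (Ln (W i))" using w by (simp add: Re_Ln)
      then have "0 \<le> Re (Ln (W i) / lq)" unfolding re by (rule divide_nonneg_pos[OF _ lq(2)])
      then show ?thesis unfolding s_def using 3 by simp
    qed
  qed
  have V: "q_powers q s i = point m W U t i" if i: "i \<in> {1..Suc m}" for i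
  proof -
    consider "i = m" | "i = Suc m" | "i \<in> {1..<m}" using i by fastforce
    then show ?thesis
    proof cases
      case 1
      have "of_nat q powr s m = inverse (of_nat q powr (- s m))" unfolding q_powr by (simp flip: exp_minus)
      then show ?thesis using 1 unfolding q_powers_def point_def pU by simp
    next
      case 2
      have "of_nat q powr s (Suc m) = inverse (of_nat q powr (- s (Suc m)))" unfolding q_powr by (simp flip: exp_minus)
      then show ?thesis using 2 unfolding q_powers_def point_def pt by (simp add: inverse_eq_divide)
    next
      case 3
      then have "1 \<le> norm (W i)" using W by blast
      then have "W i \<noteq> 0" by auto
      then show ?thesis using 3 lq(1) by (simp add: q_powers_def point_def q_powr s_def)
    qed
  qed
  have mu: "mu s a l = mu (\<lambda>i. Ln (W i) / lq) a l" for a l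
    by (rule mu_cong) (auto simp: s_def)
  have "U / t * t = U" using t by simp
  then have "(\<lambda>a. U powi (int a - int a0) * g W a t) sums f s"
    using series[OF nonneg] unfolding pt pU g_def mu by simp
  then have "(\<lambda>a. U ^ a0 * (U powi (int a - int a0) * g W a t)) sums (U ^ a0 * f s)" by (rule sums_mult)
  moreover have "U ^ a0 * (U powi (int a - int a0) * g W a t) = g W a t * U ^ a" for a
    using U(1) by (simp add: power_int_diff)
  ultimately have "(\<lambda>a. g W a t * U ^ a) sums (U ^ a0 * f s)" by simp
  moreover have "Q (point m W U t) * f s = P (point m W U t)"
    using PQ[OF nonneg] polynomial_fun_cong[OF P V] polynomial_fun_cong[OF Q V] by simp
  ultimately show ?thesis by (intro exI[of _ "U ^ a0 * f s"]) (simp add: mult_ac)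
qed

text \<open>\<open>g\<close> cleared of its denominators t^a (1 - Y^2), see \<open>g_h\<close>. It
  is a polynomial in t, which lets identities leave the unit disc.\<close>

definition h :: "(nat \<Rightarrow> complex) \<Rightarrow> nat \<Rightarrow> complex \<Rightarrow> complex" where
  "h W a t = (\<Sum>l\<le>a. mu (\<lambda>i. Ln (W i) / lq) a l * t ^ (a - l) *
     ((of_nat q + t\<^sup>2 / of_nat q ^ 2) * ((of_nat q ^ 2 - t\<^sup>2 / of_nat q ^ 2) -
       (1 - of_nat q ^ 2 * (t\<^sup>2 / of_nat q ^ 2)) * (- (t\<^sup>2 / of_nat q ^ 2)) ^ l) / (of_nat q ^ 3 + 1)))"

lemma g_h:
  assumes t: "t \<noteq> 0" and Y: "1 - (t\<^sup>2 / of_nat q ^ 2)\<^sup>2 \<noteq> 0"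
  shows "g W a t * (t ^ a * (1 - (t\<^sup>2 / of_nat q ^ 2)\<^sup>2)) = h W a t"
proof -
  have gen_fun: "gen_fun q l y * (1 - y\<^sup>2) = (of_nat q + y) * ((of_nat q ^ 2 - y) - (1 - of_nat q ^ 2 * y) * (- y) ^ l) / (of_nat q ^ 3 + 1)"
    if "1 - y\<^sup>2 \<noteq> 0" for l y
    using that by (simp add: gen_fun_def)
  have pw: "t powi (- int l) * t ^ a = t ^ (a - l)" if "l \<le> a" for l
    using t that by (simp add: power_int_minus power_diff divide_inverse mult.commute)
  show ?thesis unfolding g_def h_def sum_distrib_right
  proof (intro sum.cong refl)
    fix l assume l: "l \<in> {..a}"
    define y where "y = t\<^sup>2 / of_nat q ^ 2"
    have "c * T * G * (Ta * Z) = c * (T * Ta) * (G * Z)" for c T G Ta Z :: complex by simp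
    then have "mu (\<lambda>i. Ln (W i) / lq) a l * t powi (- int l) * gen_fun q l y * (t ^ a * (1 - y\<^sup>2)) =
      mu (\<lambda>i. Ln (W i) / lq) a l * (t powi (- int l) * t ^ a) * (gen_fun q l y * (1 - y\<^sup>2))" .
    also have "\<dots> = mu (\<lambda>i. Ln (W i) / lq) a l * t ^ (a - l) *
       ((of_nat q + y) * ((of_nat q ^ 2 - y) - (1 - of_nat q ^ 2 * y) * (- y) ^ l) / (of_nat q ^ 3 + 1))"
      unfolding gen_fun[OF Y[folded y_def]] using pw[of l] l by simp
    finally show "mu (\<lambda>i. Ln (W i) / lq) a l * t powi (- int l) * gen_fun q l (t\<^sup>2 / of_nat q ^ 2) *
        (t ^ a * (1 - (t\<^sup>2 / of_nat q ^ 2)\<^sup>2)) = mu (\<lambda>i. Ln (W i) / lq) a l * t ^ (a - l) *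
       ((of_nat q + t\<^sup>2 / of_nat q ^ 2) * ((of_nat q ^ 2 - t\<^sup>2 / of_nat q ^ 2) -
       (1 - of_nat q ^ 2 * (t\<^sup>2 / of_nat q ^ 2)) * (- (t\<^sup>2 / of_nat q ^ 2)) ^ l) / (of_nat q ^ 3 + 1))"
      unfolding y_def .
  qed
qed

text \<open>Under y -> 1/y the two terms of the bracket in the numerator change places up to the
  factor y (-y)^l, and (-y)^l is what t^(-l) acquires under t -> - q^2/t. The sign comes from 1 -
  y^2 in the denominator, and the factor q + y, replaced by q + 1/y, leaves the quotient of q y + 1
  by q + y.\<close>

lemma gen_fun_symmetry:
  assumes t: "t \<noteq> 0" and Y: "1 - y\<^sup>2 \<noteq> 0" and y: "y = t\<^sup>2 / of_nat q ^ 2"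
  shows "(- (of_nat q ^ 2) / t) powi (- int l) * gen_fun q l (1 / y) * (of_nat q + y) =
    - (of_nat q * y + 1) * (t powi (- int l) * gen_fun q l y)"
proof -
  define c where "c = (of_nat q :: complex)"
  have c: "c \<noteq> 0" using q by (simp add: c_def)
  have y0: "y \<noteq> 0" using t c by (simp add: y c_def)
  have "(- (c ^ 2) / t) powi (- int l) = (- (t / c ^ 2)) ^ l"
    by (simp add: power_int_minus flip: power_inverse)
  also have "- (t / c ^ 2) = inverse t * (- y)" using t by (simp add: y c_def power2_eq_square)
  finally have p: "(- (c ^ 2) / t) powi (- int l) = t powi (- int l) * (- y) ^ l"
    by (simp only: power_mult_distrib power_int_minus power_inverse power_int_of_nat)
  define w where "w = (- y) ^ l"
  have w0: "w \<noteq> 0" using y0 by (simp add: w_def)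
  have yl: "(- (1 / y)) ^ l = 1 / w" by (simp add: w_def power_one_over flip: divide_minus_right)
  have Y': "y\<^sup>2 - 1 \<noteq> 0" "1 - (1 / y)\<^sup>2 \<noteq> 0"
    using Y y0 by (auto simp: power_divide)
  have E: "w * ((c + 1 / y) * ((c\<^sup>2 - 1 / y) - (1 - c\<^sup>2 * (1 / y)) * (1 / w)) / ((1 - (1 / y)\<^sup>2) * r)) * (c + y) =
     - (c * y + 1) * ((c + y) * ((c\<^sup>2 - y) - (1 - c\<^sup>2 * y) * w) / ((1 - y\<^sup>2) * r))" for r
  proof -
    have n: "w * (y\<^sup>2 * ((c + 1 / y) * ((c\<^sup>2 - 1 / y) - (1 - c\<^sup>2 * (1 / y)) * (1 / w)))) =
       (c * y + 1) * ((c\<^sup>2 - y) - (1 - c\<^sup>2 * y) * w)"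
      using y0 w0 by (simp add: field_simps power2_eq_square)
    have d: "y\<^sup>2 * (1 - (1 / y)\<^sup>2) = - (1 - y\<^sup>2)"
      using y0 by (simp add: field_simps power2_eq_square)
    have "A / (B * r) = (y\<^sup>2 * A) / ((y\<^sup>2 * B) * r)" for A B using y0 by simp
    then have "w * ((c + 1 / y) * ((c\<^sup>2 - 1 / y) - (1 - c\<^sup>2 * (1 / y)) * (1 / w)) / ((1 - (1 / y)\<^sup>2) * r)) * (c + y) =
      w * ((y\<^sup>2 * ((c + 1 / y) * ((c\<^sup>2 - 1 / y) - (1 - c\<^sup>2 * (1 / y)) * (1 / w)))) / (y\<^sup>2 * (1 - (1 / y)\<^sup>2) * r)) * (c + y)"
      by (simp only: mult.assoc)
    also have "\<dots> = (w * (y\<^sup>2 * ((c + 1 / y) * ((c\<^sup>2 - 1 / y) - (1 - c\<^sup>2 * (1 / y)) * (1 / w))))) / (y\<^sup>2 * (1 - (1 / y)\<^sup>2) * r) * (c + y)"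
      by (simp only: times_divide_eq_right)
    also have "\<dots> = - (c * y + 1) * ((c + y) * ((c\<^sup>2 - y) - (1 - c\<^sup>2 * y) * w) / ((1 - y\<^sup>2) * r))"
    proof -
      have "(k * B) / (- z * r) * u = - k * (u * B / (z * r))" for k B z u
        by (simp add: divide_inverse mult_ac)
      then show ?thesis unfolding n d .
    qed
    finally show ?thesis .
  qed
  have "(- (c ^ 2) / t) powi (- int l) * gen_fun q l (1 / y) * (c + y) =
    t powi (- int l) * (w * ((c + 1 / y) * ((c\<^sup>2 - 1 / y) - (1 - c\<^sup>2 * (1 / y)) * (1 / w)) / ((1 - (1 / y)\<^sup>2) * (c ^ 3 + 1))) * (c + y))"
    unfolding p gen_fun_def yl c_def[symmetric] w_def[symmetric] by (simp only: mult.assoc)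
  also have "\<dots> = - (c * y + 1) * (t powi (- int l) * gen_fun q l y)"
    unfolding E gen_fun_def c_def[symmetric] w_def[symmetric] by (simp only: mult.left_commute)
  finally show ?thesis unfolding c_def .
qed

lemma g_symmetry:
  assumes t: "t \<noteq> 0" and Y: "1 - (t\<^sup>2 / of_nat q ^ 2)\<^sup>2 \<noteq> 0"
  shows "g W a (- (of_nat q ^ 2) / t) * (of_nat q + t\<^sup>2 / of_nat q ^ 2) = - (of_nat q * (t\<^sup>2 / of_nat q ^ 2) + 1) * g W a t"
proof -
  have y: "(- (of_nat q ^ 2) / t)\<^sup>2 / of_nat q ^ 2 = 1 / (t\<^sup>2 / of_nat q ^ 2)"
    using t q by (simp add: power_divide power2_eq_square)
  show ?thesis unfolding g_def y sum_distrib_right sum_distrib_left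
  proof (intro sum.cong refl)
    fix l
    have r: "c * T * G * z = c * (T * G * z)" "k * (c * S * H) = c * (k * (S * H))" for c T G z k S H :: complex
      by (simp_all add: mult_ac)
    show "mu (\<lambda>i. Ln (W i) / lq) a l * (- (of_nat q ^ 2) / t) powi (- int l) * gen_fun q l (1 / (t\<^sup>2 / of_nat q ^ 2)) *
        (of_nat q + t\<^sup>2 / of_nat q ^ 2) = - (of_nat q * (t\<^sup>2 / of_nat q ^ 2) + 1) *
        (mu (\<lambda>i. Ln (W i) / lq) a l * t powi (- int l) * gen_fun q l (t\<^sup>2 / of_nat q ^ 2))"
      unfolding r gen_fun_symmetry[OF t Y refl] ..
  qed
qed

section \<open>Elimination of the series for a fixed choice of the other coordinates\<close>

context
  fixes W :: "nat \<Rightarrow> complex" and N :: nat and \<alpha> \<beta> :: "nat \<Rightarrow> complex poly"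
  assumes W: "\<forall>i\<in>{1..<m}. 1 \<le> norm (W i)"
    and \<alpha>: "\<forall>U t. (U :: complex) \<noteq> 0 \<longrightarrow> t \<noteq> 0 \<longrightarrow> (U * t) ^ N * P (point m W U t) = poly (slice N \<alpha> t) U"
    and \<beta>: "\<forall>U t. (U :: complex) \<noteq> 0 \<longrightarrow> t \<noteq> 0 \<longrightarrow> (U * t) ^ N * Q (point m W U t) = poly (slice N \<beta> t) U"
begin

lemma fps_identity_disc:
  assumes t: "t \<noteq> 0" "norm t \<le> 1"
  shows "fps_X ^ a0 * fps_of_poly (slice N \<alpha> t) = fps_of_poly (slice N \<beta> t) * Abs_fps (\<lambda>a. g W a t)"
proof (rule fps_eq_of_punctured)
  let ?G = "Abs_fps (\<lambda>a. g W a t)"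
  obtain y where "(\<lambda>a. g W a t * t ^ a) sums y" using series_point[OF W t t(1) order_refl] by blast
  then have "summable (\<lambda>a. fps_nth ?G a * t ^ a)" by (auto simp: sums_iff)
  then have G: "ereal (norm t) \<le> fps_conv_radius ?G" unfolding fps_conv_radius_def by (rule conv_radius_geI)
  moreover have "(0 :: ereal) < ereal (norm t)" using t by simp
  ultimately have G0: "0 < fps_conv_radius ?G" by (meson less_le_trans)
  show "0 < fps_conv_radius (fps_X ^ a0 * fps_of_poly (slice N \<alpha> t))"
    using fps_conv_radius_mult[of "fps_X ^ a0" "fps_of_poly (slice N \<alpha> t)"] by simp
  show "0 < fps_conv_radius (fps_of_poly (slice N \<beta> t) * ?G)"
    using fps_conv_radius_mult[of "fps_of_poly (slice N \<beta> t)" ?G] G0 by simp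
  show "0 < norm t" using t by simp
  fix U :: complex assume U: "U \<noteq> 0" "norm U < norm t"
  then obtain y where y: "(\<lambda>a. g W a t * U ^ a) sums y" "U ^ a0 * P (point m W U t) = Q (point m W U t) * y"
    using series_point[OF W t U(1)] by auto
  have "ereal (norm U) < ereal (norm t)" using U(2) by simp
  then have UG: "ereal (norm U) < fps_conv_radius ?G" using G by (rule less_le_trans)
  have ev: "eval_fps ?G U = y" using y(1) by (simp add: eval_fps_def sums_iff)
  have "eval_fps (fps_X ^ a0 * fps_of_poly (slice N \<alpha> t)) U = U ^ a0 * poly (slice N \<alpha> t) U"
    by (subst eval_fps_mult) auto
  also have "\<dots> = (U * t) ^ N * (U ^ a0 * P (point m W U t))"
    using \<alpha>[rule_format, OF U(1) t(1)] by (simp add: mult_ac)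
  also have "\<dots> = poly (slice N \<beta> t) U * y"
    unfolding y(2) using \<beta>[rule_format, OF U(1) t(1)] by (simp add: mult_ac)
  also have "\<dots> = eval_fps (fps_of_poly (slice N \<beta> t) * ?G) U"
    using UG by (subst eval_fps_mult) (auto simp: ev)
  finally show "eval_fps (fps_X ^ a0 * fps_of_poly (slice N \<alpha> t)) U = eval_fps (fps_of_poly (slice N \<beta> t) * ?G) U" .
qed

lemma disc_bound:
  assumes "norm (t :: complex) \<le> 1"
  shows "1 - (t\<^sup>2 / of_nat q ^ 2)\<^sup>2 \<noteq> 0"
proof
  assume "1 - (t\<^sup>2 / of_nat q ^ 2)\<^sup>2 = 0"
  then have "norm ((t\<^sup>2 / of_nat q ^ 2)\<^sup>2) = 1" by simp
  then have "norm t ^ 4 = real q ^ 4" using q by (simp add: norm_divide norm_power field_simps)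
  moreover have "norm t ^ 4 \<le> 1" using assms by (simp add: power_le_one)
  moreover have "1 < real q ^ 4" using q by (intro one_less_power) auto
  ultimately show False by simp
qed

text \<open>After multiplication by t^j (1 - Y^2) the j-th coefficients of both sides are
  polynomials in t. They agree at the points 1/(n+1) of the unit disc, hence for all t. The identity
  is one of formal series in U, so convergence outside the disc is not an issue.\<close>

lemma fps_identity:
  assumes t: "t \<noteq> 0" and Y: "1 - (t\<^sup>2 / of_nat q ^ 2)\<^sup>2 \<noteq> 0"
  shows "fps_X ^ a0 * fps_of_poly (slice N \<alpha> t) = fps_of_poly (slice N \<beta> t) * Abs_fps (\<lambda>a. g W a t)"
proof (rule fps_ext)
  fix j
  define L where "L t = (if j < a0 then 0 else coeff (slice N \<alpha> t) (j - a0))" for t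
  define Z where "Z t = 1 - (t\<^sup>2 / of_nat q ^ 2 :: complex)\<^sup>2" for t
  have fps: "fps_nth (fps_X ^ a0 * fps_of_poly (slice N \<alpha> t)) j = L t"
    "fps_nth (fps_of_poly (slice N \<beta> t) * Abs_fps (\<lambda>a. g W a t)) j = (\<Sum>i\<le>j. coeff (slice N \<beta> t) i * g W (j - i) t)" for t
    unfolding fps_X_power_mult_nth L_def by (simp, simp add: fps_mult_nth atLeast0AtMost)
  have scale: "(\<Sum>i\<le>j. coeff (slice N \<beta> t) i * g W (j - i) t) * (t ^ j * Z t) =
     (\<Sum>i\<le>j. coeff (slice N \<beta> t) i * (h W (j - i) t * t ^ i))" if "t \<noteq> 0" "Z t \<noteq> 0" for t
    unfolding sum_distrib_right
  proof (intro sum.cong refl)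
    fix i assume "i \<in> {..j}"
    then have "t ^ j = t ^ (j - i) * t ^ i" by (simp flip: power_add)
    moreover have "h W (j - i) t = g W (j - i) t * (t ^ (j - i) * Z t)" using g_h[of t W "j - i"] that by (simp add: Z_def)
    ultimately show "coeff (slice N \<beta> t) i * g W (j - i) t * (t ^ j * Z t) = coeff (slice N \<beta> t) i * (h W (j - i) t * t ^ i)"
      by (simp add: mult_ac)
  qed
  have "L t * (t ^ j * Z t) = (\<Sum>i\<le>j. coeff (slice N \<beta> t) i * (h W (j - i) t * t ^ i))"
  proof (rule poly_like_eqI[where f = "\<lambda>t. L t * (t ^ j * Z t)" and
      g = "\<lambda>t. \<Sum>i\<le>j. coeff (slice N \<beta> t) i * (h W (j - i) t * t ^ i)"])
    show "poly_like (\<lambda>t. L t * (t ^ j * Z t))"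
    proof (intro poly_like_mult)
      show "poly_like L" unfolding L_def by (cases "j < a0") (simp_all add: poly_like_const poly_like_coeff_slice)
      show "poly_like (\<lambda>t. t ^ j)" "poly_like Z" unfolding Z_def by (intro poly_like_intros)+
    qed
    show "poly_like (\<lambda>t. \<Sum>i\<le>j. coeff (slice N \<beta> t) i * (h W (j - i) t * t ^ i))"
      unfolding h_def by (intro poly_like_intros poly_like_coeff_slice)
    show "infinite (range (\<lambda>n. 1 / complex_of_nat (Suc n)))"
      by (intro range_inj_infinite) (auto simp: inj_def simp del: of_nat_Suc)
    fix t assume "t \<in> range (\<lambda>n. 1 / complex_of_nat (Suc n))"
    then obtain n where "t = 1 / complex_of_nat (Suc n)" by blast
    then have t: "t \<noteq> 0" "norm t \<le> 1" by (simp_all add: norm_divide del: of_nat_Suc)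
    show "L t * (t ^ j * Z t) = (\<Sum>i\<le>j. coeff (slice N \<beta> t) i * (h W (j - i) t * t ^ i))"
      using arg_cong[OF fps_identity_disc[OF t], of "\<lambda>F. fps_nth F j"] scale[of t] t(1) disc_bound[OF t(2)]
      unfolding fps Z_def by simp
  qed
  then have "L t * (t ^ j * Z t) = (\<Sum>i\<le>j. coeff (slice N \<beta> t) i * g W (j - i) t) * (t ^ j * Z t)"
    using scale[of t] t Y by (simp add: Z_def)
  then have "L t = (\<Sum>i\<le>j. coeff (slice N \<beta> t) i * g W (j - i) t)" using t Y by (simp add: Z_def)
  then show "fps_nth (fps_X ^ a0 * fps_of_poly (slice N \<alpha> t)) j = fps_nth (fps_of_poly (slice N \<beta> t) * Abs_fps (\<lambda>a. g W a t)) j"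
    unfolding fps .
qed

text \<open>The series at t and at its image t' are proportional by \<open>g_symmetry\<close>.
  Multiplying the identity at each point by the denominator at the other eliminates them without a
  division, so the denominators may vanish identically in U; only the power of \<open>fps_X\<close>
  is cancelled.\<close>

lemma slice_symmetry:
  assumes t: "t \<noteq> 0" and Y: "1 - (t\<^sup>2 / of_nat q ^ 2)\<^sup>2 \<noteq> 0"
  defines "t' \<equiv> - (of_nat q ^ 2) / t"
  shows "poly (slice N \<alpha> t') U * poly (slice N \<beta> t) U * (of_nat q + t\<^sup>2 / of_nat q ^ 2) =
    - (of_nat q * (t\<^sup>2 / of_nat q ^ 2) + 1) * (poly (slice N \<beta> t') U * poly (slice N \<alpha> t) U)"
proof -
  define A where "A t = fps_of_poly (slice N \<alpha> t)" for t
  define B where "B t = fps_of_poly (slice N \<beta> t)" for t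
  define G where "G t = Abs_fps (\<lambda>a. g W a t)" for t
  define u where "u = of_nat q + t\<^sup>2 / of_nat q ^ 2"
  define w where "w = - (of_nat q * (t\<^sup>2 / of_nat q ^ 2) + 1)"
  have t': "t' \<noteq> 0" using t q by (simp add: t'_def)
  have y: "t'\<^sup>2 / of_nat q ^ 2 = 1 / (t\<^sup>2 / of_nat q ^ 2)"
    using t q by (simp add: t'_def power_divide power2_eq_square)
  have Y': "1 - (t'\<^sup>2 / of_nat q ^ 2)\<^sup>2 \<noteq> 0"
    unfolding y using Y t q by (simp add: power_divide)
  have 1: "fps_X ^ a0 * A t = B t * G t" unfolding A_def B_def G_def by (rule fps_identity[OF t Y])
  have 2: "fps_X ^ a0 * A t' = B t' * G t'" unfolding A_def B_def G_def by (rule fps_identity[OF t' Y'])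
  have 3: "G t' * fps_const u = fps_const w * G t"
  proof (rule fps_ext)
    fix n
    have "g W n t' * u = w * g W n t" unfolding u_def w_def t'_def by (rule g_symmetry[OF t Y])
    then show "fps_nth (G t' * fps_const u) n = fps_nth (fps_const w * G t) n" by (simp add: G_def)
  qed
  have "fps_X ^ a0 * (A t' * B t * fps_const u) = (fps_X ^ a0 * A t') * (B t * fps_const u)" by (simp only: mult.assoc)
  also have "\<dots> = B t' * B t * (G t' * fps_const u)" unfolding 2 by (simp only: mult_ac)
  also have "\<dots> = fps_const w * B t' * (B t * G t)" unfolding 3 by (simp only: mult_ac)
  also have "\<dots> = fps_X ^ a0 * (fps_const w * (B t' * A t))" unfolding 1[symmetric] by (simp only: mult_ac)
  finally have "A t' * B t * fps_const u = fps_const w * (B t' * A t)" by simp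
  then have "fps_of_poly (slice N \<alpha> t' * slice N \<beta> t * [:u:]) = fps_of_poly ([:w:] * (slice N \<beta> t' * slice N \<alpha> t))"
    unfolding A_def B_def fps_of_poly_mult fps_of_poly_const .
  then have "slice N \<alpha> t' * slice N \<beta> t * [:u:] = [:w:] * (slice N \<beta> t' * slice N \<alpha> t)"
    unfolding fps_of_poly_eq_iff .
  then have "poly (slice N \<alpha> t' * slice N \<beta> t * [:u:]) U = poly ([:w:] * (slice N \<beta> t' * slice N \<alpha> t)) U" by simp
  then show ?thesis unfolding u_def w_def by (simp add: mult_ac)
qed

end

text \<open>The failure of the cross-multiplied functional equation. Written as a function of
  \<open>W\<close>, it is a polynomial in each coordinate.\<close>

definition defect :: "complex \<Rightarrow> complex \<Rightarrow> (nat \<Rightarrow> complex) \<Rightarrow> complex" where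
  "defect U t W = P (point m W U (- (of_nat q ^ 2) / t)) * Q (point m W U t) * (of_nat q + t\<^sup>2 / of_nat q ^ 2) +
    (of_nat q * (t\<^sup>2 / of_nat q ^ 2) + 1) * (Q (point m W U (- (of_nat q ^ 2) / t)) * P (point m W U t))"

lemma defect_generic:
  assumes W: "\<forall>i\<in>{1..<m}. 1 \<le> norm (W i)" and U: "U \<noteq> 0" and t: "t \<noteq> 0" and Y: "1 - (t\<^sup>2 / of_nat q ^ 2)\<^sup>2 \<noteq> 0"
  shows "defect U t W = 0"
proof -
  obtain N1 N2 where N: "\<forall>N\<ge>N1. \<exists>\<alpha>. \<forall>U t. U \<noteq> 0 \<longrightarrow> t \<noteq> 0 \<longrightarrow> (U * t) ^ N * P (point m W U t) = poly (slice N \<alpha> t) U"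
    "\<forall>N\<ge>N2. \<exists>\<beta>. \<forall>U t. U \<noteq> 0 \<longrightarrow> t \<noteq> 0 \<longrightarrow> (U * t) ^ N * Q (point m W U t) = poly (slice N \<beta> t) U"
    using polynomial_fun_expansion[OF P, of W] polynomial_fun_expansion[OF Q, of W] by blast
  define N where "N = max N1 N2"
  obtain \<alpha> where \<alpha>: "\<forall>U t. U \<noteq> 0 \<longrightarrow> t \<noteq> 0 \<longrightarrow> (U * t) ^ N * P (point m W U t) = poly (slice N \<alpha> t) U"
    using N(1)[rule_format, of N] by (auto simp: N_def)
  obtain \<beta> where \<beta>: "\<forall>U t. U \<noteq> 0 \<longrightarrow> t \<noteq> 0 \<longrightarrow> (U * t) ^ N * Q (point m W U t) = poly (slice N \<beta> t) U"
    using N(2)[rule_format, of N] by (auto simp: N_def)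
  define t' where "t' = - (of_nat q ^ 2) / t"
  have t': "t' \<noteq> 0" using t q by (simp add: t'_def)
  define c where "c = (U * t') ^ N * (U * t) ^ N"
  have c: "c \<noteq> 0" using U t t' by (simp add: c_def)
  have "c * (P (point m W U t') * Q (point m W U t) * (of_nat q + t\<^sup>2 / of_nat q ^ 2)) =
     c * (- (of_nat q * (t\<^sup>2 / of_nat q ^ 2) + 1) * (Q (point m W U t') * P (point m W U t)))"
    using slice_symmetry[OF W \<alpha> \<beta> t Y, of U]
    unfolding \<alpha>[rule_format, OF U t, symmetric] \<beta>[rule_format, OF U t, symmetric] t'_def[symmetric]
      \<alpha>[rule_format, OF U t', symmetric] \<beta>[rule_format, OF U t', symmetric] c_def
    by (simp only: mult_ac)
  then have "P (point m W U t') * Q (point m W U t) * (of_nat q + t\<^sup>2 / of_nat q ^ 2) =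
     - (of_nat q * (t\<^sup>2 / of_nat q ^ 2) + 1) * (Q (point m W U t') * P (point m W U t))"
    using c by (metis mult_left_cancel)
  moreover have "A = - k * B \<Longrightarrow> A + k * B = 0" for A k B :: complex by simp
  ultimately show ?thesis unfolding defect_def t'_def[symmetric] by blast
qed

lemma finite_exceptional: "finite {t :: complex. 1 - (t\<^sup>2 / of_nat q ^ 2)\<^sup>2 = 0}"
proof -
  have "poly_like (\<lambda>t. 1 - (t\<^sup>2 / of_nat q ^ 2)\<^sup>2)" by (intro poly_like_intros)
  then obtain r where r: "\<forall>t :: complex. 1 - (t\<^sup>2 / of_nat q ^ 2)\<^sup>2 = poly r t" unfolding poly_like_def by blast
  have "poly r 0 \<noteq> 0" using r[rule_format, of 0] by auto
  then have "r \<noteq> 0" by auto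
  then show ?thesis using poly_roots_finite[of r] r by simp
qed

text \<open>At the finitely many t with Y^2 = 1, where the generating function has its denominator
  zero, the claim follows by continuity from neighbouring t.\<close>

lemma defect_nonzero_t:
  assumes W: "\<forall>i\<in>{1..<m}. 1 \<le> norm (W i)" and U: "U \<noteq> 0" and t: "t \<noteq> 0"
  shows "defect U t W = 0"
proof -
  define E where "E = {t :: complex. 1 - (t\<^sup>2 / of_nat q ^ 2)\<^sup>2 = 0}"
  have V: "isCont (\<lambda>t. point m W U t i) t" "isCont (\<lambda>t. point m W U (- (of_nat q ^ 2) / t) i) t" for i
  proof -
    have "isCont (\<lambda>t. t / U) t" "isCont (\<lambda>t. 1 / t) t" "isCont (\<lambda>t. - (of_nat q ^ 2) / t / U) t"
      "isCont (\<lambda>t. 1 / (- (of_nat q ^ 2) / t)) t"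
      using U t q by (auto intro!: continuous_intros)
    then show "isCont (\<lambda>t. point m W U t i) t" "isCont (\<lambda>t. point m W U (- (of_nat q ^ 2) / t) i) t"
      unfolding point_def by (cases "i = Suc m"; cases "i = m"; simp)+
  qed
  have "isCont (\<lambda>t. defect U t W) t"
    unfolding defect_def
    by (intro continuous_intros polynomial_fun_isCont[OF P] polynomial_fun_isCont[OF Q] V) (use q in auto)
  then have lim: "((\<lambda>t. defect U t W) \<longlongrightarrow> defect U t W) (at t)" unfolding isCont_def .
  have "open (- (E - {t}) \<inter> - {0})"
    using finite_exceptional by (intro open_Int open_Compl finite_imp_closed) (auto simp: E_def)
  then have "eventually (\<lambda>u. defect U u W = 0) (at t)"
    unfolding eventually_at_topological
    using t defect_generic[OF W U] by (intro exI[of _ "- (E - {t}) \<inter> - {0}"]) (auto simp: E_def)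
  then have "((\<lambda>t. defect U t W) \<longlongrightarrow> 0) (at t)" by (rule tendsto_eventually)
  with lim show ?thesis by (intro tendsto_unique[OF trivial_limit_at])
qed

text \<open>The bound |\<open>W i\<close>| >= 1 from the domain of convergence is removed one
  coordinate at a time: in the coordinate \<open>Suc j\<close> the defect is a polynomial that
  vanishes at all positive integers.\<close>

lemma defect_zero:
  assumes U: "U \<noteq> 0" and t: "t \<noteq> 0"
  shows "defect U t W = 0"
proof -
  have "\<forall>W. (\<forall>i\<in>{Suc j..<m}. 1 \<le> norm (W i)) \<longrightarrow> defect U t W = 0" for j
  proof (induction j)
    case 0
    then show ?case using defect_nonzero_t[OF _ U t] by simp
  next
    case (Suc j)
    show ?case
    proof (intro allI impI)
      fix W :: "nat \<Rightarrow> complex" assume W: "\<forall>i\<in>{Suc (Suc j)..<m}. 1 \<le> norm (W i)"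
      have V: "poly_like (\<lambda>w. point m (W(Suc j := w)) U u i)" for u i
        unfolding point_def by (cases "i = Suc m"; cases "i = m"; cases "i = Suc j"; simp add: poly_like_const poly_like_id)
      have "defect U t (W(Suc j := w)) = 0" for w
      proof (rule poly_like_eqI[where f = "\<lambda>w. defect U t (W(Suc j := w))" and g = "\<lambda>w. 0"])
        show "poly_like (\<lambda>w. defect U t (W(Suc j := w)))"
          unfolding defect_def
          by (intro poly_like_add poly_like_mult poly_like_const polynomial_fun_polyex[OF P] polynomial_fun_polyex[OF Q] V)
        show "poly_like (\<lambda>w. 0)" by (rule poly_like_const)
        show "infinite (range (\<lambda>n. complex_of_nat (Suc n)))"
          by (intro range_inj_infinite) (auto simp: inj_def simp del: of_nat_Suc)
        fix w assume "w \<in> range (\<lambda>n. complex_of_nat (Suc n))"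
        then have "1 \<le> norm w" by (auto simp del: of_nat_Suc)
        then have "\<forall>i\<in>{Suc j..<m}. 1 \<le> norm ((W(Suc j := w)) i)" using W by auto
        then show "defect U t (W(Suc j := w)) = 0" using Suc.IH by blast
      qed
      from this[of "W (Suc j)"] show "defect U t W = 0" by simp
    qed
  qed
  from this[of m] show ?thesis by simp
qed

end

section \<open>The functional equation\<close>

text \<open>The continuation controls omega only where Q is not 0, so Q omega = P may fail at zeros
  of Q. One more factor Q repairs this: Q^2 omega = P Q holds on the whole domain, which is why the
  series carries these products.\<close>

lemma (in haar_setup) omega_rational_series:
  assumes "rational_continuation (Suc m) q (omega star v (Suc m) M x) P Q"
  shows "\<exists>a0 mu. rational_series m q a0 (omega star v (Suc m) M x) mu (\<lambda>X. P X * Q X) (\<lambda>X. Q X * Q X)"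
proof -
  have PQ: "polynomial_fun (Suc m) P" "polynomial_fun (Suc m) Q"
    and c: "\<And>s. (\<forall>i\<in>{1..Suc m}. 0 \<le> Re (s i)) \<Longrightarrow> Q (q_powers q s) \<noteq> 0 \<Longrightarrow>
      omega star v (Suc m) M x s = P (q_powers q s) / Q (q_powers q s)"
    using assms unfolding rational_continuation_def by auto
  from omega_series obtain a0 where a0: "\<forall>s. re_nonneg s \<longrightarrow> (\<lambda>a. (Qs (s m) * Qs (s (Suc m))) powi (int a - int a0) *
     (\<Sum>l\<le>a. mass s (int a - int a0) l 0 * Qs (s (Suc m)) powi (- int l) *
       gen_fun q l (Qs (s (Suc m)) ^ 2 / of_nat q ^ 2))) sums omega star v (Suc m) M x s" by blast
  have "rational_series m q a0 (omega star v (Suc m) M x) (\<lambda>s a l. mass s (int a - int a0) l 0)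
    (\<lambda>X. P X * Q X) (\<lambda>X. Q X * Q X)"
  proof (rule rational_series.intro)
    show "2 \<le> q" by (rule pi_props(5))
    show "polynomial_fun (Suc m) (\<lambda>X. P X * Q X)" "polynomial_fun (Suc m) (\<lambda>X. Q X * Q X)"
      by (intro polynomial_fun_mult PQ)+
    fix s :: "nat \<Rightarrow> complex" assume s: "\<forall>i\<in>{1..Suc m}. 0 \<le> Re (s i)"
    show "(\<lambda>a. (of_nat q powr (- s m) * of_nat q powr (- s (Suc m))) powi (int a - int a0) *
        (\<Sum>l\<le>a. mass s (int a - int a0) l 0 * (of_nat q powr (- s (Suc m))) powi (- int l) *
          gen_fun q l ((of_nat q powr (- s (Suc m))) ^ 2 / of_nat q ^ 2))) sums omega star v (Suc m) M x s"
      using a0 s unfolding re_nonneg_def Qs_def by blast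
    show "Q (q_powers q s) * Q (q_powers q s) * omega star v (Suc m) M x s = P (q_powers q s) * Q (q_powers q s)"
      using c[OF s] by (cases "Q (q_powers q s) = 0") simp_all
  next
    fix s s' :: "nat \<Rightarrow> complex" and a l
    assume "\<And>i. i \<in> {1..<m} \<Longrightarrow> s i = s' i"
    then show "mass s (int a - int a0) l 0 = mass s' (int a - int a0) l 0" by (rule mass_cong)
  qed
  then show ?thesis by blast
qed

context rational_series
begin

text \<open>With e = q^(z_n), the shift by \<pi> i/(2 log q) contributes the factor i to q^(s_n), so
  t = - i q e. Replacing e by its inverse sends t to - q^2/t. It multiplies q^(s_m) by e^(-2),
  exactly as t/U changes for fixed U.\<close>

lemma s_of_z_point:
  fixes z :: "nat \<Rightarrow> complex"
  defines "e \<equiv> of_nat q powr z (Suc m)"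
  defines "W \<equiv> q_powers q (s_of_z (Suc m) q z)"
  defines "U \<equiv> inverse (W m) * (- \<i> * of_nat q * e)"
  assumes i: "i \<in> {1..Suc m}"
  shows "W i = point m W U (- \<i> * of_nat q * e) i"
    and "q_powers q (s_of_z (Suc m) q (tau (Suc m) z)) i = point m W U (- \<i> * of_nat q / e) i"
proof -
  have eW: "W j \<noteq> 0" "e \<noteq> 0" for j by (simp_all add: W_def e_def q_powers_def q_powr)
  have q0: "of_nat q \<noteq> (0 :: complex)" using q by simp
  have eq: "exp lq = of_nat q" using exp_of_real[of "ln (real q)"] q by simp
  \<comment> \<open>The quarter period in the definition of s_n: exp(i pi/2) = i, which later turns
    Y into - e^2.\<close>
  have half: "exp (of_real pi * \<i> / (2 * lq) * lq) = \<i>"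
  proof -
    have "of_real pi * \<i> / (2 * lq) * lq = \<i> * of_real (pi / 2)" using lq by simp
    then show ?thesis by (simp only: cis_conv_exp[symmetric] cis_pi_half)
  qed
  have last: "of_nat q powr (- w - 1 + of_real pi * \<i> / (2 * lq)) = \<i> / (of_nat q * of_nat q powr w)" for w
  proof -
    have "(- w - 1 + of_real pi * \<i> / (2 * lq)) * lq = of_real pi * \<i> / (2 * lq) * lq - (lq + w * lq)"
      by (simp add: algebra_simps)
    then show ?thesis unfolding q_powr by (simp only: exp_diff exp_add half eq)
  qed
  have n: "W (Suc m) = \<i> / (of_nat q * e)"
    "q_powers q (s_of_z (Suc m) q (tau (Suc m) z)) (Suc m) = \<i> / (of_nat q * of_nat q powr (- z (Suc m)))"
    using last[of "z (Suc m)"] last[of "- z (Suc m)"] by (simp_all add: W_def q_powers_def s_of_z_def tau_def e_def)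
  have inv: "of_nat q powr (- z (Suc m)) = inverse e" by (simp add: e_def q_powr exp_minus)
  have m: "q_powers q (s_of_z (Suc m) q (tau (Suc m) z)) m = W m * inverse e * inverse e"
  proof -
    have "(- z m - z (Suc m) - 1 + of_real pi * \<i> / lq) * lq =
      (- z m + z (Suc m) - 1 + of_real pi * \<i> / lq) * lq + (- z (Suc m) * lq) + (- z (Suc m) * lq)"
      by (simp add: algebra_simps)
    then have "exp ((- z m - z (Suc m) - 1 + of_real pi * \<i> / lq) * lq) =
      exp ((- z m + z (Suc m) - 1 + of_real pi * \<i> / lq) * lq) * exp (- z (Suc m) * lq) * exp (- z (Suc m) * lq)"
      by (simp only: exp_add)
    then show ?thesis
      unfolding inv[symmetric] q_powers_def W_def s_of_z_def tau_def q_powr by simp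
  qed
  consider "i = m" "m \<noteq> Suc m" | "i = Suc m" | "i < m" using i by fastforce
  then show "W i = point m W U (- \<i> * of_nat q * e) i"
  proof cases
    case 1
    then show ?thesis using eW q0 by (simp add: point_def U_def) (simp add: divide_inverse)
  next
    case 2
    have "1 / (- \<i> * of_nat q * e) = \<i> / (of_nat q * e)" using eW q0 by (simp add: field_simps)
    then show ?thesis using 2 n by (simp add: point_def)
  qed (simp add: point_def)
  consider "i = m" | "i = Suc m" | "i < m" using i by fastforce
  then show "q_powers q (s_of_z (Suc m) q (tau (Suc m) z)) i = point m W U (- \<i> * of_nat q / e) i"
  proof cases
    case 1
    have "- \<i> * of_nat q / e / (inverse (W m) * (- \<i> * of_nat q * e)) = W m * inverse e * inverse e"
      using eW q0 by (simp add: field_simps)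
    then show ?thesis using 1 m by (simp add: point_def U_def)
  next
    case 2
    have "1 / (- \<i> * of_nat q / e) = \<i> / (of_nat q * inverse e)" using eW q0 by (simp add: field_simps)
    then show ?thesis using 2 n inv by (simp add: point_def)
  next
    case 3
    then show ?thesis by (simp add: point_def W_def q_powers_def s_of_z_def tau_def)
  qed
qed

lemma functional_equation:
  fixes z :: "nat \<Rightarrow> complex"
  defines "V \<equiv> q_powers q (s_of_z (Suc m) q z)" and "V' \<equiv> q_powers q (s_of_z (Suc m) q (tau (Suc m) z))"
    and "e \<equiv> of_nat q powr z (Suc m)"
  shows "P V' * Q V * (of_nat q - e\<^sup>2) = (of_nat q * e\<^sup>2 - 1) * (Q V' * P V)"
proof -
  define t where "t = - \<i> * of_nat q * e"
  define U where "U = inverse (V m) * t"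
  have e: "e \<noteq> 0" "V m \<noteq> 0" "of_nat q \<noteq> (0 :: complex)" using q by (simp_all add: e_def V_def q_powers_def q_powr)
  then have nz: "t \<noteq> 0" "U \<noteq> 0" by (simp_all add: t_def U_def)
  have t': "- (of_nat q ^ 2) / t = - \<i> * of_nat q / e"
    using e by (simp add: t_def field_simps power2_eq_square)
  have y: "t\<^sup>2 / of_nat q ^ 2 = - e\<^sup>2" using e by (simp add: t_def power_mult_distrib)
  have V: "V i = point m V U t i" "V' i = point m V U (- (of_nat q ^ 2) / t) i" if "i \<in> {1..Suc m}" for i
    using s_of_z_point[OF that, of z] unfolding t' unfolding U_def t_def V_def V'_def e_def .
  have "P V = P (point m V U t)" "Q V = Q (point m V U t)"
    by (rule polynomial_fun_cong[OF P V(1)], assumption, rule polynomial_fun_cong[OF Q V(1)], assumption)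
  moreover have "P V' = P (point m V U (- (of_nat q ^ 2) / t))" "Q V' = Q (point m V U (- (of_nat q ^ 2) / t))"
    by (rule polynomial_fun_cong[OF P V(2)], assumption, rule polynomial_fun_cong[OF Q V(2)], assumption)
  ultimately have "P V' * Q V * (of_nat q - e\<^sup>2) + (1 - of_nat q * e\<^sup>2) * (Q V' * P V) = 0"
    using defect_zero[OF nz(2,1), of V] unfolding defect_def y by simp
  then show ?thesis by (simp add: algebra_simps)
qed

end

theorem theorem2p5:
  fixes p q n :: nat and Qp k :: "'a::field_char_0 set"
    and star :: "'a \<Rightarrow> 'a" and v :: "'a \<Rightarrow> real" and \<pi> :: 'a
    and M :: "'a mat measure" and x :: "'a mat"
    and P Q :: "(nat \<Rightarrow> complex) \<Rightarrow> complex" and z :: "nat \<Rightarrow> complex"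
  assumes "unramified_quadratic p Qp k star v \<pi>"
    and "q = residue_card v k"
    and "n \<ge> 1"
    and "normalized_Haar star v n M"
    and "x \<in> X_space star n"
    and "rational_continuation n q (omega star v n M x) P Q"
    and "Q (q_powers q (s_of_z n q z)) \<noteq> 0"
    and "Q (q_powers q (s_of_z n q (tau n z))) \<noteq> 0"
    and "of_nat q powr (2 * z n) \<noteq> of_nat q powr (-1)"
  shows "P (q_powers q (s_of_z n q z)) / Q (q_powers q (s_of_z n q z)) =
    (1 - of_nat q powr (-1 + 2 * z n)) / (of_nat q powr (2 * z n) - of_nat q powr (-1)) *
    (P (q_powers q (s_of_z n q (tau n z))) / Q (q_powers q (s_of_z n q (tau n z))))"
proof -
  obtain m where n: "n = Suc m" using assms(3) by (cases n) auto
  interpret unramified_quadratic p Qp k star v \<pi> by fact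
  interpret haar_setup p Qp k star v \<pi> m M x
    using assms(4,5) unfolding n by unfold_locales
  obtain a0 mu where "rational_series m q a0 (omega star v n M x) mu (\<lambda>X. P X * Q X) (\<lambda>X. Q X * Q X)"
    using omega_rational_series assms(6) unfolding n assms(2) by blast
  then interpret rational_series m q a0 "omega star v n M x" mu "\<lambda>X. P X * Q X" "\<lambda>X. Q X * Q X" .
  define V where "V = q_powers q (s_of_z n q z)"
  define V' where "V' = q_powers q (s_of_z n q (tau n z))"
  define e where "e = (of_nat q :: complex) powr z n"
  have nz: "Q V \<noteq> 0" "Q V' \<noteq> 0" using assms(7,8) by (simp_all add: V_def V'_def)
  have q0: "of_nat q \<noteq> (0 :: complex)" using pi_props(5) assms(2) by auto
  have pw: "of_nat q powr (2 * z n) = e\<^sup>2" "of_nat q powr (-1 + 2 * z n) = e\<^sup>2 / of_nat q"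
    "of_nat q powr (-1) = 1 / (of_nat q :: complex)"
  proof -
    show "of_nat q powr (2 * z n) = e\<^sup>2"
      unfolding e_def q_powr mult.assoc exp_double ..
    moreover show m1: "of_nat q powr (-1) = 1 / (of_nat q :: complex)"
      using q0 by (simp add: powr_minus divide_inverse)
    ultimately show "of_nat q powr (-1 + 2 * z n) = e\<^sup>2 / of_nat q"
      unfolding powr_add by simp
  qed
  have e: "of_nat q * e\<^sup>2 - 1 \<noteq> 0"
    using assms(9) q0 unfolding pw by (auto simp: field_simps)
  \<comment> \<open>This is the functional equation for P Q and Q^2. The surplus factors Q at the
    two points are nonzero by hypothesis and cancel.\<close>
  have "P V' * Q V' * (Q V * Q V) * (of_nat q - e\<^sup>2) = (of_nat q * e\<^sup>2 - 1) * ((Q V' * Q V') * (P V * Q V))"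
    using functional_equation[of z] unfolding V_def V'_def e_def n .
  then have "(Q V * Q V') * (P V' * Q V * (of_nat q - e\<^sup>2)) = (Q V * Q V') * ((of_nat q * e\<^sup>2 - 1) * (Q V' * P V))"
    by (simp only: mult_ac)
  then have "P V' * Q V * (of_nat q - e\<^sup>2) = (of_nat q * e\<^sup>2 - 1) * (Q V' * P V)"
    using nz by simp
  then have "P V / Q V = (of_nat q - e\<^sup>2) / (of_nat q * e\<^sup>2 - 1) * (P V' / Q V')"
    using nz e by (simp add: divide_simps) (simp only: mult_ac)
  moreover have "(of_nat q - e\<^sup>2) / (of_nat q * e\<^sup>2 - 1) = (1 - e\<^sup>2 / of_nat q) / (e\<^sup>2 - 1 / of_nat q)"
  proof -
    have "(1 - e\<^sup>2 / of_nat q) / (e\<^sup>2 - 1 / of_nat q) = (of_nat q * (1 - e\<^sup>2 / of_nat q)) / (of_nat q * (e\<^sup>2 - 1 / of_nat q))"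
      using q0 by simp
    then show ?thesis using q0 by (simp add: right_diff_distrib)
  qed
  ultimately show ?thesis unfolding V_def V'_def pw by simp
qed

end
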